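(* Let $\alpha>0$ and let $\rho,\nu$ be $\sigma$-finite measures on $\mathbb R^d$ such that $\rho(\{\mathbf x:\ x_i=0\})=0$ for every $i=1,\ldots,d$, and such that $\nu\circledast\rho\in{\rm RV}(\alpha,\mu)$. Assume that for some $0<\delta'<\alpha$, $$\int_{\mathbb R^d}\bigl(\|\mathbf y\|^{\alpha-\delta'}\vee\|\mathbf y\|^{\alpha+\delta'}\bigr)\,\rho(d\mathbf y)<\infty,$$ that for each $j=1,\ldots,d$, $$\lim_{b\downarrow 0}\limsup_{s\to\infty}\frac{\int_{0<|y_j|\le b}\rho(\{\mathbf x:\ |x_j|>s/|y_j|\})\,\nu(d\mathbf y)}{(\nu\circledast\rho)(\{\mathbf x:\ \|\mathbf x\|>s\})}=0,$$ and that $$\int_{\mathbb R^d}|x_j|^{\alpha}\prod_{k=1}^d|x_k|^{i\theta_k}\prod_{k=1}^d({\rm sign}(x_k))^{m_k}\,\rho(d\mathbf x)\neq 0$$ for each $j=1,\ldots,d$, all $m_1,\ldots,m_d\in\{0,1\}$ and all $\theta_1,\ldots,\theta_d\in\mathbb R$. Then the measure $\nu$ is regularly varying with index $\alpha$. Moreover, as $s\to\infty$, the measures $$\mu_s(\cdot)=\frac{\nu(s\,\cdot)}{(\nu\circledast\rho)(\{\mathbf x:\ \|\mathbf x\|>s\})},\qquad s\ge 1,$$ converge vaguely in $\overline{\mathbb R}_0^d$ to a measure $\mu_\ast$ satisfying $\mu_\ast\circledast\rho=\mu$.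
   Context: $\|\cdot\|$ is a fixed norm on $\mathbb R^d$; $a\vee b=\max(a,b)$; in exponents $i$ is the imaginary unit. $\mathbb R_0^d=\mathbb R^d\setminus\{\mathbf 0\}$, $\overline{\mathbb R}=[-\infty,\infty]$, $\overline{\mathbb R}_0^d=\overline{\mathbb R}^d\setminus\{\mathbf 0\}$. A Borel measure on $\overline{\mathbb R}_0^d$ is Radon if it is finite outside every ball of positive radius centered at the origin. Vague convergence in $\overline{\mathbb R}_0^d$ means convergence of integrals of all continuous functions with compact support in $\overline{\mathbb R}_0^d$ (so supports are bounded away from the origin but may include infinite points); measures on $\mathbb R^d$ are restricted to $\mathbb R_0^d\subset\overline{\mathbb R}_0^d$. Regular variation: a $\sigma$-finite Borel measure $\nu$ on $\mathbb R^d$ that is finite outside every ball of positive radius centered at the origin is regularly varying if there is a non-null Radon measure $\mu$ on $\overline{\mathbb R}_0^d$, not charging the set of infinite points, such that $\nu(s\,\cdot)/\nu(\{\mathbf y:\|\mathbf y\|>s\})\to\mu$ vaguely in $\overline{\mathbb R}_0^d$ as $s\to\infty$. Then $\mu(tA)=t^{-\alpha}\mu(A)$ for all $t>0$ and Borel $A$, for some $\alpha>0$, called the index; $\mu$ is the tail measure, and one writes $\nu\in{\rm RV}(\alpha,\mu)$. Multiplicative convolution: $(\nu\circledast\rho)(B)=\int_{\mathbb R^d}\nu(T_{\mathbf x}^{-1}(B))\,\rho(d\mathbf x)$ for Borel $B\subset\mathbb R^d$, where $T_{\mathbf x}={\rm diag}(\mathbf x)$ and $T_{\mathbf x}^{-1}(B)$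 is the preimage of $B$. In $\mu_\ast\circledast\rho=\mu$, the measure $\mu_\ast$ (which does not charge infinite points) is viewed as a measure on $\mathbb R^d$ with no mass at the origin, and the equality is between measures on $\mathbb R_0^d$. *)

theory Defs
  imports "HOL-Analysis.Analysis"
begin

definition is_norm :: "(real ^ 'd \<Rightarrow> real) \<Rightarrow> bool" where
  "is_norm N \<longleftrightarrow>
     (\<forall>x. N x = 0 \<longleftrightarrow> x = 0) \<and>
     (\<forall>c x. N (c *\<^sub>R x) = \<bar>c\<bar> * N x) \<and>
     (\<forall>x y. N (x + y) \<le> N x + N y)"

text \<open>The compactified space with the origin removed is the subset \<open>- {0}\<close> of
  \<open>ereal ^ 'd\<close>, which carries the product topology.\<close>

definition ext_space :: "(ereal ^ 'd) measure" where
  "ext_space = restrict_space borel (- {0})"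

definition ext :: "real ^ 'd \<Rightarrow> ereal ^ 'd" where
  "ext x = (\<chi> i. ereal (x $ i))"

definition infinite_points :: "(ereal ^ 'd) set" where
  "infinite_points = {x. \<exists>i. \<bar>x $ i\<bar> = \<infinity>}"

definition radon :: "(real ^ 'd \<Rightarrow> real) \<Rightarrow> (ereal ^ 'd) measure \<Rightarrow> bool" where
  "radon N M \<longleftrightarrow> sets M = sets ext_space \<and>
     (\<forall>r>0. emeasure M (- {0} - ext ` {x. N x < r}) < \<infinity>)"

text \<open>A measure on \<open>real ^ 'd\<close>, restricted to the complement of the origin and
  regarded as a measure on the compactified space without the origin.\<close>

definition to_ext :: "(real ^ 'd) measure \<Rightarrow> (ereal ^ 'd) measure" where
  "to_ext M = distr (restrict_space M (- {0})) ext_space ext"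

text \<open>Conversely, the finite part of a measure on the compactified space, regarded as a
  measure on \<open>real ^ 'd\<close> with no mass at the origin:
  \<open>emeasure (from_ext M) B = emeasure M (ext ` (B - {0}))\<close>.\<close>

definition from_ext :: "(ereal ^ 'd) measure \<Rightarrow> (real ^ 'd) measure" where
  "from_ext M = distr (restrict_space M (- infinite_points)) borel (\<lambda>x. \<chi> i. real_of_ereal (x $ i))"

text \<open>Continuous functions on \<open>- {0}\<close> with compact support; the support is the closure
  relative to \<open>- {0}\<close>.\<close>

definition Cc_ext :: "(ereal ^ 'd \<Rightarrow> real) set" where
  "Cc_ext = {f. continuous_on (- {0}) f \<and> compact (closure {x. x \<noteq> 0 \<and> f x \<noteq> 0} - {0})}"

text \<open>The integrals are Bochner integrals, which are genuine whenever the measures involved are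
  finite outside every ball centred at the origin (every \<open>f\<close> in \<open>Cc_ext\<close> is bounded and
  vanishes near the origin); finiteness is required separately where it matters.\<close>

definition vague_conv ::
  "('b \<Rightarrow> (ereal ^ 'd) measure) \<Rightarrow> (ereal ^ 'd) measure \<Rightarrow> 'b filter \<Rightarrow> bool" where
  "vague_conv M L F \<longleftrightarrow>
     (\<forall>f\<in>Cc_ext. ((\<lambda>s. integral\<^sup>L (M s) f) \<longlongrightarrow> integral\<^sup>L L f) F)"

text \<open>The measure \<open>A \<mapsto> M (s A)\<close>: the preimage of \<open>A\<close> under \<open>x \<mapsto> x / s\<close> is \<open>s A\<close>.\<close>

definition dilate :: "real \<Rightarrow> (real ^ 'd) measure \<Rightarrow> (real ^ 'd) measure" where
  "dilate s M = distr M borel (\<lambda>x. inverse s *\<^sub>R x)"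

text \<open>The measure \<open>A \<mapsto> M (s A) / c\<close> on the compactified space without the origin.\<close>

definition rescaled :: "(real ^ 'd) measure \<Rightarrow> ennreal \<Rightarrow> real \<Rightarrow> (ereal ^ 'd) measure" where
  "rescaled M c s = scale_measure (inverse c) (to_ext (dilate s M))"

definition tail_measure ::
  "(real ^ 'd \<Rightarrow> real) \<Rightarrow> (real ^ 'd) measure \<Rightarrow> (ereal ^ 'd) measure \<Rightarrow> bool" where
  "tail_measure N M L \<longleftrightarrow>
     sets M = sets borel \<and> sigma_finite_measure M \<and>
     (\<forall>r>0. emeasure M {x. N x \<ge> r} < \<infinity>) \<and>
     radon N L \<and> emeasure L (space L) \<noteq> 0 \<and> emeasure L infinite_points = 0 \<and>
     vague_conv (\<lambda>s. rescaled M (emeasure M {y. N y > s}) s) L at_top"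

definition homogeneous :: "(ereal ^ 'd) measure \<Rightarrow> real \<Rightarrow> bool" where
  "homogeneous L \<alpha> \<longleftrightarrow>
     (\<forall>t>0. \<forall>A\<in>sets L.
        emeasure L ((\<lambda>x. \<chi> i. ereal t * x $ i) ` A) = ennreal (t powr (- \<alpha>)) * emeasure L A)"

definition RV ::
  "(real ^ 'd \<Rightarrow> real) \<Rightarrow> (real ^ 'd) measure \<Rightarrow> real \<Rightarrow> (ereal ^ 'd) measure \<Rightarrow> bool" where
  "RV N M \<alpha> L \<longleftrightarrow> tail_measure N M L \<and> \<alpha> > 0 \<and> homogeneous L \<alpha>"

definition diag_map :: "real ^ 'd \<Rightarrow> real ^ 'd \<Rightarrow> real ^ 'd" where
  "diag_map x y = (\<chi> i. x $ i * y $ i)"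

text \<open>The integral below is countably additive in \<open>B\<close> when \<open>\<nu>\<close> is sigma-finite, by
  measurability of the integrand in \<open>x\<close>.\<close>

definition mult_conv ::
  "(real ^ 'd) measure \<Rightarrow> (real ^ 'd) measure \<Rightarrow> (real ^ 'd) measure" (infixl \<open>\<circledast>\<close> 70) where
  "\<nu> \<circledast> \<rho> = measure_of UNIV (sets borel) (\<lambda>B. \<integral>\<^sup>+ x. emeasure \<nu> (diag_map x -` B) \<partial>\<rho>)"

end

theory Submission
  imports Defs "HOL-Probability.Probability"
begin

text \<open>Testing is done on \<open>\<real>\<^sup>d\<close> with bounded continuous functions vanishing near the origin. Since \<open>\<rho>\<close>
  charges a set of vectors with all coordinates bounded away from zero, the tails of \<open>\<nu>\<close> are dominated by those of
  \<open>\<nu> \<circledast> \<rho>\<close>, for which Potter bounds hold; hence the measures \<open>\<mu>\<^sub>s\<close> are relatively compact. Every limit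
  point \<open>\<mu>\<^sub>*\<close> solves \<open>\<mu>\<^sub>* \<circledast> \<rho> = \<mu>\<close> by dominated convergence: the Potter bounds control large \<open>y\<close>, and the
  second hypothesis on \<open>\<rho>\<close> and \<open>\<nu>\<close> the remaining small ones.

  The equation has at most one solution. On the stratum of vectors whose nonzero coordinates are those in \<open>A \<ni> j\<close>,
  integrate it against \<open>\<chi>(z) \<bar>z\<^sub>j\<bar>\<^sup>\<alpha> g(ln \<bar>z\<^sub>j\<bar>)\<close> with \<open>\<chi>\<close> a multiplicative character.
  Here \<open>g\<close> is the Fourier transform of \<open>b / S\<close>, where \<open>b\<close> is a compactly supported twice differentiable bump and \<open>S\<close>
  is the integral of \<open>\<chi>(x) \<bar>x\<^sub>j\<bar>\<^sup>\<alpha> exp (i t ln \<bar>x\<^sub>j\<bar>)\<close> against \<open>\<rho>\<close>, which never vanishes. Integrating over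
  \<open>\<rho>\<close> cancels \<open>S\<close>, so that the Fourier coefficients of \<open>\<mu>\<^sub>*\<close>, weighted by the transform of \<open>b\<close>, are
  determined by \<open>\<mu>\<close>. Uniqueness turns subsequential into full convergence, and homogeneity of \<open>\<mu>\<^sub>*\<close> follows
  from regular variation of the normalization.\<close>

subsection \<open>Weak compactness\<close>

text \<open>The limit measures may be infinite near the origin and may charge coordinate
  hyperplanes. Infinite mass excludes an ordinary Fourier transform: a tail bound of order
  u^-\<alpha> gives, after multiplication by \<bar>z_j\<bar>^\<alpha>, only bounded mass per unit of
  ln \<bar>z_j\<bar>. So the kernel g has to be integrable in the logarithm, and decay of order 1/(1
  + v^2) suffices. It is bought by two derivatives of b/S; those of S cost logarithmic moments of
  \<rho>, up to the fourth in the form used here, which the two-sided moment condition supplies.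
  Hyperplanes force the strata: logarithms exist only for nonzero coordinates, and as \<rho>-almost
  every x has no zero coordinate, multiplication by x preserves each stratum. The transform of b is
  known to be positive only for \<bar>v\<bar> \<le> 1/c when b lives on [-c, c]; each c thus
  determines the limit on a logarithmic window only, and c tends to 0. Another obstacle lies at
  infinity: compactly supported functions on the punctured compactification extend to infinite
  points, bounded continuous functions need not. Tightness fills this gap, and it comes from the
  absence of mass of \<mu> at infinite points.\<close>

lemma ternary_digits:
  fixes d e :: "nat \<Rightarrow> real"
  assumes d: "\<And>n. d n = 0 \<or> d n = 1" and e: "\<And>n. e n = 0 \<or> e n = 1"
    and less: "\<bar>(\<Sum>n. d n * (1/3)^n) - (\<Sum>n. e n * (1/3)^n)\<bar> < (1/3)^m / 2"
    and k: "k \<le> m"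
  shows "d k = e k"
proof (rule ccontr)
  assume "d k \<noteq> e k"
  \<comment> \<open>At the first disagreement the term has size \<open>(1/3)^j\<close>, while
    everything after it sums to at most half of that. In base two the tail could cancel the term, in
    base three it cannot.\<close>
  define j where "j = (LEAST i. d i \<noteq> e i)"
  have j: "d j \<noteq> e j" unfolding j_def by (rule LeastI) fact
  have "j \<le> k" unfolding j_def by (rule Least_le) fact
  have before: "d i = e i" if "i < j" for i
    using not_less_Least[of i "\<lambda>i. d i \<noteq> e i"] that unfolding j_def by auto
  define c where "c n = (d n - e n) * (1/3)^n" for n
  have bd: "\<bar>c n\<bar> \<le> (1/3)^n" for n
    using d[of n] e[of n] by (auto simp: c_def abs_mult)
  have geo: "summable (\<lambda>n. (1/3::real)^n)" by (rule summable_geometric) simp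
  have bd_d: "norm (d n * (1/3)^n) \<le> (1/3)^n" for n using d[of n] by auto
  have bd_e: "norm (e n * (1/3)^n) \<le> (1/3)^n" for n using e[of n] by auto
  have sd: "summable (\<lambda>n. d n * (1/3)^n)"
    by (rule summable_comparison_test'[OF geo, of 0]) (metis bd_d)
  have se: "summable (\<lambda>n. e n * (1/3)^n)"
    by (rule summable_comparison_test'[OF geo, of 0]) (metis bd_e)
  have sc: "summable c"
    using summable_diff[OF sd se] by (simp add: c_def[abs_def] algebra_simps)
  have "(\<Sum>n. d n * (1/3)^n) - (\<Sum>n. e n * (1/3)^n) = suminf c"
    using suminf_diff[OF sd se] by (simp add: c_def[abs_def] algebra_simps)
  also have "\<dots> = (\<Sum>n. c (n + Suc j)) + sum c {..<Suc j}"
    by (rule suminf_split_initial_segment[OF sc])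
  also have "sum c {..<Suc j} = c j"
    using before by (simp add: c_def)
  finally have eq: "(\<Sum>n. d n * (1/3)^n) - (\<Sum>n. e n * (1/3)^n) = (\<Sum>n. c (n + Suc j)) + c j" .
  have geo': "(\<lambda>n. (1/3::real)^(n + Suc j)) sums ((1/3)^j / 2)"
    using sums_mult[OF geometric_sums[of "1/3::real"], of "(1/3)^Suc j"]
    by (simp add: power_add algebra_simps)
  have "\<bar>\<Sum>n. c (n + Suc j)\<bar> \<le> (\<Sum>n. (1/3)^(n + Suc j))"
    using norm_suminf_le[OF _ sums_summable[OF geo'], of "\<lambda>n. c (n + Suc j)"] bd
    by (metis real_norm_def)
  also have "\<dots> = (1/3)^j / 2" using geo' by (simp add: sums_iff)
  finally have tail: "\<bar>\<Sum>n. c (n + Suc j)\<bar> \<le> (1/3)^j / 2" .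
  have cj: "\<bar>c j\<bar> = (1/3)^j"
    using j d[of j] e[of j] by (auto simp: c_def abs_mult)
  have "(1/3::real)^m \<le> (1/3)^j"
    using \<open>j \<le> k\<close> k by (intro power_decreasing) auto
  then show False using less tail cj unfolding eq by linarith
qed

text \<open>The digits of the code of a point record its membership in the members of a countable base;
  by compactness, finitely many digits determine the point up to a prescribed error.\<close>

lemma compact_coding:
  fixes S :: "'a::euclidean_space set"
  assumes S: "compact S"
  obtains g :: "'a \<Rightarrow> real" and h :: "real \<Rightarrow> 'a"
  where "g \<in> borel_measurable borel" "\<And>x. 0 \<le> g x" "\<And>x. g x \<le> 2"
    "continuous_on UNIV h" "\<And>x. x \<in> S \<Longrightarrow> h (g x) = x"
proof -
  obtain B :: "'a set set" where B: "countable B" "topological_basis B"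
    using ex_countable_basis by blast
  have "B \<noteq> {}"
    using topological_basisE[OF B(2) open_UNIV, of undefined] by auto
  define U where "U = from_nat_into B"
  have rU: "range U = B" unfolding U_def using B(1) \<open>B \<noteq> {}\<close> by (rule range_from_nat_into[rotated])
  have opU: "open (U n)" for n using rU topological_basis_open[OF B(2)] by blast
  define e where "e x n = (if x \<in> U n then 1 else 0 :: real)" for x n
  define g where "g x = (\<Sum>n. e x n * (1/3)^n)" for x
  have geo: "summable (\<lambda>n. (1/3::real)^n)" by (rule summable_geometric) simp
  have sume: "summable (\<lambda>n. e x n * (1/3)^n)" for x
    by (rule summable_comparison_test'[OF geo, of 0]) (auto simp: e_def)
  have meas: "g \<in> borel_measurable borel"
    unfolding g_def[abs_def]
    by (intro borel_measurable_suminf borel_measurable_times borel_measurable_const)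
       (auto simp: e_def opU intro!: measurable_If borel_open)
  have g0: "0 \<le> g x" for x unfolding g_def by (intro suminf_nonneg sume) (auto simp: e_def)
  have g2: "g x \<le> 2" for x
  proof -
    have "g x \<le> (\<Sum>n. (1/3::real)^n)" unfolding g_def
      by (intro suminf_le sume geo) (auto simp: e_def)
    also have "\<dots> = 3/2" by (simp add: suminf_geometric)
    finally show ?thesis by simp
  qed
  have close: "\<exists>\<delta>>0. \<forall>x\<in>S. \<forall>y\<in>S. \<bar>g x - g y\<bar> < \<delta> \<longrightarrow> dist x y < \<epsilon>" if "\<epsilon> > 0" for \<epsilon>
  proof -
    \<comment> \<open>Indices of basic sets contained in a ball of radius \<epsilon>/2. Finitely
      many of these sets cover \<open>S\<close>, and points whose digits agree at those indices lie
      in a common one.\<close>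
    define C where "C = {n. \<exists>x. U n \<subseteq> ball x (\<epsilon>/2)}"
    have "S \<subseteq> (\<Union>n\<in>C. U n)"
    proof
      fix x assume "x \<in> S"
      obtain V where "V \<in> B" "x \<in> V" "V \<subseteq> ball x (\<epsilon>/2)"
        using topological_basisE[OF B(2) open_ball, of x x "\<epsilon>/2"] \<open>\<epsilon> > 0\<close> by auto
      moreover then obtain n where "V = U n" using rU by blast
      ultimately show "x \<in> (\<Union>n\<in>C. U n)" by (auto simp: C_def)
    qed
    then obtain D where D: "D \<subseteq> C" "finite D" "S \<subseteq> (\<Union>n\<in>D. U n)"
      using compactE_image[OF S, of C U] opU by auto
    define m where "m = Max (insert 0 D)"
    have m: "n \<le> m" if "n \<in> D" for n unfolding m_def using D(2) that by auto
    show ?thesis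
    proof (intro exI[of _ "(1/3)^m / 2"] conjI ballI impI)
      fix x y assume xy: "x \<in> S" "y \<in> S" "\<bar>g x - g y\<bar> < (1/3)^m / 2"
      obtain n where n: "n \<in> D" "x \<in> U n" using D(3) xy(1) by auto
      have "e x n = e y n"
        by (rule ternary_digits[where m=m]) (use xy(3) m[OF n(1)] in \<open>auto simp: e_def g_def\<close>)
      then have "y \<in> U n" using n by (auto simp: e_def split: if_splits)
      obtain z where "U n \<subseteq> ball z (\<epsilon>/2)" using n D(1) by (auto simp: C_def)
      then have "dist z x < \<epsilon>/2" "dist z y < \<epsilon>/2" using n(2) \<open>y \<in> U n\<close> by auto
      then show "dist x y < \<epsilon>" by (metis dist_commute dist_triangle_half_l)
    qed simp
  qed
  have inj: "inj_on g S"
  proof (rule inj_onI)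
    fix x y assume xy: "x \<in> S" "y \<in> S" "g x = g y"
    show "x = y"
    proof (rule ccontr)
      assume "x \<noteq> y"
      then obtain \<delta> where "\<delta> > 0" "\<forall>x'\<in>S. \<forall>y'\<in>S. \<bar>g x' - g y'\<bar> < \<delta> \<longrightarrow> dist x' y' < dist x y"
        using close[of "dist x y"] by auto
      then show False using xy by fastforce
    qed
  qed
  have uc: "uniformly_continuous_on (g ` S) (inv_into S g)"
    unfolding uniformly_continuous_on_def
  proof (intro allI impI)
    fix \<epsilon> :: real assume "\<epsilon> > 0"
    then obtain \<delta> where "\<delta> > 0" "\<forall>x\<in>S. \<forall>y\<in>S. \<bar>g x - g y\<bar> < \<delta> \<longrightarrow> dist x y < \<epsilon>"
      using close by blast
    then show "\<exists>d>0. \<forall>x\<in>g ` S. \<forall>x'\<in>g ` S. dist x' x < d \<longrightarrow> dist (inv_into S g x') (inv_into S g x) < \<epsilon>"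
      using inj by (intro exI[of _ \<delta>]) (auto simp: dist_real_def)
  qed
  \<comment> \<open>The decoder is needed on the whole line, because limits there are tested with
    functions defined everywhere: uniform continuity carries the inverse to the closure of the set
    of codes, and Dugundji's theorem extends it further.\<close>
  obtain k where k: "uniformly_continuous_on (closure (g ` S)) k"
      "\<And>x. x \<in> g ` S \<Longrightarrow> inv_into S g x = k x"
    using uniformly_continuous_on_extension_on_closure[OF uc] by metis
  obtain h where h: "continuous_on UNIV h" "\<And>x. x \<in> closure (g ` S) \<Longrightarrow> h x = k x"
    using Dugundji[of UNIV UNIV "closure (g ` S)" k] uniformly_continuous_imp_continuous[OF k(1)]
    by auto
  have "h (g x) = x" if "x \<in> S" for x
    using h(2)[of "g x"] k(2)[of "g x"] inj that closure_subset[of "g ` S"] by auto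
  with meas g0 g2 h(1) show ?thesis using that by blast
qed

text \<open>The Borel code moves the measures to a bounded interval of the line, where tight
  sequences of distributions have weakly convergent subsequences. The code need not be continuous,
  but its continuous left inverse \<open>h\<close> is enough: testing with \<open>f\<close> on
  \<open>S\<close> is testing with \<open>f \<circ> h\<close> on the line.\<close>

lemma weak_compactness_compact:
  fixes M :: "nat \<Rightarrow> 'a::euclidean_space measure"
  assumes S: "compact S" and sets: "\<And>n. sets (M n) = sets borel"
    and supp: "\<And>n. emeasure (M n) (- S) = 0" and C: "\<And>n. emeasure (M n) UNIV \<le> ennreal C"
  obtains r :: "nat \<Rightarrow> nat" and L :: "'a measure" where "strict_mono r" "sets L = sets borel"
    "emeasure L UNIV < \<infinity>"
    "\<And>f :: 'a \<Rightarrow> real. continuous_on UNIV f \<Longrightarrow> bounded (range f) \<Longrightarrow>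
        (\<lambda>n. integral\<^sup>L (M (r n)) f) \<longlonglongrightarrow> integral\<^sup>L L f"
proof -
  have sp: "space (M n) = UNIV" for n using sets_eq_imp_space_eq[OF sets[of n]] by simp
  have fin: "finite_measure (M n)" for n
    by (rule finite_measureI) (use C[of n] sp in \<open>auto simp: top_unique\<close>)
  define a where "a n = measure (M n) UNIV" for n
  have em: "emeasure (M n) UNIV = ennreal (a n)" for n
    unfolding a_def using finite_measure.emeasure_eq_measure[OF fin] by simp
  have a_le: "a n \<le> max C 0" for n
    using C[of n] unfolding em by (cases "C \<ge> 0") (auto simp: ennreal_neg ennreal_le_iff a_def)
  have "\<forall>n. a n \<in> {0..max C 0}" using a_le by (auto simp: a_def)
  then obtain a0 s where s: "strict_mono s" "(a \<circ> s) \<longlonglongrightarrow> a0"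
    using compact_Icc[of 0 "max C 0", THEN compact_imp_seq_compact]
    unfolding seq_compact_def by metis
  have a0: "a0 \<ge> 0" using s(2) by (rule LIMSEQ_le_const) (auto simp: a_def)
  show ?thesis
  proof (cases "a0 = 0")
    \<comment> \<open>Vanishing total mass cannot be normalised to probability measures; the limit
      is then the null measure.\<close>
    case True
    show ?thesis
    proof (rule that[of s "null_measure borel"])
      fix f :: "'a \<Rightarrow> real" assume f0: "continuous_on UNIV f" "bounded (range f)"
      then obtain B where f: "continuous_on UNIV f" "\<And>x. \<bar>f x\<bar> \<le> B" by (auto simp: bounded_iff)
      have "\<bar>integral\<^sup>L (M n) f\<bar> \<le> B * a n" for n
      proof -
        interpret finite_measure "M n" by fact
        have [measurable]: "f \<in> borel_measurable (M n)"
          using borel_measurable_continuous_onI[OF f(1)] sets[of n] measurable_cong_sets by blast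
        have "integrable (M n) f" by (rule integrable_const_bound[where B=B]) (use f in auto)
        then have "norm (integral\<^sup>L (M n) f) \<le> integral\<^sup>L (M n) (\<lambda>x. B)"
          using integral_norm_bound[of "M n" f] \<open>integrable (M n) f\<close> f(2)
          by (intro order.trans[OF integral_norm_bound[of "M n" f] integral_mono]) auto
        then show ?thesis by (simp add: a_def sp mult.commute)
      qed
      moreover have "(\<lambda>n. B * a (s n)) \<longlonglongrightarrow> 0"
        using tendsto_mult_left[OF s(2), of B] True by (simp add: o_def)
      ultimately have "(\<lambda>n. integral\<^sup>L (M (s n)) f) \<longlonglongrightarrow> 0"
        by (metis (no_types, lifting) Lim_null_comparison[where g="\<lambda>n. B * a (s n)"] always_eventually real_norm_def)
      then show "(\<lambda>n. integral\<^sup>L (M (s n)) f) \<longlonglongrightarrow> integral\<^sup>L (null_measure borel) f" by simp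
    qed (use s in auto)
  next
    case False
    then have "a0 > 0" using a0 by simp
    then have "eventually (\<lambda>n. a (s n) > 0) sequentially"
      using order_tendstoD(1)[OF s(2)] by (simp add: o_def)
    then obtain k where k: "\<And>n. n \<ge> k \<Longrightarrow> a (s n) > 0" by (auto simp: eventually_sequentially)
    define t where "t n = s (n + k)" for n
    have t: "strict_mono t" using s(1) by (auto simp: t_def strict_mono_def)
    have at: "a (t n) > 0" for n using k by (simp add: t_def)
    have lim: "(\<lambda>n. a (t n)) \<longlonglongrightarrow> a0"
      using LIMSEQ_ignore_initial_segment[OF s(2), of k] by (simp add: o_def t_def)
    obtain g :: "'a \<Rightarrow> real" and h where g[measurable]: "g \<in> borel_measurable borel"
      and g0: "\<And>x. 0 \<le> g x" "\<And>x. g x \<le> 2" and h: "continuous_on UNIV h" "\<And>x. x \<in> S \<Longrightarrow> h (g x) = x"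
      using compact_coding[OF S] by metis
    have [measurable]: "h \<in> borel_measurable borel" using h(1) by (rule borel_measurable_continuous_onI)
    have gM[measurable]: "g \<in> borel_measurable (M n)" for n
      using g sets[of n] measurable_cong_sets by blast
    define Q where "Q n = distr (density (M (t n)) (\<lambda>_. ennreal (1 / a (t n)))) borel g" for n
    have prob: "prob_space (Q n)" for n
    proof -
      have "emeasure (density (M (t n)) (\<lambda>_. ennreal (1 / a (t n)))) UNIV = 1"
        using at[of n] sp[of "t n"]
        by (subst emeasure_density) (auto simp: sp em nn_integral_cmult ennreal_mult[symmetric] sets)
      then have "prob_space (density (M (t n)) (\<lambda>_. ennreal (1 / a (t n))))"
        by (intro prob_spaceI) (simp add: sp)
      then show ?thesis unfolding Q_def by (rule prob_space.prob_space_distr) simp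
    qed
    have rd: "real_distribution (Q n)" for n
      unfolding real_distribution_def real_distribution_axioms_def using prob by (auto simp: Q_def)
    have "measure (Q n) {-1<..2} = 1" for n
    proof -
      have "AE x in Q n. x \<in> {-1<..2}"
        unfolding Q_def by (subst AE_distr_iff) (auto intro!: AE_I2 simp: order_trans[OF _ g0(1)] g0 less_le_trans[OF _ g0(1)])
      then show ?thesis
        using prob_space.prob_eq_1[OF prob, of "{-1<..2}" n] by (auto simp: Q_def)
    qed
    then have "tight Q" unfolding tight_def using rd
      by (intro conjI allI impI exI[of _ "-1::real"] exI[of _ "2::real"]) auto
    then obtain r P where r: "strict_mono r" "real_distribution P" "weak_conv_m (Q \<circ> id \<circ> r) P"
      using tight_imp_convergent_subsubsequence[of Q id] by (auto simp: strict_mono_id)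
    interpret P: real_distribution P by fact
    show ?thesis
    proof (rule that[of "t \<circ> r" "density (distr P borel h) (\<lambda>_. ennreal a0)"])
      show "strict_mono (t \<circ> r)" using t r(1) by (rule strict_mono_o)
      have "emeasure (density (distr P borel h) (\<lambda>_. ennreal a0)) UNIV = ennreal a0"
        using P.emeasure_space_1
        by (subst emeasure_density) (auto simp: emeasure_distr nn_integral_cmult)
      then show "emeasure (density (distr P borel h) (\<lambda>_. ennreal a0)) UNIV < \<infinity>" by simp
      fix f :: "'a \<Rightarrow> real" assume f0: "continuous_on UNIV f" "bounded (range f)"
      then obtain B where f: "continuous_on UNIV f" "\<And>x. \<bar>f x\<bar> \<le> B" by (auto simp: bounded_iff)
      have [measurable]: "f \<in> borel_measurable borel" using f(1) by (rule borel_measurable_continuous_onI)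
      have fM[measurable]: "f \<in> borel_measurable (M n)" for n
        using \<open>f \<in> borel_measurable borel\<close> sets[of n] measurable_cong_sets by blast
      have "continuous_on UNIV (\<lambda>x. f (h x))"
        using continuous_on_compose2[OF f(1) h(1)] by auto
      then have "(\<lambda>n. integral\<^sup>L ((Q \<circ> id \<circ> r) n) (\<lambda>x. f (h x))) \<longlonglongrightarrow> integral\<^sup>L P (\<lambda>x. f (h x))"
        by (intro weak_conv_imp_integral_bdd_continuous_conv[where B=B] r rd)
           (use f rd in \<open>auto simp: continuous_on_eq_continuous_at r\<close>)
      moreover have "integral\<^sup>L (Q n) (\<lambda>x. f (h x)) = (1 / a (t n)) * integral\<^sup>L (M (t n)) f" for n
      proof -
        have "integral\<^sup>L (Q n) (\<lambda>x. f (h x)) =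
            integral\<^sup>L (density (M (t n)) (\<lambda>_. ennreal (1 / a (t n)))) (\<lambda>x. f (h (g x)))"
          unfolding Q_def by (subst integral_distr) auto
        also have "\<dots> = integral\<^sup>L (M (t n)) (\<lambda>x. (1 / a (t n)) * f (h (g x)))"
          using at[of n] by (subst integral_real_density) auto
        \<comment> \<open>Decoding is exact only on \<open>S\<close>, which carries all the
          mass.\<close>
        also have "\<dots> = integral\<^sup>L (M (t n)) (\<lambda>x. (1 / a (t n)) * f x)"
        proof (rule integral_cong_AE)
          show "AE x in M (t n). (1 / a (t n)) * f (h (g x)) = (1 / a (t n)) * f x"
            by (rule AE_I'[of "- S"])
               (use h(2) supp[of "t n"] compact_imp_closed[OF S] in \<open>auto simp: null_sets_def sets intro!: borel_comp borel_closed\<close>)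
        qed auto
        finally show ?thesis by simp
      qed
      ultimately have "(\<lambda>n. a (t (r n)) * ((1 / a (t (r n))) * integral\<^sup>L (M (t (r n))) f))
          \<longlonglongrightarrow> a0 * integral\<^sup>L P (\<lambda>x. f (h x))"
        using LIMSEQ_subseq_LIMSEQ[OF lim r(1)] by (intro tendsto_mult) (auto simp: o_def)
      moreover have "a (t n) \<noteq> 0" for n using at[of n] by simp
      ultimately have "(\<lambda>n. integral\<^sup>L (M (t (r n))) f) \<longlonglongrightarrow> a0 * integral\<^sup>L P (\<lambda>x. f (h x))"
        by simp
      also have "a0 * integral\<^sup>L P (\<lambda>x. f (h x)) = integral\<^sup>L (density (distr P borel h) (\<lambda>_. ennreal a0)) f"
        using a0 by (subst integral_real_density) (auto simp: integral_distr)
      finally show "(\<lambda>n. integral\<^sup>L (M ((t \<circ> r) n)) f) \<longlonglongrightarrow>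
          integral\<^sup>L (density (distr P borel h) (\<lambda>_. ennreal a0)) f" by simp
    qed auto
  qed
qed


lemma tendsto_uniform_approx:
  fixes f :: "'b \<Rightarrow> real"
  assumes "\<And>e. e > 0 \<Longrightarrow> \<exists>g l'. (g \<longlongrightarrow> l') F \<and> eventually (\<lambda>x. \<bar>f x - g x\<bar> \<le> e) F \<and> \<bar>l - l'\<bar> \<le> e"
  shows "(f \<longlongrightarrow> l) F"
proof (rule tendstoI)
  fix e :: real assume "e > 0"
  then obtain g l' where g: "(g \<longlongrightarrow> l') F" "eventually (\<lambda>x. \<bar>f x - g x\<bar> \<le> e/4) F" "\<bar>l - l'\<bar> \<le> e/4"
    using assms[of "e/4"] by auto
  have "eventually (\<lambda>x. dist (g x) l' < e/4) F" using tendstoD[OF g(1), of "e/4"] \<open>e > 0\<close> by simp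
  with g(2) show "eventually (\<lambda>x. dist (f x) l < e) F"
  proof eventually_elim
    case (elim x)
    then show ?case using g(3) \<open>e > 0\<close> unfolding dist_real_def by arith
  qed
qed

lemma integral_cutoff_bound:
  fixes f k :: "'a \<Rightarrow> real"
  assumes "finite_measure M" and [measurable]: "f \<in> borel_measurable M" "k \<in> borel_measurable M" "A \<in> sets M"
    and f: "\<And>x. \<bar>f x\<bar> \<le> B" and k: "\<And>x. 0 \<le> k x" "\<And>x. k x \<le> 1" "\<And>x. x \<notin> A \<Longrightarrow> k x = 1"
  shows "\<bar>integral\<^sup>L M f - integral\<^sup>L M (\<lambda>x. f x * k x)\<bar> \<le> B * measure M A"
proof -
  interpret finite_measure M by fact
  have B: "0 \<le> B" using f[of undefined] by linarith
  have bd: "\<bar>f x * k x\<bar> \<le> B" for x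
    using mult_mono[OF f[of x], of "\<bar>k x\<bar>" 1] k[of x] B by (simp add: abs_mult)
  have i: "integrable M f" "integrable M (\<lambda>x. f x * k x)"
    by (rule integrable_const_bound[where B=B]; use f bd in simp)+
  have "\<bar>integral\<^sup>L M f - integral\<^sup>L M (\<lambda>x. f x * k x)\<bar> = \<bar>integral\<^sup>L M (\<lambda>x. f x - f x * k x)\<bar>"
    using i by simp
  also have "\<dots> \<le> integral\<^sup>L M (\<lambda>x. \<bar>f x - f x * k x\<bar>)" by (rule integral_abs_bound)
  also have "\<dots> \<le> integral\<^sup>L M (\<lambda>x. B * indicator A x)"
  proof (rule integral_mono)
    show "integrable M (\<lambda>x. \<bar>f x - f x * k x\<bar>)" using i by simp
    show "integrable M (\<lambda>x. B * indicator A x)" by (intro integrable_mult_right integrable_real_indicator) (auto simp: emeasure_eq_measure)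
    fix x
    have "f x - f x * k x = f x * (1 - k x)" by (simp add: algebra_simps)
    then have "\<bar>f x - f x * k x\<bar> = \<bar>f x\<bar> * (1 - k x)"
      using k(2)[of x] by (simp add: abs_mult)
    also have "\<dots> \<le> B * 1" using f[of x] k[of x] B by (intro mult_mono) auto
    finally show "\<bar>f x - f x * k x\<bar> \<le> B * indicator A x"
      using k(3)[of x] by (cases "x \<in> A") auto
  qed
  also have "\<dots> = B * measure M A" by simp
  finally show ?thesis .
qed

text \<open>The map \<open>T\<close> squeezes the space into the open unit ball, so that the compact
  case applies on the closed ball. Tightness makes the error of a cutoff \<open>k\<close> small
  uniformly in \<open>n\<close>, and after the cutoff the test function extends continuously by zero
  to the closed ball.\<close>

lemma prokhorov:
  fixes M :: "nat \<Rightarrow> 'a::euclidean_space measure"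
  assumes sets: "\<And>n. sets (M n) = sets borel" and C: "\<And>n. emeasure (M n) UNIV \<le> ennreal C"
    and tight: "\<And>e. e > 0 \<Longrightarrow> \<exists>R. \<forall>n. emeasure (M n) {x. norm x > R} \<le> ennreal e"
  obtains r :: "nat \<Rightarrow> nat" and L :: "'a measure" where "strict_mono r" "sets L = sets borel"
    "emeasure L UNIV < \<infinity>"
    "\<And>f :: 'a \<Rightarrow> real. continuous_on UNIV f \<Longrightarrow> bounded (range f) \<Longrightarrow>
        (\<lambda>n. integral\<^sup>L (M (r n)) f) \<longlonglongrightarrow> integral\<^sup>L L f"
proof -
  have sp: "space (M n) = UNIV" for n using sets_eq_imp_space_eq[OF sets[of n]] by simp
  have fin: "finite_measure (M n)" for n
    by (rule finite_measureI) (use C[of n] sp in \<open>auto simp: top_unique\<close>)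
  define T where "T y = y /\<^sub>R (1 + norm y)" for y :: 'a
  define G where "G u = u /\<^sub>R (1 - norm u)" for u :: 'a
  have nT: "norm (T y) = norm y / (1 + norm y)" for y
    by (simp add: T_def divide_inverse mult.commute add_nonneg_nonneg abs_of_nonneg)
  have nT1: "norm (T y) < 1" for y unfolding nT by (simp add: add_pos_nonneg)
  have GT: "G (T y) = y" for y
  proof -
    have nz: "1 + norm y \<noteq> 0" by (smt (verit) norm_ge_zero)
    then have "1 - norm y / (1 + norm y) = 1 / (1 + norm y)"
      by (simp add: divide_eq_eq diff_divide_eq_iff)
    moreover note nz
    ultimately show ?thesis unfolding G_def nT by (simp add: T_def)
  qed
  have nG: "norm (G u) = norm u / (1 - norm u)" if "norm u < 1" for u
    using that by (simp add: G_def divide_inverse mult.commute)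
  have Tm0[measurable]: "T \<in> borel_measurable borel" unfolding T_def[abs_def] by measurable
  have Gm[measurable]: "G \<in> borel_measurable borel" unfolding G_def[abs_def] by measurable
  have Tm[measurable]: "T \<in> borel_measurable (M n)" for n
    using Tm0 sets[of n] measurable_cong_sets by blast
  define Q where "Q n = distr (M n) borel T" for n
  have q0: "sets (Q n) = sets borel" for n by (simp add: Q_def)
  have q1: "emeasure (Q n) (- cball 0 1) = 0" for n
  proof -
    have "T -` (- cball 0 1) \<inter> space (M n) = {}" using nT1 by (auto simp: less_imp_le)
    then show ?thesis unfolding Q_def by (subst emeasure_distr) (auto simp: nT1)
  qed
  have q2: "emeasure (Q n) UNIV \<le> ennreal C" for n
    using C[of n] sp[of n] unfolding Q_def by (subst emeasure_distr) auto
  obtain r P where r: "strict_mono r" and P: "sets P = sets borel" "emeasure P UNIV < \<infinity>"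
    and lim: "\<And>f :: 'a \<Rightarrow> real. continuous_on UNIV f \<Longrightarrow> bounded (range f) \<Longrightarrow>
        (\<lambda>n. integral\<^sup>L (Q (r n)) f) \<longlonglongrightarrow> integral\<^sup>L P f"
    proof (rule weak_compactness_compact[where M=Q and C=C, OF compact_cball[of 0 1] q0 q1 q2])
    fix r :: "nat \<Rightarrow> nat" and P :: "'a measure"
    assume a: "strict_mono r" "sets P = sets borel" "emeasure P UNIV < \<infinity>"
      and b: "\<And>f :: 'a \<Rightarrow> real. continuous_on UNIV f \<Longrightarrow> bounded (range f) \<Longrightarrow>
        (\<lambda>n. integral\<^sup>L (Q (r n)) f) \<longlonglongrightarrow> integral\<^sup>L P f"
    show thesis by (rule that[OF a]) (rule b)
  qed
  have Gm'[measurable]: "G \<in> borel_measurable P"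
    using Gm P(1) measurable_cong_sets by blast
  \<comment> \<open>Only the open ball corresponds to points of the space; mass of \<open>P\<close>
    on the sphere would be mass at infinity and is discarded.\<close>
  define D where "D = density P (indicator (ball 0 1))"
  define L where "L = distr D borel G"
  have bP[measurable]: "ball 0 1 \<in> sets P" using P(1) by simp
  have spP: "space P = UNIV" using sets_eq_imp_space_eq[OF P(1)] by simp
  have UP: "UNIV \<in> sets P" using sets.top[of P] spP by simp
  have "emeasure L UNIV = emeasure P (ball 0 1)"
    unfolding L_def D_def by (simp add: emeasure_distr emeasure_density spP UP)
  also have "\<dots> \<le> emeasure P UNIV" by (rule emeasure_mono) (use P spP sets.top[of P] in auto)
  finally have Lfin: "emeasure L UNIV < \<infinity>" using P(2) by (metis order_le_less_trans)
  have finL: "finite_measure L" by (rule finite_measureI) (use Lfin in \<open>auto simp: L_def\<close>)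
  show ?thesis
  proof (rule that[OF r _ Lfin])
    show "sets L = sets borel" by (simp add: L_def)
    fix f :: "'a \<Rightarrow> real" assume f0: "continuous_on UNIV f" "bounded (range f)"
    then obtain B where f: "continuous_on UNIV f" "\<And>x. \<bar>f x\<bar> \<le> B" by (auto simp: bounded_iff)
    have fm[measurable]: "f \<in> borel_measurable borel" using f(1) by (rule borel_measurable_continuous_onI)
    have fM[measurable]: "f \<in> borel_measurable (M n)" for n
      using fm sets[of n] measurable_cong_sets by blast
    have B: "0 \<le> B" using f(2)[of undefined] by linarith
    show "(\<lambda>n. integral\<^sup>L (M (r n)) f) \<longlonglongrightarrow> integral\<^sup>L L f"
    proof (rule tendsto_uniform_approx)
      fix e :: real assume e: "e > 0"
      define e' where "e' = e / (B + 1)"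
      have e': "e' > 0" "B * e' \<le> e" using e B by (auto simp: e'_def field_simps)
      obtain R1 where R1: "\<And>n. emeasure (M n) {x. norm x > R1} \<le> ennreal e'" using tight[OF e'(1)] by auto
      have "(\<lambda>n. measure L {x. norm x > real n}) \<longlonglongrightarrow> measure L (\<Inter>n. {x. norm x > real n})"
        by (rule finite_measure.finite_Lim_measure_decseq[OF finL])
           (auto simp: L_def decseq_def)
      also have "(\<Inter>n. {x::'a. norm x > real n}) = {}"
      proof -
        have "\<exists>n. \<not> real n < norm x" for x :: 'a
          using real_arch_simple[of "norm x"] by (auto simp: not_less)
        then show ?thesis by auto
      qed
      finally have "eventually (\<lambda>n. measure L {x. norm x > real n} < e') sequentially"
        using e'(1) by (intro order_tendstoD(2)) auto
      then obtain R2 where R2: "measure L {x. norm x > real R2} < e'" by (auto simp: eventually_sequentially)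
      define R where "R = max 0 (max R1 (real R2))"
      define k where "k y = max 0 (min 1 (R + 1 - norm y))" for y :: 'a
      have k: "0 \<le> k y" "k y \<le> 1" "norm y \<le> R \<Longrightarrow> k y = 1" "norm y \<ge> R + 1 \<Longrightarrow> k y = 0" for y
        by (auto simp: k_def)
      have kc: "continuous_on UNIV k" unfolding k_def[abs_def] by (intro continuous_intros)
      have km[measurable]: "k \<in> borel_measurable borel" using kc by (rule borel_measurable_continuous_onI)
      have kM[measurable]: "k \<in> borel_measurable (M n)" for n
        using km sets[of n] measurable_cong_sets by blast
      define F where "F u = (if norm u < 1 then f (G u) * k (G u) else 0)" for u
      have Fb: "\<bar>F u\<bar> \<le> B" for u
        using mult_mono[OF f(2)[of "G u"], of "\<bar>k (G u)\<bar>" 1] k[of "G u"] B by (auto simp: F_def abs_mult)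
      have Fc: "continuous_on UNIV F"
      proof -
        \<comment> \<open>\<open>(R + 1) / (R + 2)\<close> is the norm of \<open>T y\<close> for
          \<open>norm y = R + 1\<close>, the radius from which \<open>k\<close> vanishes; the two
          open sets overlap in an annulus.\<close>
        have U: "(UNIV :: 'a set) = {u. norm u < 1} \<union> {u. norm u > (R + 1) / (R + 2)}"
        proof -
          have "(R + 1) / (R + 2) < 1" by (auto simp: R_def field_simps)
          then show ?thesis by (auto simp: not_less intro: less_le_trans)
        qed
        have F0: "F u = 0" if "norm u > (R + 1) / (R + 2)" for u
        proof (cases "norm u < 1")
          case True
          have "R + 2 > 0" by (auto simp: R_def)
          then have "norm u * (R + 2) > R + 1" using that by (simp add: pos_divide_less_eq)
          then have "norm (G u) \<ge> R + 1" unfolding nG[OF True] using True by (simp add: pos_le_divide_eq algebra_simps)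
          then show ?thesis using k(4) by (simp add: F_def)
        qed (simp add: F_def)
        show ?thesis
          unfolding U
        proof (rule continuous_on_open_Un)
          show "open {u::'a. norm u < 1}" by (intro open_Collect_less continuous_intros)
          show "open {u::'a. norm u > (R + 1) / (R + 2)}" by (intro open_Collect_less continuous_intros)
          have "continuous_on {u. norm u < 1} G" unfolding G_def[abs_def]
            by (intro continuous_intros) auto
          then have "continuous_on {u. norm u < 1} (\<lambda>u. f (G u) * k (G u))"
            by (intro continuous_intros continuous_on_compose2[OF f(1)] continuous_on_compose2[OF kc]) auto
          then show "continuous_on {u. norm u < 1} F"
            by (rule continuous_on_eq) (auto simp: F_def)
          show "continuous_on {u. norm u > (R + 1) / (R + 2)} F"
            by (rule continuous_on_eq[of _ "\<lambda>_. 0"]) (auto simp: F0)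
        qed
      qed
      have Fm[measurable]: "F \<in> borel_measurable borel" using Fc by (rule borel_measurable_continuous_onI)
      have FP[measurable]: "F \<in> borel_measurable P" using Fm P(1) measurable_cong_sets by blast
      have 1: "integral\<^sup>L (Q n) F = integral\<^sup>L (M n) (\<lambda>y. f y * k y)" for n
        unfolding Q_def by (subst integral_distr) (auto simp: F_def GT nT1)
      have 2: "integral\<^sup>L P F = integral\<^sup>L L (\<lambda>y. f y * k y)"
      proof -
        have "integral\<^sup>L L (\<lambda>y. f y * k y) = integral\<^sup>L D (\<lambda>u. f (G u) * k (G u))"
          unfolding L_def by (subst integral_distr) (auto simp: D_def)
        also have "\<dots> = integral\<^sup>L (density P (\<lambda>u. ennreal (indicator (ball 0 1) u))) (\<lambda>u. f (G u) * k (G u))"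
          by (simp add: D_def ennreal_indicator)
        also have "\<dots> = integral\<^sup>L P (\<lambda>u. indicator (ball 0 1) u * (f (G u) * k (G u)))"
          by (subst integral_real_density) auto
        also have "\<dots> = integral\<^sup>L P F"
          by (rule Bochner_Integration.integral_cong) (auto simp: F_def)
        finally show ?thesis by simp
      qed
      have Am: "{x. norm x > R} \<in> sets (M n)" for n unfolding sets by measurable
      have mM: "measure (M n) {x. norm x > R} \<le> e'" for n
      proof -
        have "emeasure (M n) {x. norm x > R} \<le> emeasure (M n) {x. norm x > R1}"
          by (rule emeasure_mono) (auto simp: R_def sets)
        then show ?thesis using R1[of n] e'(1) finite_measure.emeasure_eq_measure[OF fin]
          by (metis order_trans ennreal_le_iff less_imp_le)
      qed
      have bM: "\<bar>integral\<^sup>L (M n) f - integral\<^sup>L (M n) (\<lambda>y. f y * k y)\<bar> \<le> e" for n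
      proof -
        have "\<bar>integral\<^sup>L (M n) f - integral\<^sup>L (M n) (\<lambda>y. f y * k y)\<bar> \<le> B * measure (M n) {x. norm x > R}"
          by (rule integral_cutoff_bound[OF fin fM kM Am f(2) k(1) k(2)]) (use k(3) in auto)
        also have "\<dots> \<le> B * e'" using mM B by (intro mult_left_mono) auto
        finally show ?thesis using e'(2) by linarith
      qed
      have "measure L {x. norm x > R} \<le> measure L {x. norm x > real R2}"
        by (rule finite_measure.finite_measure_mono[OF finL]) (auto simp: R_def L_def)
      then have mL: "measure L {x. norm x > R} \<le> e'" using R2 by linarith
      have bL: "\<bar>integral\<^sup>L L f - integral\<^sup>L L (\<lambda>y. f y * k y)\<bar> \<le> e"
      proof -
        have "\<bar>integral\<^sup>L L f - integral\<^sup>L L (\<lambda>y. f y * k y)\<bar> \<le> B * measure L {x. norm x > R}"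
          by (rule integral_cutoff_bound[OF finL _ _ _ f(2) k(1) k(2)]) (use k(3) in \<open>auto simp: L_def\<close>)
        also have "\<dots> \<le> B * e'" using mL B by (intro mult_left_mono) auto
        finally show ?thesis using e'(2) by linarith
      qed
      have lF: "(\<lambda>n. integral\<^sup>L (Q (r n)) F) \<longlonglongrightarrow> integral\<^sup>L P F" by (rule lim[OF Fc]) (use Fb in \<open>auto simp: bounded_iff\<close>)
      show "\<exists>g l'. g \<longlonglongrightarrow> l' \<and> (\<forall>\<^sub>F n in sequentially. \<bar>integral\<^sup>L (M (r n)) f - g n\<bar> \<le> e) \<and> \<bar>integral\<^sup>L L f - l'\<bar> \<le> e"
        by (rule exI[of _ "\<lambda>n. integral\<^sup>L (M (r n)) (\<lambda>y. f y * k y)"], rule exI[of _ "integral\<^sup>L L (\<lambda>y. f y * k y)"])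
           (use lF[unfolded 1 2] bM bL in simp)
    qed
  qed
qed

section \<open>Measures finite away from the origin and the functions that test them\<close>

definition finite_away :: "'a::euclidean_space measure \<Rightarrow> bool" where
  "finite_away L \<longleftrightarrow> sets L = sets borel \<and> (\<forall>r>0. emeasure L {x. r \<le> norm x} < \<infinity>)"

text \<open>No behaviour at infinity is prescribed, in contrast with \<open>Cc_ext\<close>, whose
  members are continuous at the infinite points too. This makes the class stable under composition
  with every \<open>diag_map x\<close>.\<close>

definition away_test :: "('a::euclidean_space \<Rightarrow> real) set" where
  "away_test = {f. continuous_on UNIV f \<and> bounded (range f) \<and> (\<exists>r>0. \<forall>x. norm x < r \<longrightarrow> f x = 0)}"

lemma away_testE:
  assumes "f \<in> away_test"
  obtains B r where "continuous_on UNIV f" "f \<in> borel_measurable borel" "B > 0" "\<And>x. \<bar>f x\<bar> \<le> B" "r > 0"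
    "\<And>x. norm x < r \<Longrightarrow> f x = 0" "\<And>x. \<bar>f x\<bar> \<le> B * indicator {x. r \<le> norm x} x"
proof -
  obtain B0 r where *: "continuous_on UNIV f" "\<And>x. \<bar>f x\<bar> \<le> B0" "r > 0" "\<And>x. norm x < r \<Longrightarrow> f x = 0"
    using assms unfolding away_test_def bounded_iff by auto
  have "\<bar>f x\<bar> \<le> max 1 B0" for x using *(2)[of x] by simp
  moreover then have "\<bar>f x\<bar> \<le> max 1 B0 * indicator {x. r \<le> norm x} x" for x
    using *(4)[of x] by (auto simp: indicator_def)
  ultimately show ?thesis
    using that[of "max 1 B0" r] * borel_measurable_continuous_onI[OF *(1)] by auto
qed

lemma integrable_away_test:
  assumes L: "finite_away L" and f: "f \<in> away_test"
  shows "integrable L f"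
proof -
  obtain B r where *: "f \<in> borel_measurable borel" "r > 0" "\<And>x. \<bar>f x\<bar> \<le> B * indicator {x. r \<le> norm x} x"
    using away_testE[OF f] by metis
  have s: "sets L = sets borel" using L by (simp add: finite_away_def)
  have fm: "f \<in> borel_measurable L" using *(1) s measurable_cong_sets by blast
  have "integrable L (\<lambda>x. B * indicator {x. r \<le> norm x} x)"
    using L *(2) by (intro integrable_mult_right integrable_real_indicator) (auto simp: finite_away_def)
  then show ?thesis using fm
    by (rule Bochner_Integration.integrable_bound) (use *(3) in \<open>auto intro: order_trans[OF _ abs_ge_self]\<close>)
qed

text \<open>The Lipschitz functions \<open>f n\<close> decrease to the indicator of
  \<open>C\<close>. They become admissible tests once \<open>n\<close> is so large that their slope
  brings them to zero before they reach the ball of radius \<open>r/2\<close>.\<close>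

lemma emeasure_closed_away_eq:
  assumes L: "finite_away L1" "finite_away L2"
    and eq: "\<And>f. f \<in> away_test \<Longrightarrow> integral\<^sup>L L1 f = integral\<^sup>L L2 f"
    and C: "closed C" "r > 0" "\<And>x. x \<in> C \<Longrightarrow> r \<le> norm x"
  shows "emeasure L1 C = emeasure L2 C"
proof (cases "C = {}")
  case False
  define f where "f n x = max 0 (1 - real n * infdist x C)" for n x
  obtain N :: nat where N: "1 / (r/2) < real N" using reals_Archimedean2 by blast
  have N0: "real N > 0" using N C(2) by (smt (verit) divide_pos_pos)
  have fc: "continuous_on UNIV (f n)" for n
    unfolding f_def[abs_def] by (intro continuous_intros continuous_on_infdist)
  have fb: "0 \<le> f n x" "f n x \<le> 1" for n x by (auto simp: f_def infdist_nonneg)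
  have f0: "f n x = 0" if "n \<ge> N" "norm x < r/2" for n x
  proof -
    obtain c where c: "c \<in> C" "infdist x C = dist x c" using infdist_attains_inf[OF C(1) False] by blast
    have "r \<le> norm c" using C(3)[OF c(1)] .
    then have "infdist x C \<ge> r/2" unfolding c(2) using that(2) norm_triangle_ineq2[of c x]
      by (simp add: dist_norm norm_minus_commute)
    moreover have "real n * (r/2) \<ge> 1"
    proof -
      have "real N * (r/2) \<ge> 1" using N C(2) by (simp add: field_simps)
      moreover have "real N * (r/2) \<le> real n * (r/2)" using that(1) C(2) by (intro mult_right_mono) auto
      ultimately show ?thesis by linarith
    qed
    ultimately have "real n * infdist x C \<ge> 1" using mult_left_mono[of "r/2" "infdist x C" "real n"] by simp
    then show ?thesis by (simp add: f_def)
  qed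
  have test: "f n \<in> away_test" if "n \<ge> N" for n
    unfolding away_test_def mem_Collect_eq using fc f0[OF that] fb C(2)
    by (intro conjI boundedI[of _ 1] exI[of _ "r/2"]) auto
  have lim: "(\<lambda>n. f (n + N) x) \<longlonglongrightarrow> indicator C x" for x
  proof (cases "x \<in> C")
    case True then show ?thesis by (simp add: f_def)
  next
    case False
    then have "infdist x C > 0"
      using in_closed_iff_infdist_zero[OF C(1) \<open>C \<noteq> {}\<close>] infdist_nonneg[of x C] by fastforce
    then obtain K :: nat where K: "1 / infdist x C < real K" using reals_Archimedean2 by blast
    have "f (n + N) x = 0" if "n \<ge> K" for n
    proof -
      have "1 < real K * infdist x C" using K \<open>infdist x C > 0\<close> by (simp add: field_simps)
      also have "\<dots> \<le> real (n + N) * infdist x C" using that by (intro mult_right_mono) (auto simp: infdist_nonneg)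
      finally show ?thesis by (simp add: f_def)
    qed
    then have "eventually (\<lambda>n. f (n + N) x = indicator C x) sequentially"
      using False by (auto simp: eventually_sequentially)
    then show ?thesis by (rule tendsto_eventually)
  qed
  have main: "(\<lambda>n. integral\<^sup>L L (f (n + N))) \<longlonglongrightarrow> measure L C" if "finite_away L" for L
  proof -
    have s: "sets L = sets borel" using that by (simp add: finite_away_def)
    have sp: "space L = UNIV" using sets_eq_imp_space_eq[OF s] by simp
    have fm: "f n \<in> borel_measurable L" for n
      using borel_measurable_continuous_onI[OF fc] s measurable_cong_sets by blast
    have "(\<lambda>n. integral\<^sup>L L (f (n + N))) \<longlonglongrightarrow> integral\<^sup>L L (indicator C)"
    proof (rule integral_dominated_convergence[where w="indicator {x. r/2 \<le> norm x}"])
      show "indicator C \<in> borel_measurable L" using C(1) s by (intro borel_measurable_indicator) auto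
      show "integrable L (indicator {x. r/2 \<le> norm x} :: _ \<Rightarrow> real)"
      proof (rule integrable_real_indicator)
        show "emeasure L {x. r/2 \<le> norm x} < \<infinity>"
          using that half_gt_zero[OF C(2)] unfolding finite_away_def by blast
      qed (auto simp: s)
      show "AE x in L. norm (f (n + N) x) \<le> indicator {x. r/2 \<le> norm x} x" for n
        using fb f0[of "n + N"] by (intro AE_I2) (auto simp: indicator_def not_le)
    qed (use fm lim in auto)
    then show ?thesis by (simp add: sp)
  qed
  have "measure L1 C = measure L2 C"
    using main[OF L(1)] main[OF L(2)] eq[OF test] by (simp add: LIMSEQ_unique)
  moreover have "emeasure L C = ennreal (measure L C)" if "finite_away L" for L
  proof -
    have "emeasure L C \<le> emeasure L {x. r \<le> norm x}"
      using that C(3) by (intro emeasure_mono) (auto simp: finite_away_def)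
    also have "\<dots> < \<infinity>" using that C(2) by (auto simp: finite_away_def)
    finally show ?thesis by (intro emeasure_eq_ennreal_measure) auto
  qed
  ultimately show ?thesis using L by simp
qed auto

lemma finite_measure_eqI_closed:
  fixes M N :: "'a::topological_space measure"
  assumes "sets M = sets borel" "sets N = sets borel" "emeasure M UNIV < \<infinity>"
    and eq: "\<And>C. closed C \<Longrightarrow> emeasure M C = emeasure N C"
  shows "M = N"
proof (rule measure_eqI_generator_eq[where E="Collect closed" and \<Omega>=UNIV and A="\<lambda>_. UNIV"])
  show "Int_stable (Collect closed)" by (auto simp: Int_stable_def)
  show "sets M = sigma_sets UNIV (Collect closed)" "sets N = sigma_sets UNIV (Collect closed)"
    using assms by (simp_all add: borel_eq_closed)
qed (use assms in auto)

text \<open>Tests see nothing of the origin, so its mass is prescribed separately. Off the origin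
  the closed sets \<open>A k\<close> exhaust the space, and the restrictions to them are finite and
  agree on closed sets.\<close>

lemma measure_eqI_away_test:
  assumes L: "finite_away L1" "finite_away L2" and z: "emeasure L1 {0} = 0" "emeasure L2 {0} = 0"
    and eq: "\<And>f. f \<in> away_test \<Longrightarrow> integral\<^sup>L L1 f = integral\<^sup>L L2 f"
  shows "L1 = L2"
proof (rule measure_eqI)
  define A where "A k = {x::'a. 1 / real (Suc k) \<le> norm x}" for k
  have A[measurable]: "A k \<in> sets borel" for k unfolding A_def by measurable
  show "sets L1 = sets L2" using L by (simp add: finite_away_def)
  fix X assume "X \<in> sets L1"
  then have X[measurable]: "X \<in> sets borel" using L by (simp add: finite_away_def)
  define D where "D L k = density L (indicator (A k))" for L :: "'a measure" and k
  have em: "emeasure (D L k) Y = emeasure L (A k \<inter> Y)" if "finite_away L" "Y \<in> sets borel" for L k Y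
  proof -
    have s: "sets L = sets borel" using that by (simp add: finite_away_def)
    show ?thesis unfolding D_def using s that(2)
      by (subst emeasure_density)
         (auto simp: s indicator_inter_arith[symmetric] measurable_cong_sets[OF s refl])
  qed
  have "D L1 k = D L2 k" for k
  proof (rule finite_measure_eqI_closed)
    show "sets (D L1 k) = sets borel" "sets (D L2 k) = sets borel"
      using L by (auto simp: D_def finite_away_def)
    show "emeasure (D L1 k) UNIV < \<infinity>" using em[OF L(1), of UNIV k] L(1) by (auto simp: A_def finite_away_def)
    fix C :: "'a set" assume "closed C"
    then have "closed (A k \<inter> C)" unfolding A_def by (intro closed_Int closed_Collect_le continuous_intros)
    then have "emeasure L1 (A k \<inter> C) = emeasure L2 (A k \<inter> C)"
      by (intro emeasure_closed_away_eq[OF L, where r="1 / real (Suc k)"] eq) (auto simp: A_def)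
    then show "emeasure (D L1 k) C = emeasure (D L2 k) C" using em[OF L(1)] em[OF L(2)] \<open>closed C\<close> by simp
  qed
  then have k: "emeasure L1 (A k \<inter> X) = emeasure L2 (A k \<inter> X)" for k
    using em[OF L(1) X, of k] em[OF L(2) X, of k] by simp
  have lim: "(\<lambda>k. emeasure L (A k \<inter> X)) \<longlonglongrightarrow> emeasure L X" if "finite_away L" "emeasure L {0} = 0" for L
  proof -
    have s: "sets L = sets borel" using that by (simp add: finite_away_def)
    have "(\<lambda>k. emeasure L (A k \<inter> X)) \<longlonglongrightarrow> emeasure L (\<Union>k. A k \<inter> X)"
    proof (rule Lim_emeasure_incseq)
      show "range (\<lambda>k. A k \<inter> X) \<subseteq> sets L" by (auto simp: s)
      show "incseq (\<lambda>k. A k \<inter> X)"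
        by (auto simp: incseq_def A_def) (smt (verit) frac_le of_nat_le_iff of_nat_0_le_iff)
    qed
    also have "(\<Union>k. A k \<inter> X) = X - {0}"
    proof -
      have "\<exists>k. 1 / real (Suc k) \<le> norm x" if "x \<noteq> 0" for x :: 'a
        using that nat_approx_posE[of "norm x"] by (metis less_imp_le zero_less_norm_iff)
      then show ?thesis by (auto simp: A_def)
    qed
    also have "emeasure L (X - {0}) = emeasure L X"
      using that by (intro emeasure_Diff_null_set) (auto simp: s null_sets_def)
    finally show ?thesis .
  qed
  show "emeasure L1 X = emeasure L2 X"
    using lim[OF L(1) z(1)] lim[OF L(2) z(2)] unfolding k by (rule LIMSEQ_unique)
qed

lemma borel_measurable_vec_component[measurable (raw)]:
  fixes Z :: "'a \<Rightarrow> real^'n"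
  assumes "Z \<in> borel_measurable M" shows "(\<lambda>y. Z y $ k) \<in> borel_measurable M"
  using assms by (rule measurable_compose) (intro borel_measurable_continuous_onI continuous_intros)

lemma borel_measurable_vec_lambda[measurable (raw)]:
  fixes Z :: "'a \<Rightarrow> 'n::finite \<Rightarrow> real"
  assumes "\<And>k. (\<lambda>y. Z y k) \<in> borel_measurable M" shows "(\<lambda>y. \<chi> k. Z y k) \<in> borel_measurable M"
  by (subst borel_measurable_euclidean_space) (auto simp: Basis_vec_def inner_axis assms)

lemma axis_expansion: "(\<Sum>k\<in>UNIV. x $ k *\<^sub>R axis k 1) = (x :: real^'n)"
  by (simp add: vec_eq_iff axis_def if_distrib[of "\<lambda>z. _ * z"] cong: if_cong)

subsection \<open>Trigonometric polynomials and uniqueness\<close>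

text \<open>A multiplicative character in disguise: \<open>U\<close> stands for logarithms of
  absolute values and \<open>V\<close> for signs. Natural exponents \<open>m\<close>, rather than
  residues modulo two, keep the family closed under products even where a sign is recorded as
  0.\<close>

definition chr :: "('a \<Rightarrow> real^'n) \<Rightarrow> ('a \<Rightarrow> real^'n) \<Rightarrow> ('n \<Rightarrow> real) \<Rightarrow> ('n \<Rightarrow> nat) \<Rightarrow> 'a \<Rightarrow> complex" where
  "chr U V \<theta> m y = cis (\<Sum>k\<in>UNIV. \<theta> k * U y $ k) * (\<Prod>k\<in>UNIV. complex_of_real (V y $ k ^ m k))"

lemma chr_mult: "chr U V \<theta> m y * chr U V \<theta>' m' y = chr U V (\<lambda>k. \<theta> k + \<theta>' k) (\<lambda>k. m k + m' k) y"
  by (simp add: chr_def cis_mult[symmetric] power_add prod.distrib sum.distrib algebra_simps)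

lemma chr_measurable[measurable]:
  assumes [measurable]: "U \<in> borel_measurable M" "V \<in> borel_measurable M"
  shows "chr U V \<theta> m \<in> borel_measurable M"
proof -
  have "cis \<in> borel_measurable borel"
    by (intro borel_measurable_continuous_onI continuous_on_cis continuous_on_id)
  then have "(\<lambda>y. cis (\<Sum>k\<in>UNIV. \<theta> k * U y $ k)) \<in> borel_measurable M"
    by (rule measurable_compose[rotated]) measurable
  then show ?thesis unfolding chr_def[abs_def] by measurable
qed

lemma norm_chr_le:
  assumes "\<And>k. \<bar>V y $ k\<bar> \<le> 1"
  shows "cmod (chr U V \<theta> m y) \<le> 1"
proof -
  have "(\<Prod>k\<in>UNIV. \<bar>V y $ k\<bar> ^ m k) \<le> 1"
    using assms by (intro prod_le_1) (auto simp: power_le_one)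
  then show ?thesis by (simp add: chr_def norm_mult prod_norm[symmetric] norm_power power_abs)
qed

inductive trig :: "('a \<Rightarrow> real^'n) \<Rightarrow> ('a \<Rightarrow> real^'n) \<Rightarrow> ('a \<Rightarrow> complex) \<Rightarrow> bool" for U V where
  chr: "trig U V (chr U V \<theta> m)"
| add: "trig U V f \<Longrightarrow> trig U V g \<Longrightarrow> trig U V (\<lambda>y. f y + g y)"
| cmult: "trig U V f \<Longrightarrow> trig U V (\<lambda>y. c * f y)"

lemma trig_const: "trig U V (\<lambda>y. c)"
proof -
  have "chr U V (\<lambda>_. 0) (\<lambda>_. 0) = (\<lambda>y. 1)" by (auto simp: chr_def)
  then show ?thesis using trig.cmult[OF trig.chr[of U V "\<lambda>_. 0" "\<lambda>_. 0"], of c] by simp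
qed

lemma trig_sum: "finite I \<Longrightarrow> (\<And>i. i \<in> I \<Longrightarrow> trig U V (f i)) \<Longrightarrow> trig U V (\<lambda>y. \<Sum>i\<in>I. f i y)"
  by (induction I rule: finite_induct) (auto intro: trig.add trig_const)

lemma trig_mult_chr: "trig U V f \<Longrightarrow> trig U V (\<lambda>y. f y * chr U V \<theta> m y)"
proof (induction rule: trig.induct)
  case (chr \<theta>' m')
  then show ?case using trig.chr[of U V "\<lambda>k. \<theta>' k + \<theta> k" "\<lambda>k. m' k + m k"] by (simp add: chr_mult)
next
  case (add f g)
  then show ?case using trig.add[OF add.IH] by (simp add: distrib_right)
next
  case (cmult f c)
  then show ?case using trig.cmult[OF cmult.IH, of c] by (simp add: mult.assoc)
qed

lemma trig_mult: "trig U V g \<Longrightarrow> trig U V f \<Longrightarrow> trig U V (\<lambda>y. f y * g y)"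
proof (induction rule: trig.induct)
  case (chr \<theta> m)
  then show ?case by (rule trig_mult_chr)
next
  case (add g h)
  then show ?case using trig.add[OF add.IH] by (simp add: distrib_left)
next
  case (cmult g c)
  then show ?case using trig.cmult[OF cmult.IH, of c] by (simp add: mult.left_commute)
qed

lemma trig_sin: "trig U V (\<lambda>y. of_real (sin (a * U y $ k)))"
proof -
  let ?t = "\<lambda>b j. if j = k then b else (0::real)"
  have *: "chr U V (?t b) (\<lambda>_. 0) y = cis (b * U y $ k)" for b y
    by (simp add: chr_def if_distrib[of "\<lambda>x. x * _"] cong: if_cong)
  have "trig U V (\<lambda>y. (1 / (2 * \<i>)) * (chr U V (?t a) (\<lambda>_. 0) y + (-1) * chr U V (?t (-a)) (\<lambda>_. 0) y))"
    by (intro trig.intros)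
  also have "(\<lambda>y. (1 / (2 * \<i>)) * (chr U V (?t a) (\<lambda>_. 0) y + (-1) * chr U V (?t (-a)) (\<lambda>_. 0) y))
      = (\<lambda>y. of_real (sin (a * U y $ k)))"
    unfolding * by (auto simp: fun_eq_iff complex_eq_iff Re_divide Im_divide power2_eq_square)
  finally show ?thesis .
qed

lemma trig_sign: "trig U V (\<lambda>y. of_real (V y $ k))"
proof -
  have "chr U V (\<lambda>_. 0) (\<lambda>j. if j = k then 1 else 0) = (\<lambda>y. complex_of_real (V y $ k))"
    by (auto simp: chr_def fun_eq_iff if_distrib[of "\<lambda>i. _ ^ i"] cong: if_cong) (simp add: prod.delta if_distrib cong: if_cong)
  then show ?thesis using trig.chr[of U V "\<lambda>_. 0" "\<lambda>j. if j = k then 1 else 0"] by simp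
qed

text \<open>A linear form is a combination of the coordinates, each of which is a character or a
  multiple of a difference of two; products stay in the span. Sines replace the unbounded
  \<open>U\<close> by arguments ranging over a compact box, where polynomials approximate.\<close>

lemma trig_polynomial:
  fixes U V :: "'a \<Rightarrow> real^'n"
  assumes "real_polynomial_function p"
  shows "trig U V (\<lambda>y. complex_of_real (p (\<chi> k. sin (a * U y $ k), V y)))"
  using assms
proof (induction rule: real_polynomial_function.induct)
  case (linear f)
  interpret f: bounded_linear f by fact
  have sc: "f (c *\<^sub>R x, 0) = c * f (x, 0)" "f (0, c *\<^sub>R x) = c * f (0, x)" for c x
    using f.scaleR[of c "(x, 0)"] f.scaleR[of c "(0, x)"] by simp_all
  have feq: "f (u, v) = (\<Sum>k\<in>UNIV. f (axis k 1, 0) * u $ k) + (\<Sum>k\<in>UNIV. f (0, axis k 1) * v $ k)"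
    for u v :: "real^'n"
  proof -
    have "(u, v) = (\<Sum>k\<in>UNIV. (u $ k *\<^sub>R axis k 1, 0)) + (\<Sum>k\<in>UNIV. (0, v $ k *\<^sub>R axis k 1))"
      by (simp add: prod_eq_iff fst_sum snd_sum axis_expansion)
    then have "f (u, v) = f ((\<Sum>k\<in>UNIV. (u $ k *\<^sub>R axis k 1, 0)) + (\<Sum>k\<in>UNIV. (0, v $ k *\<^sub>R axis k 1)))"
      by simp
    also have "\<dots> = (\<Sum>k\<in>UNIV. f (u $ k *\<^sub>R axis k 1, 0)) + (\<Sum>k\<in>UNIV. f (0, v $ k *\<^sub>R axis k 1))"
      unfolding f.add f.sum ..
    finally show ?thesis by (simp add: sc mult.commute)
  qed
  have "(\<lambda>y. complex_of_real (f (\<chi> k. sin (a * U y $ k), V y))) =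
      (\<lambda>y. (\<Sum>k\<in>UNIV. of_real (f (axis k 1, 0)) * of_real (sin (a * U y $ k))) +
           (\<Sum>k\<in>UNIV. of_real (f (0, axis k 1)) * of_real (V y $ k)))"
    by (rule ext, subst feq) simp
  moreover have "trig U V (\<lambda>y. (\<Sum>k\<in>UNIV. of_real (f (axis k 1, 0)) * of_real (sin (a * U y $ k))) +
           (\<Sum>k\<in>UNIV. of_real (f (0, axis k 1)) * of_real (V y $ k)))"
    by (rule trig.add; rule trig_sum[OF finite]; rule trig.cmult; rule trig_sin trig_sign)
  ultimately show ?case by metis
next
  case (const c)
  then show ?case by (simp add: trig_const)
next
  case (add f g)
  then show ?case using trig.add[OF add.IH] by simp
next
  case (mult f g)
  then show ?case using trig_mult[OF mult.IH(2,1)] by simp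
qed

text \<open>Integrability travels with the equality, since the additive step of the induction uses
  it.\<close>

lemma trig_integral_eq:
  fixes U V :: "'a \<Rightarrow> real^'n" and w :: "'a \<Rightarrow> real"
  assumes "sets M1 = sets M2"
    and [measurable]: "U \<in> borel_measurable M1" "V \<in> borel_measurable M1"
    and V: "\<And>y k. \<bar>V y $ k\<bar> \<le> 1"
    and w: "integrable M1 w" "integrable M2 w"
    and eq: "\<And>\<theta> m. integral\<^sup>L M1 (\<lambda>y. of_real (w y) * chr U V \<theta> m y) = integral\<^sup>L M2 (\<lambda>y. of_real (w y) * chr U V \<theta> m y)"
    and "trig U V f"
  shows "integrable M1 (\<lambda>y. of_real (w y) * f y) \<and> integrable M2 (\<lambda>y. of_real (w y) * f y) \<and>
    integral\<^sup>L M1 (\<lambda>y. of_real (w y) * f y) = integral\<^sup>L M2 (\<lambda>y. of_real (w y) * f y)"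
  using \<open>trig U V f\<close>
proof (induction rule: trig.induct)
  case (chr \<theta> m)
  have UV2[measurable]: "U \<in> borel_measurable M2" "V \<in> borel_measurable M2"
    using assms(1-3) measurable_cong_sets by blast+
  have "integrable M (\<lambda>y. of_real (w y) * chr U V \<theta> m y)" if "integrable M w"
    "chr U V \<theta> m \<in> borel_measurable M" for M
    by (rule Bochner_Integration.integrable_bound[OF that(1)])
       (use that norm_chr_le[where V=V, OF V] in \<open>auto simp: norm_mult mult_left_le\<close>)
  then show ?case using w eq by auto
next
  case (add f g)
  then show ?case by (simp add: distrib_left)
next
  case (cmult f c)
  then show ?case by (simp add: mult.left_commute)
qed

text \<open>The derivative of the sine at 0. Convergence is only pointwise in \<open>u\<close>,
  which is all that dominated convergence will ask for.\<close>

lemma sin_scaled_tendsto: "(\<lambda>n. real (Suc n) * sin ((1 / real (Suc n)) * u)) \<longlonglongrightarrow> u"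
proof -
  have "((\<lambda>h. (sin (u * (0 + h)) - sin (u * 0)) / h) \<longlongrightarrow> u) (at 0)"
    using DERIV_chain2[OF DERIV_sin DERIV_cmult_Id[of u], of 0 UNIV] unfolding DERIV_def by simp
  moreover have "filterlim (\<lambda>n. 1 / real (Suc n)) (at 0) sequentially"
    by (intro filterlim_atI LIMSEQ_Suc[OF lim_1_over_n]) auto
  ultimately have "(\<lambda>n. sin (u * (1 / real (Suc n))) / (1 / real (Suc n))) \<longlonglongrightarrow> u"
    by (auto dest: filterlim_compose)
  then show ?thesis by (simp add: mult.commute)
qed

text \<open>A bounded continuous function of the arguments \<open>L sin (u / L)\<close> is uniformly approximable by
  trigonometric polynomials on the whole space, not only on a period; then \<open>L \<rightarrow> \<infinity>\<close>.\<close>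

lemma integral_eq_if_characters_eq:
  fixes U V :: "'a \<Rightarrow> real^'n" and w :: "'a \<Rightarrow> real" and f :: "(real^'n) \<times> (real^'n) \<Rightarrow> real"
  assumes s: "sets M1 = sets M2"
    and UV: "U \<in> borel_measurable M1" "V \<in> borel_measurable M1"
    and V: "\<And>y k. \<bar>V y $ k\<bar> \<le> 1"
    and w: "integrable M1 w" "integrable M2 w"
    and eq: "\<And>\<theta> m. integral\<^sup>L M1 (\<lambda>y. of_real (w y) * chr U V \<theta> m y) = integral\<^sup>L M2 (\<lambda>y. of_real (w y) * chr U V \<theta> m y)"
    and f: "continuous_on UNIV f" "\<And>z. \<bar>f z\<bar> \<le> B"
  shows "integral\<^sup>L M1 (\<lambda>y. w y * f (U y, V y)) = integral\<^sup>L M2 (\<lambda>y. w y * f (U y, V y))"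
proof -
  have UV2: "U \<in> borel_measurable M2" "V \<in> borel_measurable M2"
    using s UV measurable_cong_sets by blast+
  define T where "T n y = (\<chi> k. real (Suc n) * sin ((1 / real (Suc n)) * U y $ k), V y)" for n y
  have fT: "(\<lambda>y. f (T n y)) \<in> borel_measurable M" "(\<lambda>y. f (U y, V y)) \<in> borel_measurable M"
    if "U \<in> borel_measurable M" "V \<in> borel_measurable M" for n M
  proof -
    note [measurable] = that
    have [measurable]: "f \<in> borel_measurable (borel \<Otimes>\<^sub>M borel)"
      using borel_measurable_continuous_onI[OF f(1)] by (simp add: borel_prod)
    have "(\<lambda>y. \<chi> k. real (Suc n) * sin ((1 / real (Suc n)) * U y $ k)) \<in> borel_measurable M"
      by measurable
    then have "T n \<in> M \<rightarrow>\<^sub>M borel \<Otimes>\<^sub>M borel" unfolding T_def[abs_def] by measurable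
    then show "(\<lambda>y. f (T n y)) \<in> borel_measurable M" by measurable
    show "(\<lambda>y. f (U y, V y)) \<in> borel_measurable M" by measurable
  qed
  have iw: "integrable M (\<lambda>y. w y * h y)" if "integrable M w" "h \<in> borel_measurable M" "\<And>y. \<bar>h y\<bar> \<le> B'" for M B' and h :: "'a \<Rightarrow> real"
    by (rule Bochner_Integration.integrable_bound[of M "\<lambda>y. B' * w y"])
       (use that in \<open>auto simp: abs_mult mult.commute intro!: mult_mono' order.trans[OF that(3) abs_ge_self]\<close>)
  define C where "C = integral\<^sup>L M1 (\<lambda>y. \<bar>w y\<bar>) + integral\<^sup>L M2 (\<lambda>y. \<bar>w y\<bar>)"
  have "C \<ge> 0" by (simp add: C_def)
  have step: "integral\<^sup>L M1 (\<lambda>y. w y * f (T n y)) = integral\<^sup>L M2 (\<lambda>y. w y * f (T n y))" for n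
  proof -
    \<comment> \<open>Rescaling puts sines and signs into one fixed box for all \<open>y\<close>. A
      polynomial close to \<open>F\<close> on this box gives a trigonometric polynomial uniformly
      close to \<open>f (T n y)\<close>, and the error is weighted by \<open>w\<close>
      alone.\<close>
    define F where "F z = f (real (Suc n) *\<^sub>R fst z, snd z)" for z
    have Fc: "continuous_on UNIV F"
      unfolding F_def[abs_def] by (intro continuous_on_compose2[OF f(1)] continuous_intros) auto
    let ?I = "cbox (\<chi> k. - 1) (\<chi> k. 1) :: (real^'n) set"
    have "\<bar>integral\<^sup>L M1 (\<lambda>y. w y * f (T n y)) - integral\<^sup>L M2 (\<lambda>y. w y * f (T n y))\<bar> \<le> e * C" if "e > 0" for e
    proof -
      have KF: "compact (?I \<times> ?I)" "continuous_on (?I \<times> ?I) F"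
        using compact_Times[OF compact_cbox compact_cbox] continuous_on_subset[OF Fc subset_UNIV] by blast+
      obtain p where p: "real_polynomial_function p" "\<And>z. z \<in> ?I \<times> ?I \<Longrightarrow> \<bar>F z - p z\<bar> < e"
        using Stone_Weierstrass_real_polynomial_function[OF KF \<open>e > 0\<close>] by metis
      define q where "q y = p (\<chi> k. sin ((1 / real (Suc n)) * U y $ k), V y)" for y
      have fT_F: "f (T n y) = F (\<chi> k. sin ((1 / real (Suc n)) * U y $ k), V y)" for y
        by (auto simp: F_def T_def vec_eq_iff intro!: arg_cong[where f=f])
      have close: "\<bar>f (T n y) - q y\<bar> \<le> e" for y
      proof -
        have "\<bar>F (\<chi> k. sin ((1 / real (Suc n)) * U y $ k), V y) - q y\<bar> < e"
          unfolding q_def using V by (intro p(2)) (auto simp: mem_box_cart abs_le_iff minus_le_iff)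
        then show ?thesis unfolding fT_F by simp
      qed
      have q: "integrable M1 (\<lambda>y. w y * q y)" "integrable M2 (\<lambda>y. w y * q y)"
        "integral\<^sup>L M1 (\<lambda>y. w y * q y) = integral\<^sup>L M2 (\<lambda>y. w y * q y)"
        using trig_integral_eq[OF s UV V w eq trig_polynomial[OF p(1)], of "1 / real (Suc n)"]
        unfolding q_def[symmetric] of_real_mult[symmetric] complex_of_real_integrable_eq
        by (auto simp: integral_complex_of_real simp del: of_real_mult)
      have bd: "\<bar>integral\<^sup>L M (\<lambda>y. w y * f (T n y)) - integral\<^sup>L M (\<lambda>y. w y * q y)\<bar> \<le> e * integral\<^sup>L M (\<lambda>y. \<bar>w y\<bar>)"
        if "integrable M w" "integrable M (\<lambda>y. w y * q y)" "U \<in> borel_measurable M" "V \<in> borel_measurable M" for M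
      proof -
        have i: "integrable M (\<lambda>y. w y * f (T n y))" by (rule iw[OF that(1) fT(1)[OF that(3,4)] f(2)])
        have "\<bar>integral\<^sup>L M (\<lambda>y. w y * f (T n y)) - integral\<^sup>L M (\<lambda>y. w y * q y)\<bar> =
            \<bar>integral\<^sup>L M (\<lambda>y. w y * f (T n y) - w y * q y)\<bar>" using i that(2) by simp
        also have "\<dots> \<le> integral\<^sup>L M (\<lambda>y. \<bar>w y * f (T n y) - w y * q y\<bar>)" by (rule integral_abs_bound)
        also have "\<dots> \<le> integral\<^sup>L M (\<lambda>y. e * \<bar>w y\<bar>)"
        proof (rule integral_mono)
          show "\<bar>w y * f (T n y) - w y * q y\<bar> \<le> e * \<bar>w y\<bar>" for y
            using mult_left_mono[OF close[of y], of "\<bar>w y\<bar>"] by (simp add: abs_mult[symmetric] algebra_simps)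
        qed (use i that in auto)
        finally show ?thesis by simp
      qed
      show ?thesis using bd[OF w(1) q(1) UV] bd[OF w(2) q(2) UV2] q(3)
        unfolding C_def by (simp add: distrib_left)
    qed
    then have "\<bar>integral\<^sup>L M1 (\<lambda>y. w y * f (T n y)) - integral\<^sup>L M2 (\<lambda>y. w y * f (T n y))\<bar> \<le> 0 + e" if "e > 0" for e
    proof -
      have "e / (C + 1) * C \<le> e" using \<open>C \<ge> 0\<close> that by (simp add: field_simps)
      then show ?thesis using \<open>C \<ge> 0\<close> that
          \<open>\<And>e. e > 0 \<Longrightarrow> \<bar>integral\<^sup>L M1 (\<lambda>y. w y * f (T n y)) - integral\<^sup>L M2 (\<lambda>y. w y * f (T n y))\<bar> \<le> e * C\<close>[of "e / (C + 1)"]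
        by (simp add: divide_pos_pos)
    qed
    then have "\<bar>integral\<^sup>L M1 (\<lambda>y. w y * f (T n y)) - integral\<^sup>L M2 (\<lambda>y. w y * f (T n y))\<bar> \<le> 0"
      by (rule field_le_epsilon)
    then show ?thesis by simp
  qed
  have lim: "(\<lambda>n. integral\<^sup>L M (\<lambda>y. w y * f (T n y))) \<longlonglongrightarrow> integral\<^sup>L M (\<lambda>y. w y * f (U y, V y))"
    if "integrable M w" "U \<in> borel_measurable M" "V \<in> borel_measurable M" for M
  proof (rule integral_dominated_convergence[where w="\<lambda>y. B * \<bar>w y\<bar>"])
    have "(\<lambda>n. T n y) \<longlonglongrightarrow> (U y, V y)" for y
      unfolding T_def by (intro tendsto_Pair tendsto_const vec_tendstoI) (use sin_scaled_tendsto in simp)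
    then have "(\<lambda>n. f (T n y)) \<longlonglongrightarrow> f (U y, V y)" for y
      by (rule continuous_on_tendsto_compose[OF f(1)]) auto
    then show "AE y in M. (\<lambda>n. w y * f (T n y)) \<longlonglongrightarrow> w y * f (U y, V y)"
      by (intro AE_I2 tendsto_intros)
    show "AE y in M. norm (w y * f (T n y)) \<le> B * \<bar>w y\<bar>" for n
      using f(2) by (intro AE_I2) (simp add: abs_mult mult.commute[of B] mult_left_mono)
  qed (use that fT[OF that(2,3)] in auto)
  show ?thesis
    using lim[OF w(1) UV] lim[OF w(2) UV2] unfolding step by (rule LIMSEQ_unique)
qed

subsection \<open>Deconvolution on the line\<close>

lemma norm_cis_taylor: "cmod (cis x - 1 - \<i> * x) \<le> x\<^sup>2 / 2"
  using iexp_approx1[of x 1] by (simp add: cis_conv_exp algebra_simps power2_eq_square numeral_2_eq_2)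

lemma integrable_mult_cis:
  assumes "integrable M w" and [measurable]: "l \<in> borel_measurable M"
  shows "integrable M (\<lambda>x. w x * cis (t * l x))"
proof -
  have "cis \<in> borel_measurable borel"
    by (intro borel_measurable_continuous_onI continuous_on_cis continuous_on_id)
  then have [measurable]: "(\<lambda>x. cis (t * l x)) \<in> borel_measurable M"
    by (rule measurable_compose[rotated]) measurable
  show ?thesis
    by (rule Bochner_Integration.integrable_bound[OF assms(1)]) (use assms in \<open>auto simp: norm_mult\<close>)
qed

text \<open>The quadratic Taylor remainder of \<open>cis\<close> is integrated directly. This gives
  an explicit error bound, at the price of a second moment of \<open>l\<close> for a first
  derivative.\<close>

lemma integral_cis_has_vector_derivative:
  fixes l :: "'a \<Rightarrow> real"
  assumes w: "integrable M w" "integrable M (\<lambda>x. w x * of_real (l x))" "integrable M (\<lambda>x. w x * of_real (l x ^ 2))"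
    and l: "l \<in> borel_measurable M"
  shows "((\<lambda>t. integral\<^sup>L M (\<lambda>x. w x * cis (t * l x))) has_vector_derivative
    integral\<^sup>L M (\<lambda>x. (\<i> * (w x * of_real (l x))) * cis (t * l x))) (at t)"
proof -
  let ?S = "\<lambda>t. integral\<^sup>L M (\<lambda>x. w x * cis (t * l x))"
  let ?D = "integral\<^sup>L M (\<lambda>x. (\<i> * (w x * of_real (l x))) * cis (t * l x))"
  define K where "K = integral\<^sup>L M (\<lambda>x. cmod (w x * of_real (l x ^ 2)))"
  have i1: "integrable M (\<lambda>x. w x * cis (t * l x))" for t using w(1) l by (rule integrable_mult_cis)
  have i2: "integrable M (\<lambda>x. (\<i> * (w x * of_real (l x))) * cis (t * l x))"
    using integrable_mult_right[OF w(2), of \<i>] l by (intro integrable_mult_cis) auto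
  have i3: "integrable M (\<lambda>x. of_real (s - t) * ((\<i> * (w x * of_real (l x))) * cis (t * l x)))" for s
    by (rule integrable_mult_right[OF i2])
  have bound: "cmod (?S s - ?S t - (s - t) *\<^sub>R ?D) \<le> (s - t)\<^sup>2 * K" for s
  proof -
    have pt: "w x * cis (s * l x) - w x * cis (t * l x) - of_real (s - t) * ((\<i> * (w x * of_real (l x))) * cis (t * l x))
      = w x * cis (t * l x) * (cis ((s - t) * l x) - 1 - \<i> * of_real ((s - t) * l x))" for x
    proof -
      have "cis (s * l x) = cis (t * l x) * cis ((s - t) * l x)" by (simp add: cis_mult algebra_simps)
      then show ?thesis by (simp add: algebra_simps)
    qed
    have eq: "?S s - ?S t - (s - t) *\<^sub>R ?D = integral\<^sup>L M (\<lambda>x. w x * cis (s * l x) - w x * cis (t * l x)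
        - of_real (s - t) * ((\<i> * (w x * of_real (l x))) * cis (t * l x)))"
      by (simp only: Bochner_Integration.integral_diff[OF Bochner_Integration.integrable_diff[OF i1 i1] i3]
          Bochner_Integration.integral_diff[OF i1 i1] integral_mult_right_zero scaleR_conv_of_real)
    have "cmod (?S s - ?S t - (s - t) *\<^sub>R ?D) \<le> integral\<^sup>L M (\<lambda>x. cmod (w x * cis (s * l x) - w x * cis (t * l x)
        - of_real (s - t) * ((\<i> * (w x * of_real (l x))) * cis (t * l x))))"
      unfolding eq by (rule integral_norm_bound)
    also have "\<dots> \<le> integral\<^sup>L M (\<lambda>x. (s - t)\<^sup>2 * cmod (w x * of_real (l x ^ 2)))"
    proof (rule integral_mono)
      show "integrable M (\<lambda>x. cmod (w x * cis (s * l x) - w x * cis (t * l x)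
        - of_real (s - t) * ((\<i> * (w x * of_real (l x))) * cis (t * l x))))"
        by (rule integrable_norm[OF Bochner_Integration.integrable_diff[OF Bochner_Integration.integrable_diff[OF i1 i1] i3]])
      show "integrable M (\<lambda>x. (s - t)\<^sup>2 * cmod (w x * of_real (l x ^ 2)))"
        by (rule integrable_mult_right[OF integrable_norm[OF w(3)]])
      fix x
      have "cmod (cis ((s - t) * l x) - 1 - \<i> * of_real ((s - t) * l x)) \<le> ((s - t) * l x)\<^sup>2 / 2"
        by (rule norm_cis_taylor)
      also have "\<dots> \<le> (s - t)\<^sup>2 * (l x)\<^sup>2" by (simp add: power_mult_distrib)
      finally show "cmod (w x * cis (s * l x) - w x * cis (t * l x)
        - of_real (s - t) * ((\<i> * (w x * of_real (l x))) * cis (t * l x))) \<le> (s - t)\<^sup>2 * cmod (w x * of_real (l x ^ 2))"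
        unfolding pt using mult_left_mono[of _ _ "cmod (w x)"] by (simp add: norm_mult norm_power mult.left_commute)
    qed
    also have "\<dots> = (s - t)\<^sup>2 * K" by (simp add: K_def)
    finally show ?thesis .
  qed
  show ?thesis
    unfolding has_vector_derivative_def
  proof (rule has_derivativeI_sandwich[where e=1 and H="\<lambda>s. K * \<bar>s - t\<bar>"])
    show "bounded_linear (\<lambda>x. x *\<^sub>R ?D)" by (rule bounded_linear_scaleR_left)
    have "((\<lambda>s. K * \<bar>s - t\<bar>) \<longlongrightarrow> K * \<bar>t - t\<bar>) (at t)" by (intro tendsto_intros)
    then show "((\<lambda>s. K * \<bar>s - t\<bar>) \<longlongrightarrow> 0) (at t)" by simp
    fix s assume "s \<noteq> t"
    then show "norm (?S s - ?S t - (s - t) *\<^sub>R ?D) / norm (s - t) \<le> K * \<bar>s - t\<bar>"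
    proof -
      have "(s - t)\<^sup>2 * K = K * \<bar>s - t\<bar> * norm (s - t)"
        using abs_mult_self_eq[of "s - t"] by (simp add: power2_eq_square mult.assoc mult.commute)
      then have "norm (?S s - ?S t - (s - t) *\<^sub>R ?D) \<le> K * \<bar>s - t\<bar> * norm (s - t)"
        using bound[of s] by (simp only:)
      then show ?thesis by (subst pos_divide_le_eq) (use \<open>s \<noteq> t\<close> in auto)
    qed
  qed simp
qed

text \<open>Two integrations by parts give the factor 1/v^2 for large v, and the trivial bound by
  the integral of \<bar>a\<bar> covers small v; the sum of the two bounds has the required
  form.\<close>

lemma oscillatory_integral_bound:
  fixes a a1 a2 :: "real \<Rightarrow> complex"
  assumes a: "\<And>t. (a has_vector_derivative a1 t) (at t)" "\<And>t. (a1 has_vector_derivative a2 t) (at t)"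
    and a2: "continuous_on UNIV a2" and c: "c > 0"
    and z: "a c = 0" "a (-c) = 0" "a1 c = 0" "a1 (-c) = 0"
  obtains K where "\<And>v::real. cmod (LINT t:{-c..c}|lborel. cis (v * t) * a t) \<le> K / (1 + v\<^sup>2)"
proof -
  have cont: "continuous_on UNIV a" "continuous_on UNIV a1"
    using a by (meson continuous_at_imp_continuous_on has_vector_derivative_continuous)+
  have contcis: "continuous_on UNIV (\<lambda>t. cis (v * t))" for v :: real by (intro continuous_intros)
  have si: "set_integrable lborel {-c..c} (\<lambda>t. cis (v * t) * f t)" if "continuous_on UNIV f" for f and v :: real
    using contcis that by (intro borel_integrable_atLeastAtMost' continuous_intros)
       (auto intro: continuous_on_subset)
  have nb: "cmod (LINT t:{-c..c}|lborel. cis (v * t) * f t) \<le> (LINT t:{-c..c}|lborel. cmod (f t))"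
    if "continuous_on UNIV f" for f and v :: real
  proof -
    have "cmod (LINT t:{-c..c}|lborel. cis (v * t) * f t) \<le> (LINT t:{-c..c}|lborel. cmod (cis (v * t) * f t))"
      by (rule set_integral_norm_bound[OF si[OF that]])
    then show ?thesis by (simp add: norm_mult)
  qed
  define K1 where "K1 = (LINT t:{-c..c}|lborel. cmod (a t))"
  define K2 where "K2 = (LINT t:{-c..c}|lborel. cmod (a2 t))"
  have main: "v\<^sup>2 * cmod (LINT t:{-c..c}|lborel. cis (v * t) * a t) \<le> K2" for v :: real
  proof (cases "v = 0")
    case True
    have "0 \<le> K2" unfolding K2_def set_lebesgue_integral_def by (intro integral_nonneg_AE) auto
    then show ?thesis using True by simp
  next
    case False
    \<comment> \<open>An antiderivative of
      \<open>cis (v * t) * (a t + a2 t / of_real (v\<^sup>2))\<close>: the two terms containing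
      \<open>a1\<close> cancel. Both integrations by parts thus become one application of the
      fundamental theorem, and the boundary conditions make \<open>G\<close> vanish at both
      ends.\<close>
    define G where "G t = cis (v * t) * (a t / (\<i> * v) + a1 t / of_real (v\<^sup>2))" for t
    have dc: "((\<lambda>t. cis (v * t)) has_vector_derivative (\<i> * v * cis (v * t))) (at t)" for t
    proof -
      have "((\<lambda>z. exp (\<i> * v * z)) has_field_derivative (\<i> * v * exp (\<i> * v * of_real t))) (at (of_real t))"
        by (auto intro!: derivative_eq_intros simp: mult_ac)
      from has_vector_derivative_real_field[OF this] show ?thesis
        by (simp add: cis_conv_exp mult_ac)
    qed
    have dG: "(G has_vector_derivative (cis (v * t) * (a t + a2 t / of_real (v\<^sup>2)))) (at t)" for t
    proof -
      have "(G has_vector_derivative (cis (v * t) * (a1 t / (\<i> * v) + a2 t / of_real (v\<^sup>2)) +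
          (\<i> * v * cis (v * t)) * (a t / (\<i> * v) + a1 t / of_real (v\<^sup>2)))) (at t)"
        unfolding G_def[abs_def]
        by (intro has_vector_derivative_mult has_vector_derivative_add dc has_vector_derivative_divide a)
      also have "(cis (v * t) * (a1 t / (\<i> * v) + a2 t / of_real (v\<^sup>2)) +
          (\<i> * v * cis (v * t)) * (a t / (\<i> * v) + a1 t / of_real (v\<^sup>2))) =
          cis (v * t) * (a t + a2 t / of_real (v\<^sup>2))"
        using False by (simp add: field_simps power2_eq_square)
      finally show ?thesis .
    qed
    have "((\<lambda>t. cis (v * t) * (a t + a2 t / of_real (v\<^sup>2))) has_integral (G c - G (-c))) {-c..c}"
      using c dG by (intro fundamental_theorem_of_calculus) (auto intro: has_vector_derivative_at_within)
    then have "integral {-c..c} (\<lambda>t. cis (v * t) * (a t + a2 t / of_real (v\<^sup>2))) = 0"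
      using z by (simp add: G_def integral_unique)
    moreover have cc: "continuous_on UNIV (\<lambda>t. a t + a2 t / of_real (v\<^sup>2))"
      using False cont a2 by (intro continuous_intros) auto
    ultimately have "(LINT t:{-c..c}|lborel. cis (v * t) * (a t + a2 t / of_real (v\<^sup>2))) = 0"
      using set_borel_integral_eq_integral(2)[OF si[OF cc]] by simp
    also have "(LINT t:{-c..c}|lborel. cis (v * t) * (a t + a2 t / of_real (v\<^sup>2))) =
        (LINT t:{-c..c}|lborel. cis (v * t) * a t) + (LINT t:{-c..c}|lborel. cis (v * t) * a2 t) / of_real (v\<^sup>2)"
      unfolding distrib_left
    proof (subst set_integral_add(2)[OF si[OF cont(1)] si])
      show "continuous_on UNIV (\<lambda>t. a2 t / complex_of_real (v\<^sup>2))"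
        using False a2 by (intro continuous_intros) auto
    qed (simp add: set_integral_divide_zero)
    finally have "(LINT t:{-c..c}|lborel. cis (v * t) * a t) * of_real (v\<^sup>2) = - (LINT t:{-c..c}|lborel. cis (v * t) * a2 t)"
      using False by (simp add: field_simps add_eq_0_iff)
    then have "cmod (LINT t:{-c..c}|lborel. cis (v * t) * a t) * v\<^sup>2 = cmod (LINT t:{-c..c}|lborel. cis (v * t) * a2 t)"
      by (drule_tac arg_cong[where f=cmod]) (simp add: norm_mult norm_power)
    then show ?thesis using nb[OF a2, of v] by (simp add: K2_def mult.commute)
  qed
  show ?thesis
  proof (rule that[of "K1 + K2"])
    fix v :: real
    have "0 < 1 + v\<^sup>2" by (simp add: add_pos_nonneg)
    moreover have "cmod (LINT t:{-c..c}|lborel. cis (v * t) * a t) * (1 + v\<^sup>2) \<le> K1 + K2"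
      using main[of v] nb[OF cont(1), of v] unfolding K1_def[symmetric]
      by (simp only: distrib_left mult.commute[of _ "v\<^sup>2"] mult_1_right)
    ultimately show "cmod (LINT t:{-c..c}|lborel. cis (v * t) * a t) \<le> (K1 + K2) / (1 + v\<^sup>2)"
      by (simp add: pos_le_divide_eq)
  qed
qed


text \<open>The cube makes the extension by zero outside \<open>{-c..c}\<close> twice continuously
  differentiable.\<close>

definition bump :: "real \<Rightarrow> real \<Rightarrow> real" where "bump c t = (c\<^sup>2 - t\<^sup>2)^3"

definition bump_transform :: "real \<Rightarrow> real \<Rightarrow> real" where
  "bump_transform c v = (LINT t:{-c..c}|lborel. cos (v * t) * bump c t)"

lemma continuous_on_bump[continuous_intros]: "continuous_on S (bump c)"
  unfolding bump_def[abs_def] by (intro continuous_intros)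

text \<open>The bump is even, so the substitution of -t for t annihilates the sine part. The Fourier
  transform being real, its positivity makes sense.\<close>

lemma bump_transform_complex:
  "(LINT t:{-c..c}|lborel. cis (v * t) * of_real (bump c t)) = of_real (bump_transform c v)"
proof -
  define J where "J = (LINT t:{-c..c}|lborel. cis (v * t) * of_real (bump c t))"
  have i: "set_integrable lborel {-c..c} (\<lambda>t. cis (v * t) * of_real (bump c t))"
    by (intro borel_integrable_atLeastAtMost' continuous_intros)
  have "Re J = bump_transform c v"
    unfolding J_def bump_transform_def set_lebesgue_integral_def
    using i[unfolded set_integrable_def] by (subst integral_Re[symmetric]) (auto simp: cis.ctr)
  moreover have "Im J = 0"
  proof -
    have "Im J = (\<integral>t. indicator {-c..c} t * (sin (v * t) * bump c t) \<partial>lborel)"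
      unfolding J_def set_lebesgue_integral_def
      using i[unfolded set_integrable_def] by (subst integral_Im[symmetric]) (auto simp: cis.ctr)
    also have "\<dots> = (\<integral>t. indicator {-c..c} (0 + (-1) * t) * (sin (v * (0 + (-1) * t)) * bump c (0 + (-1) * t)) \<partial>lborel)"
      by (subst lborel_integral_real_affine[of "-1" _ 0]) auto
    also have "\<dots> = (\<integral>t. - (indicator {-c..c} t * (sin (v * t) * bump c t)) \<partial>lborel)"
      by (intro Bochner_Integration.integral_cong) (auto simp: bump_def indicator_def)
    also have "\<dots> = - Im J"
      unfolding J_def set_lebesgue_integral_def
      using i[unfolded set_integrable_def] by (subst integral_Im[symmetric]) (auto simp: cis.ctr)
    finally show ?thesis by simp
  qed
  ultimately show ?thesis unfolding J_def[symmetric] by (simp add: complex_eq_iff)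
qed

text \<open>For these \<open>v\<close> the phase \<open>v * t\<close> stays in [-1, 1] on the
  support, where the cosine is at least \<open>cos 1 > 0\<close>. Since the bound on
  \<open>v\<close> is 1/c, small \<open>c\<close> will reach every argument.\<close>

lemma bump_transform_pos:
  assumes c: "c > 0" and v: "\<bar>v\<bar> \<le> 1 / c"
  shows "bump_transform c v > 0"
proof -
  \<comment> \<open>A lower bound for the integrand on the middle half of the support, an interval
    of length \<open>c\<close> on which c^2 - t^2 \<ge> 3/4 c^2.\<close>
  define k where "k = cos 1 * (3/4 * c\<^sup>2)^3"
  have "cos (1::real) > 0" by (rule cos_gt_zero) (use pi_gt3 in auto)
  then have k: "k > 0" using c by (simp add: k_def)
  have i: "set_integrable lborel {-c..c} (\<lambda>t. cos (v * t) * bump c t)"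
    by (intro borel_integrable_atLeastAtMost' continuous_intros)
  have "0 < k * c" using k c by simp
  also have "k * c = (\<integral>t. k * indicator {-c/2..c/2} t \<partial>lborel)" using c by simp
  also have "\<dots> \<le> bump_transform c v"
    unfolding bump_transform_def set_lebesgue_integral_def
  proof (rule integral_mono)
    show "integrable lborel (\<lambda>t. k * indicator {-c/2..c/2} t)"
      by (intro integrable_mult_right integrable_real_indicator) (auto simp: emeasure_lborel_Icc_eq)
    show "integrable lborel (\<lambda>t. indicator {-c..c} t *\<^sub>R (cos (v * t) * bump c t))"
      using i by (simp add: set_integrable_def)
    fix t :: real
    show "k * indicator {-c/2..c/2} t \<le> indicator {-c..c} t *\<^sub>R (cos (v * t) * bump c t)"
    proof (cases "t \<in> {-c..c}")
      case True
      then have tc: "\<bar>t\<bar> \<le> c" by auto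
      have "\<bar>v * t\<bar> \<le> (1 / c) * c" unfolding abs_mult using v tc c by (intro mult_mono) auto
      then have "\<bar>v * t\<bar> \<le> 1" using c by simp
      then have cos: "cos 1 \<le> cos (v * t)"
        using cos_monotone_0_pi_le[of "\<bar>v * t\<bar>" 1] pi_gt3 by simp
      have "t\<^sup>2 \<le> c\<^sup>2" using tc c by (simp add: abs_le_square_iff[symmetric])
      then have b0: "bump c t \<ge> 0" by (simp add: bump_def)
      show ?thesis
      proof (cases "t \<in> {-c/2..c/2}")
        case True
        then have "\<bar>t\<bar> \<le> \<bar>c/2\<bar>" using c by auto
        then have "t\<^sup>2 \<le> (c/2)\<^sup>2" by (simp add: abs_le_square_iff[symmetric])
        then have "(3/4 * c\<^sup>2)^3 \<le> bump c t" unfolding bump_def by (intro power_mono) (auto simp: power_divide)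
        then have "k \<le> cos (v * t) * bump c t" unfolding k_def using cos \<open>cos 1 > 0\<close> by (intro mult_mono) auto
        then show ?thesis using True \<open>t \<in> {-c..c}\<close> by simp
      next
        case False
        then show ?thesis using \<open>t \<in> {-c..c}\<close> b0 cos \<open>cos 1 > 0\<close> by auto
      qed
    next
      case False
      then show ?thesis using c by (auto simp: indicator_def)
    qed
  qed
  finally show ?thesis .
qed

lemma continuous_on_bump_transform: "continuous_on S (bump_transform c)"
proof -
  have "isCont (bump_transform c) v" for v
  proof (rule continuous_at_sequentiallyI)
    fix u :: "nat \<Rightarrow> real" assume u: "u \<longlonglongrightarrow> v"
    show "(\<lambda>n. bump_transform c (u n)) \<longlonglongrightarrow> bump_transform c v"
      unfolding bump_transform_def set_lebesgue_integral_def
    proof (rule integral_dominated_convergence[where w="\<lambda>t. indicator {-c..c} t *\<^sub>R \<bar>bump c t\<bar>"])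
      have "set_integrable lborel {-c..c} (\<lambda>t. \<bar>bump c t\<bar>)"
        by (intro borel_integrable_atLeastAtMost' continuous_intros)
      then show "integrable lborel (\<lambda>t. indicator {-c..c} t *\<^sub>R \<bar>bump c t\<bar>)" by (simp add: set_integrable_def)
      have [measurable]: "bump c \<in> borel_measurable borel"
        by (intro borel_measurable_continuous_onI continuous_on_bump)
      show "(\<lambda>t. indicator {-c..c} t *\<^sub>R (cos (v * t) * bump c t)) \<in> borel_measurable lborel" for v by measurable
      then show "(\<lambda>t. indicator {-c..c} t *\<^sub>R (cos (u n * t) * bump c t)) \<in> borel_measurable lborel" for n .
      show "AE t in lborel. (\<lambda>n. indicator {-c..c} t *\<^sub>R (cos (u n * t) * bump c t)) \<longlonglongrightarrow> indicator {-c..c} t *\<^sub>R (cos (v * t) * bump c t)"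
        using u by (intro AE_I2 tendsto_intros)
      show "AE t in lborel. norm (indicator {-c..c} t *\<^sub>R (cos (u n * t) * bump c t)) \<le> indicator {-c..c} t *\<^sub>R \<bar>bump c t\<bar>" for n
        by (intro AE_I2) (auto simp: indicator_def abs_mult intro: mult_left_le_one_le)
    qed
  qed
  then show ?thesis by (simp add: continuous_at_imp_continuous_on)
qed

text \<open>The function \<open>g\<close> is the Fourier transform of the quotient \<open>a\<close> of the bump by the nonvanishing \<open>S\<close>;
  two derivatives of \<open>a\<close> give the decay of \<open>g\<close>.\<close>

lemma deconvolution_kernel:
  fixes w :: "'a \<Rightarrow> complex" and l :: "'a \<Rightarrow> real"
  assumes M: "sigma_finite_measure M" and c: "c > 0"
    and w: "\<And>k. k \<le> 4 \<Longrightarrow> integrable M (\<lambda>x. w x * of_real (l x ^ k))"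
    and l[measurable]: "l \<in> borel_measurable M"
    and nz: "\<And>t. integral\<^sup>L M (\<lambda>x. w x * cis (t * l x)) \<noteq> 0"
  obtains g K where "g \<in> borel_measurable borel" "\<And>v. cmod (g v) \<le> K / (1 + v\<^sup>2)"
    "\<And>u. integral\<^sup>L M (\<lambda>x. w x * g (l x + u)) = of_real (bump_transform c u)"
proof -
  define S where "S t = integral\<^sup>L M (\<lambda>x. w x * cis (t * l x))" for t
  define w1 where "w1 x = \<i> * (w x * of_real (l x))" for x
  define w2 where "w2 x = \<i> * (w1 x * of_real (l x))" for x
  define S1 where "S1 t = integral\<^sup>L M (\<lambda>x. w1 x * cis (t * l x))" for t
  define S2 where "S2 t = integral\<^sup>L M (\<lambda>x. w2 x * cis (t * l x))" for t
  \<comment> \<open>Each use of the derivative rule asks for two powers of \<open>l\<close> and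
    hands on one. The rule is applied to \<open>S\<close>, to \<open>S1\<close>, and to
    \<open>S2\<close> for the sake of its continuity, which is where the fourth power comes
    from.\<close>
  have iw0: "integrable M w" "integrable M (\<lambda>x. w x * of_real (l x))" "integrable M (\<lambda>x. w x * of_real (l x ^ 2))"
    using w[of 0] w[of 1] w[of 2] by simp_all
  have iw1: "integrable M w1" "integrable M (\<lambda>x. w1 x * of_real (l x))" "integrable M (\<lambda>x. w1 x * of_real (l x ^ 2))"
    using integrable_mult_right[OF w[of 1], of \<i>] integrable_mult_right[OF w[of 2], of \<i>] integrable_mult_right[OF w[of 3], of \<i>]
    by (simp_all add: w1_def[abs_def] mult.assoc power2_eq_square power3_eq_cube)
  have iw2: "integrable M w2" "integrable M (\<lambda>x. w2 x * of_real (l x))" "integrable M (\<lambda>x. w2 x * of_real (l x ^ 2))"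
    using integrable_mult_right[OF w[of 2], of "-1"] integrable_mult_right[OF w[of 3], of "-1"] integrable_mult_right[OF w[of 4], of "-1"]
    by (simp_all add: w2_def[abs_def] w1_def[abs_def] mult.assoc power2_eq_square power3_eq_cube power4_eq_xxxx)
  have dS: "(S has_vector_derivative S1 t) (at t)" for t
    using integral_cis_has_vector_derivative[OF iw0 l, of t] unfolding S_def[abs_def] S1_def w1_def .
  have dS1: "(S1 has_vector_derivative S2 t) (at t)" for t
    using integral_cis_has_vector_derivative[OF iw1 l, of t] unfolding S1_def[abs_def] S2_def w2_def .
  have cS2: "continuous_on UNIV S2"
    using integral_cis_has_vector_derivative[OF iw2 l] unfolding S2_def[abs_def]
    by (meson continuous_at_imp_continuous_on has_vector_derivative_continuous)
  have cS: "continuous_on UNIV S" "continuous_on UNIV S1"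
    using dS dS1 by (meson continuous_at_imp_continuous_on has_vector_derivative_continuous)+
  have Snz: "S t \<noteq> 0" for t using nz by (simp add: S_def)
  define R where "R t = inverse (S t)" for t
  define R1 where "R1 t = S1 t * - (R t * R t)" for t
  define R2 where "R2 t = S1 t * - (R t * R1 t + R1 t * R t) + S2 t * - (R t * R t)" for t
  have cR: "continuous_on UNIV R" unfolding R_def[abs_def] using Snz by (intro continuous_intros cS) auto
  have cR1: "continuous_on UNIV R1" unfolding R1_def[abs_def] by (intro continuous_intros cS cR)
  have cR2: "continuous_on UNIV R2" unfolding R2_def[abs_def] by (intro continuous_intros cS cR cR1 cS2)
  have dR: "(R has_vector_derivative R1 t) (at t)" for t
  proof -
    have "(inverse has_field_derivative - (inverse (S t) * inverse (S t))) (at (S t))"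
      using DERIV_inverse'[OF DERIV_ident Snz[of t]] DERIV_inverse[OF Snz[of t], of UNIV]
      by (simp add: power2_eq_square)
    from field_vector_diff_chain_at[OF dS this] show ?thesis
      by (simp add: o_def R_def[abs_def] R1_def)
  qed
  have dR1: "(R1 has_vector_derivative R2 t) (at t)" for t
    unfolding R1_def[abs_def] R2_def
    by (intro has_vector_derivative_mult has_vector_derivative_minus dR[unfolded R1_def[abs_def]] dS1 dR) 
  define B where "B t = complex_of_real (bump c t)" for t
  define B1 where "B1 t = complex_of_real (- 6 * t * (c\<^sup>2 - t\<^sup>2)^2)" for t
  define B2 where "B2 t = complex_of_real (24 * t^2 * (c\<^sup>2 - t\<^sup>2) - 6 * (c\<^sup>2 - t\<^sup>2)^2)" for t
  have dB: "(B has_vector_derivative B1 t) (at t)" for t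
    unfolding B_def[abs_def] B1_def bump_def
    by (intro has_vector_derivative_of_real) (auto intro!: derivative_eq_intros simp: power2_eq_square)
  have dB1: "(B1 has_vector_derivative B2 t) (at t)" for t
    unfolding B1_def[abs_def] B2_def
    by (intro has_vector_derivative_of_real) (auto intro!: derivative_eq_intros simp: power2_eq_square algebra_simps)
  define a where "a t = B t * R t" for t
  define a1 where "a1 t = B t * R1 t + B1 t * R t" for t
  define a2 where "a2 t = (B t * R2 t + B1 t * R1 t) + (B1 t * R1 t + B2 t * R t)" for t
  have da: "(a has_vector_derivative a1 t) (at t)" for t
    unfolding a_def[abs_def] a1_def by (intro has_vector_derivative_mult dB dR)
  have da1: "(a1 has_vector_derivative a2 t) (at t)" for t
    unfolding a1_def[abs_def] a2_def by (intro has_vector_derivative_add has_vector_derivative_mult dB dR dB1 dR1)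
  have ca2: "continuous_on UNIV a2"
    unfolding a2_def[abs_def] B_def B1_def B2_def by (intro continuous_intros cR cR1 cR2)
  have ca: "continuous_on UNIV a"
    using da by (meson continuous_at_imp_continuous_on has_vector_derivative_continuous)
  have z: "a c = 0" "a (-c) = 0" "a1 c = 0" "a1 (-c) = 0"
    by (simp_all add: a_def a1_def B_def B1_def bump_def)
  define g where "g v = (LINT t:{-c..c}|lborel. cis (v * t) * a t)" for v
  obtain K where K: "\<And>v. cmod (g v) \<le> K / (1 + v\<^sup>2)"
    using oscillatory_integral_bound[OF da da1 ca2 c z] unfolding g_def by metis
  have [measurable]: "a \<in> borel_measurable borel" using ca by (rule borel_measurable_continuous_onI)
  have cism: "cis \<in> borel_measurable borel"
    by (intro borel_measurable_continuous_onI continuous_on_cis continuous_on_id)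
  have cis2[measurable]: "(\<lambda>x. cis (f x)) \<in> borel_measurable N" if "f \<in> borel_measurable N" for f :: "'b \<Rightarrow> real" and N
    using measurable_compose[OF that cism] .
  have cis3[measurable]: "(\<lambda>x. cis (f x)) \<in> borel_measurable N" if "f \<in> borel_measurable N" for f :: "real \<times> real \<Rightarrow> real" and N
    using measurable_compose[OF that cism] .
  have cis4[measurable]: "(\<lambda>x. cis (f x)) \<in> borel_measurable N" if "f \<in> borel_measurable N" for f :: "'a \<times> real \<Rightarrow> real" and N
    using measurable_compose[OF that cism] .
  have gm: "g \<in> borel_measurable borel"
    unfolding g_def[abs_def] set_lebesgue_integral_def
    by (rule sigma_finite_measure.borel_measurable_lebesgue_integral[OF sigma_finite_lborel]) measurable
  have [measurable]: "w \<in> borel_measurable M" using iw0(1) by simp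
  interpret pair_sigma_finite M lborel
    unfolding pair_sigma_finite_def using M sigma_finite_lborel by auto
  have main: "integral\<^sup>L M (\<lambda>x. w x * g (l x + u)) = of_real (bump_transform c u)" for u
  proof -
    define H where "H x t = w x * (indicator {-c..c} t *\<^sub>R (cis ((l x + u) * t) * a t))" for x t
    define A where "A = (LINT t:{-c..c}|lborel. cmod (a t))"
    have iA: "set_integrable lborel {-c..c} (\<lambda>t. f t * a t)" if "continuous_on UNIV f" for f
      using that ca by (intro borel_integrable_atLeastAtMost' continuous_intros) (auto intro: continuous_on_subset)
    have nH: "(\<integral>t. norm (H x t) \<partial>lborel) = cmod (w x) * A" for x
    proof -
      have "(\<integral>t. norm (H x t) \<partial>lborel) = (\<integral>t. cmod (w x) * (indicator {-c..c} t *\<^sub>R cmod (a t)) \<partial>lborel)"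
        by (intro Bochner_Integration.integral_cong) (auto simp: H_def norm_mult)
      then show ?thesis by (simp only: integral_mult_right_zero A_def set_lebesgue_integral_def)
    qed
    have inH: "integrable lborel (H x)" for x
    proof -
      have "continuous_on UNIV (\<lambda>t. cis ((l x + u) * t))" by (intro continuous_intros)
      from iA[OF this] show ?thesis
        unfolding H_def by (intro integrable_mult_right) (simp add: set_integrable_def)
    qed
    have int: "integrable (M \<Otimes>\<^sub>M lborel) (case_prod H)"
    proof (rule Fubini_integrable)
      show "case_prod H \<in> borel_measurable (M \<Otimes>\<^sub>M lborel)" unfolding H_def by measurable
      show "integrable M (\<lambda>x. \<integral>t. norm (case_prod H (x, t)) \<partial>lborel)"
        using integrable_norm[OF iw0(1)] by (simp add: nH)
      show "AE x in M. integrable lborel (\<lambda>t. case_prod H (x, t))" using inH by simp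
    qed
    have "integral\<^sup>L M (\<lambda>x. w x * g (l x + u)) = (\<integral>x. (\<integral>t. H x t \<partial>lborel) \<partial>M)"
      by (simp only: g_def set_lebesgue_integral_def H_def integral_mult_right_zero)
    also have "\<dots> = (\<integral>t. (\<integral>x. H x t \<partial>M) \<partial>lborel)"
      by (rule Fubini_integral[OF int, symmetric])
    also have "\<dots> = (\<integral>t. indicator {-c..c} t *\<^sub>R (cis (u * t) * of_real (bump c t)) \<partial>lborel)"
    proof (rule Bochner_Integration.integral_cong[OF refl])
      fix t
      have "H x t = (indicator {-c..c} t *\<^sub>R (cis (u * t) * a t)) * (w x * cis (t * l x))" for x
      proof -
        have "cis ((l x + u) * t) = cis (u * t) * cis (t * l x)" by (simp add: cis_mult algebra_simps)
        then show ?thesis by (simp add: H_def mult_ac)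
      qed
      \<comment> \<open>The integral over \<open>x\<close> produces exactly \<open>S t\<close>,
        which cancels the factor \<open>R t\<close> in \<open>a t\<close>; only the bump
        remains.\<close>
      then have "(\<integral>x. H x t \<partial>M) = (indicator {-c..c} t *\<^sub>R (cis (u * t) * a t)) * S t"
        by (simp add: S_def)
      also have "\<dots> = indicator {-c..c} t *\<^sub>R (cis (u * t) * of_real (bump c t))"
        using Snz[of t] by (simp add: a_def B_def R_def)
      finally show "(\<integral>x. H x t \<partial>M) = indicator {-c..c} t *\<^sub>R (cis (u * t) * of_real (bump c t))" .
    qed
    also have "\<dots> = of_real (bump_transform c u)"
      using bump_transform_complex[of c u] by (simp add: set_lebesgue_integral_def)
    finally show ?thesis .
  qed
  show ?thesis by (rule that[OF gm K main])
qed

subsection \<open>Cancellation in multiplicative convolutions\<close>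

text \<open>Meant for shell decompositions: at each point a single member of the sequence has to
  dominate, and which one may vary with the point.\<close>

lemma nn_integral_le_suminf:
  assumes "\<And>x. x \<in> space M \<Longrightarrow> \<exists>n::nat. f x \<le> F n x" and [measurable]: "\<And>n. F n \<in> borel_measurable M"
  shows "(\<integral>\<^sup>+x. f x \<partial>M) \<le> (\<Sum>n. \<integral>\<^sup>+x. F n x \<partial>M)"
proof -
  have "(\<integral>\<^sup>+x. f x \<partial>M) \<le> (\<integral>\<^sup>+x. (\<Sum>n. F n x) \<partial>M)"
  proof (rule nn_integral_mono)
    fix x assume "x \<in> space M"
    then obtain n where "f x \<le> F n x" using assms(1) by blast
    also have "F n x = sum (\<lambda>n. F n x) {n}" by simp
    also have "\<dots> \<le> (\<Sum>n. F n x)" by (intro sum_le_suminf) auto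
    finally show "f x \<le> (\<Sum>n. F n x)" .
  qed
  also have "\<dots> = (\<Sum>n. \<integral>\<^sup>+x. F n x \<partial>M)" by (rule nn_integral_suminf) simp
  finally show ?thesis .
qed

lemma ennreal_suminf_le_finite:
  fixes F :: "nat \<Rightarrow> ennreal"
  assumes "\<And>n. F n \<le> ennreal (q n)" "summable q" "\<And>n. 0 \<le> q n"
  shows "suminf F \<le> ennreal (suminf q)"
proof -
  have "suminf F \<le> (\<Sum>n. ennreal (q n))" by (intro suminf_le assms(1)) auto
  also have "\<dots> = ennreal (suminf q)" using assms(2,3) by (intro suminf_ennreal2) auto
  finally show ?thesis .
qed

lemma summable_inverse_1_plus_square: "summable (\<lambda>n. 1 / (1 + real n ^ 2))"
proof (rule summable_comparison_test'[where N=1])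
  show "summable (\<lambda>n. inverse (real n ^ 2))" by (rule inverse_power_summable) simp
  fix n :: nat assume "1 \<le> n"
  then show "norm (1 / (1 + real n ^ 2)) \<le> inverse (real n ^ 2)"
    by (simp add: field_simps add_pos_nonneg)
qed

text \<open>The bound is scale invariant and imposed for small \<open>u\<close> as well, where it
  limits the growth of mass near the origin. It is the bound that homogeneity would give, and it is
  available for limit measures before their homogeneity is known.\<close>

definition tail_bounded :: "'a::euclidean_space measure \<Rightarrow> real \<Rightarrow> bool" where
  "tail_bounded L \<alpha> \<longleftrightarrow> sets L = sets borel \<and> (\<exists>C\<ge>0. \<forall>u>0. emeasure L {y. u < norm y} \<le> ennreal (C * u powr (- \<alpha>)))"

lemma tail_bounded_finite_away:
  assumes "tail_bounded L \<alpha>" shows "finite_away L"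
  unfolding finite_away_def
proof (intro conjI allI impI)
  show s: "sets L = sets borel" using assms by (simp add: tail_bounded_def)
  fix r :: real assume "0 < r"
  then obtain C where "emeasure L {y. r/2 < norm y} \<le> ennreal (C * (r/2) powr (- \<alpha>))"
    using assms half_gt_zero[of r] unfolding tail_bounded_def by blast
  moreover have "emeasure L {y. r \<le> norm y} \<le> emeasure L {y. r/2 < norm y}"
    by (rule emeasure_mono) (use \<open>0 < r\<close> s in auto)
  ultimately show "emeasure L {y. r \<le> norm y} < \<infinity>"
    by (metis ennreal_less_top infinity_ennreal_def order_le_less_trans)
qed

text \<open>On the shell where ln \<bar>z_j\<bar> is about n, the weight is of order exp(n
  \<alpha>)/(1 + n^2) and the mass at most of order exp(-n \<alpha>). The exponentials cancel and
  the series of 1/(1 + n^2) converges. The sets \<open>I n\<close> serve positive logarithms, the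
  sets \<open>J n\<close> the others.\<close>

lemma integrable_log_weight:
  fixes L :: "(real^'n) measure"
  assumes L: "tail_bounded L \<alpha>" and \<alpha>: "\<alpha> > 0"
  shows "integrable L (\<lambda>z. \<bar>z $ j\<bar> powr \<alpha> / (1 + (ln \<bar>z $ j\<bar>)\<^sup>2))"
proof (rule integrableI_bounded)
  have s: "sets L = sets borel" using L by (simp add: tail_bounded_def)
  note [measurable_cong] = s
  show "(\<lambda>z. \<bar>z $ j\<bar> powr \<alpha> / (1 + (ln \<bar>z $ j\<bar>)\<^sup>2)) \<in> borel_measurable L" by measurable
  obtain C where C: "C \<ge> 0" "\<And>u. u > 0 \<Longrightarrow> emeasure L {y. u < norm y} \<le> ennreal (C * u powr (- \<alpha>))"
    using L by (auto simp: tail_bounded_def)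
  have Cj: "emeasure L {y. u < \<bar>y $ j\<bar>} \<le> ennreal (C * u powr (- \<alpha>))" if "u > 0" for u
  proof -
    have "emeasure L {y. u < \<bar>y $ j\<bar>} \<le> emeasure L {y. u < norm y}"
      by (intro emeasure_mono) (auto simp: s intro: less_le_trans[OF _ component_le_norm_cart])
    then show ?thesis using C(2)[OF that] by (rule order_trans)
  qed
  define I where "I n = {y::real^'n. exp (real n) < \<bar>y $ j\<bar>}" for n
  define J where "J n = {y::real^'n. exp (- real (Suc n)) < \<bar>y $ j\<bar>}" for n
  have [measurable]: "I n \<in> sets borel" "J n \<in> sets borel" for n unfolding I_def J_def by measurable
  define a where "a n = exp (real (Suc n) * \<alpha>) / (1 + real n ^ 2)" for n
  define b where "b n = exp (- real n * \<alpha>) / (1 + real n ^ 2)" for n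
  have ab: "0 \<le> a n" "0 \<le> b n" for n by (auto simp: a_def b_def add_nonneg_nonneg)
  define F where "F n z = ennreal (a n) * indicator (I n) z + ennreal (b n) * indicator (J n) z" for n and z :: "real^'n"
  have "(\<integral>\<^sup>+ z. ennreal (norm (\<bar>z $ j\<bar> powr \<alpha> / (1 + (ln \<bar>z $ j\<bar>)\<^sup>2))) \<partial>L) \<le> (\<Sum>n. \<integral>\<^sup>+z. F n z \<partial>L)"
  proof (rule nn_integral_le_suminf)
    fix z :: "real^'n"
    have nn: "0 \<le> \<bar>z $ j\<bar> powr \<alpha> / (1 + (ln \<bar>z $ j\<bar>)\<^sup>2)" by (intro divide_nonneg_nonneg) (auto simp: add_nonneg_nonneg)
    show "\<exists>n. ennreal (norm (\<bar>z $ j\<bar> powr \<alpha> / (1 + (ln \<bar>z $ j\<bar>)\<^sup>2))) \<le> F n z"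
    proof (cases "z $ j = 0")
      case True then show ?thesis by simp
    next
      case False
      define v where "v = ln \<bar>z $ j\<bar>"
      have zv: "\<bar>z $ j\<bar> = exp v" using False by (simp add: v_def)
      have main: "exp (v * \<alpha>) / (1 + v\<^sup>2) \<le> exp (w * \<alpha>) / (1 + real n ^ 2)" if "v \<le> w" "real n \<le> \<bar>v\<bar>" for w n
      proof (rule frac_le)
        show "exp (v * \<alpha>) \<le> exp (w * \<alpha>)" using that(1) \<alpha> by simp
        have "real n ^ 2 \<le> \<bar>v\<bar> ^ 2" using that(2) by (intro power_mono) auto
        then show "1 + real n ^ 2 \<le> 1 + v\<^sup>2" by simp
        show "0 < 1 + real n ^ 2" by (simp add: add_pos_nonneg)
      qed simp
      have pw: "\<bar>z $ j\<bar> powr \<alpha> = exp (v * \<alpha>)" unfolding zv by (simp add: powr_def mult.commute)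
      show ?thesis
      proof (cases "v > 0")
        case True
        \<comment> \<open>Rounding up and subtracting one gives n < v strictly even for integral v,
          as membership in \<open>I n\<close> demands.\<close>
        define n where "n = nat (\<lceil>v\<rceil> - 1)"
        have n: "real n < v" "v \<le> real (Suc n)" using True unfolding n_def by linarith+
        have "ennreal (norm (\<bar>z $ j\<bar> powr \<alpha> / (1 + (ln \<bar>z $ j\<bar>)\<^sup>2))) \<le> ennreal (a n)"
          unfolding a_def v_def[symmetric] pw using main[of "real (Suc n)" n] n by (auto intro!: ennreal_leI simp: add_nonneg_nonneg)
        moreover have "z \<in> I n" using n(1) by (simp add: I_def zv)
        ultimately show ?thesis by (intro exI[of _ n]) (simp add: F_def add_increasing2)
      next
        case False
        define n where "n = nat \<lfloor>- v\<rfloor>"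
        have n: "real n \<le> - v" "- v < real (Suc n)" using False unfolding n_def by linarith+
        have "ennreal (norm (\<bar>z $ j\<bar> powr \<alpha> / (1 + (ln \<bar>z $ j\<bar>)\<^sup>2))) \<le> ennreal (b n)"
          unfolding b_def v_def[symmetric] pw using main[of "- real n" n] n by (auto intro!: ennreal_leI simp: add_nonneg_nonneg)
        moreover have "z \<in> J n" using n(2) by (simp add: J_def zv)
        ultimately show ?thesis by (intro exI[of _ n]) (simp add: F_def add_increasing)
      qed
    qed
  qed (simp add: F_def)
  also have "\<dots> \<le> ennreal (\<Sum>n. 2 * C * exp \<alpha> * (1 / (1 + real n ^ 2)))"
  proof (rule ennreal_suminf_le_finite)
    show "summable (\<lambda>n. 2 * C * exp \<alpha> * (1 / (1 + real n ^ 2)))"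
      by (intro summable_mult summable_inverse_1_plus_square)
    show "0 \<le> 2 * C * exp \<alpha> * (1 / (1 + real n ^ 2))" for n using C(1) by (simp add: add_nonneg_nonneg)
    fix n
    have "(\<integral>\<^sup>+z. F n z \<partial>L) = ennreal (a n) * emeasure L (I n) + ennreal (b n) * emeasure L (J n)"
      unfolding F_def by (subst nn_integral_add) (auto simp: nn_integral_cmult_indicator)
    also have "\<dots> \<le> ennreal (a n) * ennreal (C * exp (real n) powr (- \<alpha>)) + ennreal (b n) * ennreal (C * exp (- real (Suc n)) powr (- \<alpha>))"
      unfolding I_def J_def by (intro add_mono mult_left_mono Cj) auto
    also have "\<dots> = ennreal (a n * (C * exp (real n) powr (- \<alpha>)) + b n * (C * exp (- real (Suc n)) powr (- \<alpha>)))"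
      using ab C(1) by (simp add: ennreal_mult[symmetric] ennreal_plus[symmetric] del: ennreal_plus)
    also have "a n * (C * exp (real n) powr (- \<alpha>)) + b n * (C * exp (- real (Suc n)) powr (- \<alpha>)) = 2 * C * exp \<alpha> * (1 / (1 + real n ^ 2))"
    proof -
      have "exp (real (Suc n) * \<alpha>) * exp (real n) powr (- \<alpha>) = exp \<alpha>"
        by (simp add: powr_def exp_add[symmetric] algebra_simps)
      moreover have "exp (- real n * \<alpha>) * exp (- real (Suc n)) powr (- \<alpha>) = exp \<alpha>"
        by (simp add: powr_def exp_add[symmetric] algebra_simps)
      ultimately have "a n * (C * exp (real n) powr (- \<alpha>)) = C * exp \<alpha> / (1 + real n ^ 2)"
        "b n * (C * exp (- real (Suc n)) powr (- \<alpha>)) = C * exp \<alpha> / (1 + real n ^ 2)"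
        unfolding a_def b_def by (metis (no_types, lifting) mult.left_commute times_divide_eq_left times_divide_eq_right)+
      then show ?thesis by simp
    qed
    finally show "(\<integral>\<^sup>+z. F n z \<partial>L) \<le> ennreal (2 * C * exp \<alpha> * (1 / (1 + real n ^ 2)))" .
  qed
  also have "\<dots> < \<infinity>" by simp
  finally show "(\<integral>\<^sup>+ z. ennreal (norm (\<bar>z $ j\<bar> powr \<alpha> / (1 + (ln \<bar>z $ j\<bar>)\<^sup>2))) \<partial>L) < \<infinity>" .
qed

section \<open>Multiplicative convolution as the image of a product measure\<close>

lemma measurable_diag_map[measurable]:
  "(\<lambda>p. diag_map (fst p) (snd p)) \<in> borel_measurable (borel \<Otimes>\<^sub>M borel)"
  unfolding diag_map_def by measurable

lemma emeasure_distr_diag_map: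
  assumes s: "sets \<rho> = sets borel" "sets \<nu> = sets borel" and \<nu>: "sigma_finite_measure \<nu>" and B: "B \<in> sets borel"
  shows "emeasure (distr (\<rho> \<Otimes>\<^sub>M \<nu>) borel (\<lambda>p. diag_map (fst p) (snd p))) B = (\<integral>\<^sup>+ x. emeasure \<nu> (diag_map x -` B) \<partial>\<rho>)"
proof -
  note [measurable_cong] = s
  have sp: "space \<rho> = UNIV" "space \<nu> = UNIV" using sets_eq_imp_space_eq[OF s(1)] sets_eq_imp_space_eq[OF s(2)] by auto
  have m: "(\<lambda>p. diag_map (fst p) (snd p)) \<in> (\<rho> \<Otimes>\<^sub>M \<nu>) \<rightarrow>\<^sub>M borel" by measurable
  have "emeasure (distr (\<rho> \<Otimes>\<^sub>M \<nu>) borel (\<lambda>p. diag_map (fst p) (snd p))) B =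
      emeasure (\<rho> \<Otimes>\<^sub>M \<nu>) ((\<lambda>p. diag_map (fst p) (snd p)) -` B \<inter> space (\<rho> \<Otimes>\<^sub>M \<nu>))"
    using m B by (rule emeasure_distr)
  also have "\<dots> = (\<integral>\<^sup>+ x. emeasure \<nu> (Pair x -` ((\<lambda>p. diag_map (fst p) (snd p)) -` B \<inter> space (\<rho> \<Otimes>\<^sub>M \<nu>))) \<partial>\<rho>)"
    by (rule sigma_finite_measure.emeasure_pair_measure_alt[OF \<nu> measurable_sets[OF m B]])
  also have "\<dots> = (\<integral>\<^sup>+ x. emeasure \<nu> (diag_map x -` B) \<partial>\<rho>)"
    by (intro nn_integral_cong arg_cong2[where f=emeasure] refl) (auto simp: space_pair_measure sp)
  finally show ?thesis .
qed

text \<open>As \<open>mult_conv\<close> is built with \<open>measure_of\<close>, its values are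
  meaningful only once the defining set function is recognised as a measure. The image of the
  product measure achieves this and opens the way to Fubini's theorem.\<close>

lemma mult_conv_eq_distr:
  assumes s: "sets \<rho> = sets borel" "sets \<nu> = sets borel" and \<nu>: "sigma_finite_measure \<nu>"
  shows "\<nu> \<circledast> \<rho> = distr (\<rho> \<Otimes>\<^sub>M \<nu>) borel (\<lambda>p. diag_map (fst p) (snd p))"
proof -
  let ?D = "distr (\<rho> \<Otimes>\<^sub>M \<nu>) borel (\<lambda>p. diag_map (fst p) (snd p))"
  have "\<nu> \<circledast> \<rho> = measure_of (space ?D) (sets ?D) (emeasure ?D)"
    unfolding mult_conv_def
    by (simp, intro measure_of_eq) (auto simp: emeasure_distr_diag_map[OF s \<nu>] sets.sigma_sets_eq[of borel, simplified])
  also have "\<dots> = ?D" by (rule measure_of_of_measure)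
  finally show ?thesis .
qed

lemma sets_mult_conv[simp]: "sets (\<nu> \<circledast> \<rho>) = sets borel"
  by (simp add: mult_conv_def sets.sigma_sets_eq[of borel, simplified])

lemma emeasure_mult_conv:
  assumes s: "sets \<rho> = sets borel" "sets \<nu> = sets borel" and \<nu>: "sigma_finite_measure \<nu>" and B: "B \<in> sets borel"
  shows "emeasure (\<nu> \<circledast> \<rho>) B = (\<integral>\<^sup>+ x. emeasure \<nu> (diag_map x -` B) \<partial>\<rho>)"
  unfolding mult_conv_eq_distr[OF s \<nu>] by (rule emeasure_distr_diag_map[OF s \<nu> B])

lemma AE_nonzero_coordinates:
  fixes \<rho> :: "(real^'n) measure"
  assumes s: "sets \<rho> = sets borel" and z: "\<And>i. emeasure \<rho> {x. x $ i = 0} = 0"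
  shows "AE x in \<rho>. \<forall>i. x $ i \<noteq> 0"
proof -
  have "AE x in \<rho>. x $ i \<noteq> 0" for i
    by (rule AE_I[OF _ z[of i]]) (auto simp: s)
  then have "AE x in \<rho>. \<forall>i\<in>UNIV. x $ i \<noteq> 0" by (subst AE_finite_all) auto
  then show ?thesis by simp
qed

section \<open>Strata of vectors with prescribed zero coordinates and the characters on them\<close>

definition stratum :: "'n set \<Rightarrow> (real^'n) set" where
  "stratum A = {y. \<forall>k. y $ k \<noteq> 0 \<longleftrightarrow> k \<in> A}"

definition log_coords :: "'n set \<Rightarrow> real^'n \<Rightarrow> real^'n" where
  "log_coords A y = (\<chi> k. if k \<in> A then ln \<bar>y $ k\<bar> else 0)"

text \<open>With sign 0 and logarithm 0 outside \<open>A\<close>, a vector of the stratum is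
  recovered in every coordinate as the sign times the exponential of the logarithm, a formula
  continuous in both.\<close>

definition sgn_coords :: "'n set \<Rightarrow> real^'n \<Rightarrow> real^'n" where
  "sgn_coords A y = (\<chi> k. if k \<in> A then sgn (y $ k) else 0)"

abbreviation mchar :: "'n set \<Rightarrow> ('n \<Rightarrow> real) \<Rightarrow> ('n \<Rightarrow> nat) \<Rightarrow> real^'n \<Rightarrow> complex" where
  "mchar A \<equiv> chr (log_coords A) (sgn_coords A)"

lemma stratum_measurable[measurable]: "stratum A \<in> sets borel"
  unfolding stratum_def by measurable

lemma log_coords_measurable[measurable]: "log_coords A \<in> borel_measurable borel"
  unfolding log_coords_def[abs_def] by measurable

lemma sgn_coords_measurable[measurable]: "sgn_coords A \<in> borel_measurable borel"
  unfolding sgn_coords_def[abs_def] by measurable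

lemma sgn_coords_le_1: "\<bar>sgn_coords A y $ k\<bar> \<le> 1"
  by (auto simp: sgn_coords_def abs_sgn_eq)

lemma diag_map_stratum:
  assumes "\<forall>i. x $ i \<noteq> 0" shows "diag_map x y \<in> stratum A \<longleftrightarrow> y \<in> stratum A"
  using assms by (auto simp: stratum_def diag_map_def)

lemma mchar_diag_map:
  assumes x: "\<forall>i. x $ i \<noteq> 0" and y: "y \<in> stratum A"
  shows "mchar A \<theta> m (diag_map x y) = mchar A \<theta> m x * mchar A \<theta> m y"
proof -
  have "log_coords A (diag_map x y) = log_coords A x + log_coords A y"
    using x y by (auto simp: vec_eq_iff log_coords_def diag_map_def stratum_def abs_mult ln_mult)
  moreover have "sgn_coords A (diag_map x y) $ k = sgn_coords A x $ k * sgn_coords A y $ k" for k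
    by (simp add: sgn_coords_def diag_map_def sgn_mult)
  ultimately show ?thesis
    by (simp add: chr_def distrib_left sum.distrib cis_mult[symmetric] power_mult_distrib prod.distrib)
qed

lemma cis_sum: "finite S \<Longrightarrow> cis (\<Sum>k\<in>S. f k) = (\<Prod>k\<in>S. cis (f k))"
  by (induction S rule: finite_induct) (auto simp: cis_mult[symmetric])

text \<open>Brings a character into the shape of the nonvanishing hypothesis. Exponents of signs
  matter only modulo two when no coordinate is zero, and frequencies outside \<open>A\<close> become
  0. Exponents outside \<open>A\<close> have to vanish because the recorded sign is 0 there.\<close>

lemma mchar_eq_product:
  assumes x: "\<forall>i. x $ i \<noteq> 0" and m: "\<forall>k. k \<notin> A \<longrightarrow> m k = 0"
  shows "mchar A \<theta> m x = (\<Prod>k\<in>UNIV. complex_of_real \<bar>x $ k\<bar> powr (\<i> * complex_of_real (if k \<in> A then \<theta> k else 0)))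
    * (\<Prod>k\<in>UNIV. complex_of_real (sgn (x $ k)) ^ (m k mod 2))"
proof -
  have "complex_of_real \<bar>x $ k\<bar> powr (\<i> * complex_of_real (if k \<in> A then \<theta> k else 0)) = cis (\<theta> k * log_coords A x $ k)" for k
    using x by (auto simp: powr_def log_coords_def cis_conv_exp Ln_of_real mult_ac)
  moreover have "complex_of_real (sgn_coords A x $ k ^ m k) = complex_of_real (sgn (x $ k)) ^ (m k mod 2)" for k
  proof -
    have "sgn (x $ k) ^ m k = sgn (x $ k) ^ (2 * (m k div 2) + m k mod 2)" by simp
    also have "\<dots> = sgn (x $ k) ^ (m k mod 2)"
      unfolding power_add power_mult using x by (simp add: sgn_if)
    finally show ?thesis using m by (auto simp: sgn_coords_def of_real_power[symmetric] simp del: of_real_power)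
  qed
  ultimately show ?thesis by (simp add: chr_def cis_sum)
qed


lemma tail_bounded_sigma_finite:
  assumes L: "tail_bounded L \<alpha>" and z: "emeasure L {0} = 0"
  shows "sigma_finite_measure L"
proof
  have s: "sets L = sets borel" using L by (simp add: tail_bounded_def)
  have sp: "space L = UNIV" using sets_eq_imp_space_eq[OF s] by simp
  have fa: "\<And>r. r > 0 \<Longrightarrow> emeasure L {x. r \<le> norm x} < \<infinity>"
    using tail_bounded_finite_away[OF L] by (auto simp: finite_away_def)
  define Q where "Q = insert {0::'a} (range (\<lambda>n. {x. 1 / real (Suc n) \<le> norm x}))"
  show "\<exists>A. countable A \<and> A \<subseteq> sets L \<and> \<Union> A = space L \<and> (\<forall>a\<in>A. emeasure L a \<noteq> \<infinity>)"
  proof (intro exI[of _ Q] conjI)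
    show "countable Q" by (simp add: Q_def)
    show "Q \<subseteq> sets L" by (auto simp: Q_def s)
    have "x \<in> \<Union>Q" for x
    proof (cases "x = 0")
      case False
      then obtain n where "1 / real (Suc n) < norm x" using nat_approx_posE[of "norm x"] by auto
      then show ?thesis unfolding Q_def by (auto intro: less_imp_le)
    qed (simp add: Q_def)
    then show "\<Union> Q = space L" by (auto simp: sp)
    show "\<forall>a\<in>Q. emeasure L a \<noteq> \<infinity>"
      using fa z by (auto simp: Q_def less_top[symmetric])
  qed
qed

text \<open>Collects what is required of \<rho> for cancellation in a convolution. The logarithmic
  moments are stated in the form in which the deconvolution kernel asks for them.\<close>

locale nonvanishing =
  fixes \<rho> :: "(real^'n) measure" and \<alpha> :: real
  assumes sets_rho: "sets \<rho> = sets borel" and sigma_rho: "sigma_finite_measure \<rho>" and alpha: "\<alpha> > 0"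
    and rho_coord: "\<And>i. emeasure \<rho> {x. x $ i = 0} = 0"
    and moments: "\<And>j k. k \<le> 4 \<Longrightarrow> integrable \<rho> (\<lambda>x. \<bar>x $ j\<bar> powr \<alpha> * ln \<bar>x $ j\<bar> ^ k)"
    and nonvanish: "\<And>(j::'n) (m :: 'n \<Rightarrow> nat) (\<theta> :: 'n \<Rightarrow> real). (\<And>k. m k \<in> {0, 1}) \<Longrightarrow>
          (LINT x|\<rho>. complex_of_real (\<bar>x $ j\<bar> powr \<alpha>)
             * (\<Prod>k\<in>UNIV. complex_of_real \<bar>x $ k\<bar> powr (\<i> * complex_of_real (\<theta> k)))
             * (\<Prod>k\<in>UNIV. complex_of_real (sgn (x $ k)) ^ m k)) \<noteq> 0"
begin

lemma kernel_exists:
  assumes j: "j \<in> A" and m: "\<forall>k. k \<notin> A \<longrightarrow> m k = 0" and c: "c > 0"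
  obtains g K where "g \<in> borel_measurable borel" "\<And>v. cmod (g v) \<le> K / (1 + v\<^sup>2)"
    "\<And>u. (LINT x|\<rho>. of_real (\<bar>x $ j\<bar> powr \<alpha>) * mchar A \<theta> m x * g (ln \<bar>x $ j\<bar> + u)) = of_real (bump_transform c u)"
proof -
  note [measurable_cong] = sets_rho
  define w where "w x = of_real (\<bar>x $ j\<bar> powr \<alpha>) * mchar A \<theta> m x" for x
  have wm[measurable]: "w \<in> borel_measurable \<rho>" unfolding w_def[abs_def] by measurable
  have int: "integrable \<rho> (\<lambda>x. w x * of_real (ln \<bar>x $ j\<bar> ^ k))" if "k \<le> 4" for k
  proof (rule Bochner_Integration.integrable_bound[OF moments[OF that, of j]])
    show "AE x in \<rho>. norm (w x * of_real (ln \<bar>x $ j\<bar> ^ k)) \<le> norm (\<bar>x $ j\<bar> powr \<alpha> * ln \<bar>x $ j\<bar> ^ k)"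
    proof (rule AE_I2)
      fix x :: "real^'n"
      have "cmod (mchar A \<theta> m x) \<le> 1" by (rule norm_chr_le) (rule sgn_coords_le_1)
      then have "\<bar>x $ j\<bar> powr \<alpha> * cmod (mchar A \<theta> m x) \<le> \<bar>x $ j\<bar> powr \<alpha>" by (simp add: mult_left_le)
      from mult_right_mono[OF this, of "\<bar>ln \<bar>x $ j\<bar> ^ k\<bar>"]
      show "norm (w x * of_real (ln \<bar>x $ j\<bar> ^ k)) \<le> norm (\<bar>x $ j\<bar> powr \<alpha> * ln \<bar>x $ j\<bar> ^ k)"
        by (simp add: w_def norm_mult abs_mult power_abs norm_power)
    qed
  qed measurable
  have nz: "integral\<^sup>L \<rho> (\<lambda>x. w x * cis (t * ln \<bar>x $ j\<bar>)) \<noteq> 0" for t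
  proof -
    \<comment> \<open>The additional frequency \<open>t\<close> in ln \<bar>x_j\<bar> is absorbed
      into \<theta> at the coordinate \<open>j\<close>, so the hypothesis over all \<theta> covers
      all \<open>t\<close>.\<close>
    define \<theta>' where "\<theta>' k = (if k = j then \<theta> k + t else \<theta> k)" for k
    have eq: "w x * cis (t * ln \<bar>x $ j\<bar>) = of_real (\<bar>x $ j\<bar> powr \<alpha>) * mchar A \<theta>' m x" for x
    proof -
      have "(\<Sum>k\<in>UNIV. \<theta>' k * log_coords A x $ k) = (\<Sum>k\<in>UNIV. \<theta> k * log_coords A x $ k + (if k = j then t * log_coords A x $ k else 0))"
        by (intro sum.cong) (auto simp: \<theta>'_def algebra_simps)
      also have "\<dots> = (\<Sum>k\<in>UNIV. \<theta> k * log_coords A x $ k) + t * ln \<bar>x $ j\<bar>"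
        using j by (simp add: sum.distrib log_coords_def)
      finally show ?thesis by (simp add: w_def chr_def cis_mult[symmetric] mult_ac)
    qed
    have "integral\<^sup>L \<rho> (\<lambda>x. w x * cis (t * ln \<bar>x $ j\<bar>)) =
      (LINT x|\<rho>. complex_of_real (\<bar>x $ j\<bar> powr \<alpha>)
             * (\<Prod>k\<in>UNIV. complex_of_real \<bar>x $ k\<bar> powr (\<i> * complex_of_real (if k \<in> A then \<theta>' k else 0)))
             * (\<Prod>k\<in>UNIV. complex_of_real (sgn (x $ k)) ^ (m k mod 2)))"
    proof (rule integral_cong_AE)
      show "AE x in \<rho>. w x * cis (t * ln \<bar>x $ j\<bar>) = complex_of_real (\<bar>x $ j\<bar> powr \<alpha>)
             * (\<Prod>k\<in>UNIV. complex_of_real \<bar>x $ k\<bar> powr (\<i> * complex_of_real (if k \<in> A then \<theta>' k else 0)))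
             * (\<Prod>k\<in>UNIV. complex_of_real (sgn (x $ k)) ^ (m k mod 2))"
        using AE_nonzero_coordinates[OF sets_rho rho_coord]
        by eventually_elim (simp add: eq mchar_eq_product[OF _ m] mult.assoc)
      show "(\<lambda>x. w x * cis (t * ln \<bar>x $ j\<bar>)) \<in> borel_measurable \<rho>" unfolding eq by measurable
      have [measurable]: "(\<lambda>x::real^'n. complex_of_real \<bar>x $ k\<bar> powr (\<i> * complex_of_real a)) \<in> borel_measurable borel" for k a
      proof -
        have "(\<lambda>x::real^'n. complex_of_real \<bar>x $ k\<bar> powr (\<i> * complex_of_real a)) = (\<lambda>x. if x $ k = 0 then 0 else cis (a * ln \<bar>x $ k\<bar>))"
          by (auto simp: powr_def cis_conv_exp Ln_of_real mult_ac)
        moreover have "(\<lambda>x::real^'n. cis (a * ln \<bar>x $ k\<bar>)) \<in> borel_measurable borel"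
          by (rule measurable_compose[of _ _ borel]) (auto intro!: borel_measurable_continuous_onI continuous_intros)
        ultimately show ?thesis by simp
      qed
      show "(\<lambda>x. complex_of_real (\<bar>x $ j\<bar> powr \<alpha>)
             * (\<Prod>k\<in>UNIV. complex_of_real \<bar>x $ k\<bar> powr (\<i> * complex_of_real (if k \<in> A then \<theta>' k else 0)))
             * (\<Prod>k\<in>UNIV. complex_of_real (sgn (x $ k)) ^ (m k mod 2))) \<in> borel_measurable \<rho>" by measurable
    qed
    also have "\<dots> \<noteq> 0" by (rule nonvanish) (simp add: mod2_eq_if)
    finally show ?thesis .
  qed
  have lm: "(\<lambda>x. ln \<bar>x $ j\<bar>) \<in> borel_measurable \<rho>" by measurable
  show ?thesis
  proof (rule deconvolution_kernel[OF sigma_rho c int lm nz])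
    fix g K assume "g \<in> borel_measurable borel" "\<And>v. cmod (g v) \<le> K / (1 + v\<^sup>2)"
      "\<And>u. integral\<^sup>L \<rho> (\<lambda>x. w x * g (ln \<bar>x $ j\<bar> + u)) = of_real (bump_transform c u)"
    then show thesis unfolding w_def by (rule that)
  qed
qed

text \<open>The weight that remains on the side of \<nu> after \<rho> has been integrated out. It is
  the same for all characters, so that equality of all integrals against characters becomes a
  statement about one weighted measure.\<close>

definition bump_weight :: "'n set \<Rightarrow> 'n \<Rightarrow> real \<Rightarrow> real^'n \<Rightarrow> real" where
  "bump_weight A j c y = indicator (stratum A) y * \<bar>y $ j\<bar> powr \<alpha> * bump_transform c (ln \<bar>y $ j\<bar>)"

text \<open>Powers and characters are multiplicative and the logarithm is additive, so at fixed
  \<open>y\<close> the integral of \<open>G\<close> over \<open>x\<close> is the kernel identity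
  with shift ln \<bar>y_j\<bar>. One \<open>G\<close> serves every \<nu>' with the same convolution,
  and this makes the left-hand integrals coincide. The tail bound of the convolution makes
  \<open>G\<close> integrable, hence Fubini's theorem applicable.\<close>

lemma integral_mult_conv_character:
  assumes j: "j \<in> A" and m: "\<forall>k. k \<notin> A \<longrightarrow> m k = 0" and c: "c > 0"
    and \<nu>: "sets \<nu> = sets borel" "sigma_finite_measure \<nu>" and tb: "tail_bounded (\<nu> \<circledast> \<rho>) \<alpha>"
  obtains G where "integrable \<nu> (\<lambda>y. of_real (bump_weight A j c y) * mchar A \<theta> m y)"
    "\<And>\<nu>'. sets \<nu>' = sets borel \<Longrightarrow> sigma_finite_measure \<nu>' \<Longrightarrow> \<nu>' \<circledast> \<rho> = \<nu> \<circledast> \<rho> \<Longrightarrow>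
       (LINT y|\<nu>'. of_real (bump_weight A j c y) * mchar A \<theta> m y) = integral\<^sup>L (\<nu> \<circledast> \<rho>) (G :: _ \<Rightarrow> complex)"
proof -
  obtain g K where gm: "g \<in> borel_measurable borel" and gK: "\<And>v. cmod (g v) \<le> K / (1 + v\<^sup>2)"
    and g: "\<And>u. (LINT x|\<rho>. of_real (\<bar>x $ j\<bar> powr \<alpha>) * mchar A \<theta> m x * g (ln \<bar>x $ j\<bar> + u)) = of_real (bump_transform c u)"
    using kernel_exists[OF j m c, where \<theta>=\<theta>] by blast
  note [measurable] = gm
  define G where "G z = indicator (stratum A) z *\<^sub>R (of_real (\<bar>z $ j\<bar> powr \<alpha>) * mchar A \<theta> m z * g (ln \<bar>z $ j\<bar>))" for z
  have Gm[measurable]: "G \<in> borel_measurable borel" unfolding G_def[abs_def] by measurable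
  have intG: "integrable (\<nu> \<circledast> \<rho>) G"
  proof (rule Bochner_Integration.integrable_bound)
    show "integrable (\<nu> \<circledast> \<rho>) (\<lambda>z. K * (\<bar>z $ j\<bar> powr \<alpha> / (1 + (ln \<bar>z $ j\<bar>)\<^sup>2)))"
      by (intro integrable_mult_right integrable_log_weight[OF tb alpha])
    show "G \<in> borel_measurable (\<nu> \<circledast> \<rho>)" using Gm measurable_cong_sets[OF sets_mult_conv refl] by blast
    show "AE z in \<nu> \<circledast> \<rho>. norm (G z) \<le> norm (K * (\<bar>z $ j\<bar> powr \<alpha> / (1 + (ln \<bar>z $ j\<bar>)\<^sup>2)))"
    proof (rule AE_I2)
      fix z
      have "cmod (mchar A \<theta> m z) \<le> 1" by (rule norm_chr_le) (rule sgn_coords_le_1)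
      then have "\<bar>z $ j\<bar> powr \<alpha> * cmod (mchar A \<theta> m z) * cmod (g (ln \<bar>z $ j\<bar>)) \<le>
          \<bar>z $ j\<bar> powr \<alpha> * 1 * (K / (1 + (ln \<bar>z $ j\<bar>)\<^sup>2))"
        by (intro mult_mono gK) auto
      moreover have "norm (G z) \<le> \<bar>z $ j\<bar> powr \<alpha> * cmod (mchar A \<theta> m z) * cmod (g (ln \<bar>z $ j\<bar>))"
        by (simp add: G_def norm_mult indicator_def)
      moreover have "\<bar>z $ j\<bar> powr \<alpha> * 1 * (K / (1 + (ln \<bar>z $ j\<bar>)\<^sup>2)) = K * (\<bar>z $ j\<bar> powr \<alpha> / (1 + (ln \<bar>z $ j\<bar>)\<^sup>2))"
        by simp
      ultimately show "norm (G z) \<le> norm (K * (\<bar>z $ j\<bar> powr \<alpha> / (1 + (ln \<bar>z $ j\<bar>)\<^sup>2)))"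
        unfolding real_norm_def by linarith
    qed
  qed
  have main: "integrable \<nu>' (\<lambda>y. of_real (bump_weight A j c y) * mchar A \<theta> m y) \<and>
      (LINT y|\<nu>'. of_real (bump_weight A j c y) * mchar A \<theta> m y) = integral\<^sup>L (\<nu> \<circledast> \<rho>) G"
    if s: "sets \<nu>' = sets borel" and sf: "sigma_finite_measure \<nu>'" and eq: "\<nu>' \<circledast> \<rho> = \<nu> \<circledast> \<rho>" for \<nu>'
  proof -
    note [measurable_cong] = s sets_rho
    interpret pair_sigma_finite \<rho> \<nu>' unfolding pair_sigma_finite_def using sigma_rho sf by auto
    have dm: "(\<lambda>p. diag_map (fst p) (snd p)) \<in> (\<rho> \<Otimes>\<^sub>M \<nu>') \<rightarrow>\<^sub>M borel" by measurable
    have ip: "integrable (\<rho> \<Otimes>\<^sub>M \<nu>') (\<lambda>p. G (diag_map (fst p) (snd p)))"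
      using intG unfolding eq[symmetric] mult_conv_eq_distr[OF sets_rho s sf]
      by (subst (asm) integrable_distr_eq[OF dm Gm])
    have ip': "integrable (\<rho> \<Otimes>\<^sub>M \<nu>') (\<lambda>(x, y). G (diag_map x y))"
      using ip by (simp add: case_prod_beta')
    have inner: "(\<integral>x. G (diag_map x y) \<partial>\<rho>) = of_real (bump_weight A j c y) * mchar A \<theta> m y" for y
    proof (cases "y \<in> stratum A")
      case True
      have yj: "y $ j \<noteq> 0" using True j by (auto simp: stratum_def)
      have "(\<integral>x. G (diag_map x y) \<partial>\<rho>) = (\<integral>x. (of_real (\<bar>y $ j\<bar> powr \<alpha>) * mchar A \<theta> m y) *
          (of_real (\<bar>x $ j\<bar> powr \<alpha>) * mchar A \<theta> m x * g (ln \<bar>x $ j\<bar> + ln \<bar>y $ j\<bar>)) \<partial>\<rho>)"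
      proof (rule integral_cong_AE)
        show "AE x in \<rho>. G (diag_map x y) = (of_real (\<bar>y $ j\<bar> powr \<alpha>) * mchar A \<theta> m y) *
          (of_real (\<bar>x $ j\<bar> powr \<alpha>) * mchar A \<theta> m x * g (ln \<bar>x $ j\<bar> + ln \<bar>y $ j\<bar>))"
          using AE_nonzero_coordinates[OF sets_rho rho_coord]
        proof eventually_elim
          case (elim x)
          have "\<bar>diag_map x y $ j\<bar> = \<bar>x $ j\<bar> * \<bar>y $ j\<bar>" by (simp add: diag_map_def abs_mult)
          moreover have "ln (\<bar>x $ j\<bar> * \<bar>y $ j\<bar>) = ln \<bar>x $ j\<bar> + ln \<bar>y $ j\<bar>"
            using elim yj by (subst ln_mult) auto
          ultimately show ?case
            using elim True by (simp add: G_def diag_map_stratum mchar_diag_map powr_mult mult_ac)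
        qed
        have "(\<lambda>x. diag_map x y) \<in> borel_measurable \<rho>" unfolding diag_map_def by measurable
        then show "(\<lambda>x. G (diag_map x y)) \<in> borel_measurable \<rho>" by measurable
      qed measurable
      also have "\<dots> = (of_real (\<bar>y $ j\<bar> powr \<alpha>) * mchar A \<theta> m y) * of_real (bump_transform c (ln \<bar>y $ j\<bar>))"
        by (simp only: integral_mult_right_zero g)
      finally show ?thesis using True by (simp add: bump_weight_def mult_ac)
    next
      case False
      have "(\<integral>x. G (diag_map x y) \<partial>\<rho>) = (\<integral>x. 0 \<partial>\<rho>)"
      proof (rule integral_cong_AE)
        show "AE x in \<rho>. G (diag_map x y) = 0"
          using AE_nonzero_coordinates[OF sets_rho rho_coord]
          by eventually_elim (simp add: G_def diag_map_stratum False)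
        have "(\<lambda>x. diag_map x y) \<in> borel_measurable \<rho>" unfolding diag_map_def by measurable
        then show "(\<lambda>x. G (diag_map x y)) \<in> borel_measurable \<rho>" by measurable
      qed simp
      then show ?thesis using False by (simp add: bump_weight_def)
    qed
    have "integrable \<nu>' (\<lambda>y. \<integral>x. G (diag_map x y) \<partial>\<rho>)" by (rule integrable_snd[OF ip'])
    moreover have "(\<integral>y. (\<integral>x. G (diag_map x y) \<partial>\<rho>) \<partial>\<nu>') = integral\<^sup>L (\<rho> \<Otimes>\<^sub>M \<nu>') (\<lambda>(x, y). G (diag_map x y))"
      by (rule integral_snd[OF ip'])
    moreover have "integral\<^sup>L (\<nu> \<circledast> \<rho>) G = integral\<^sup>L (\<rho> \<Otimes>\<^sub>M \<nu>') (\<lambda>(x, y). G (diag_map x y))"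
      unfolding eq[symmetric] mult_conv_eq_distr[OF sets_rho s sf]
      by (subst integral_distr[OF dm Gm]) (simp add: case_prod_beta')
    ultimately show ?thesis unfolding inner by simp
  qed
  show ?thesis by (rule that[of G]) (use main[OF \<nu> refl] main in auto)
qed

lemma integral_bump_weight_eq:
  assumes j: "j \<in> A" and c: "c > 0"
    and \<nu>1: "sets \<nu>1 = sets borel" "sigma_finite_measure \<nu>1" and \<nu>2: "sets \<nu>2 = sets borel" "sigma_finite_measure \<nu>2"
    and eq: "\<nu>1 \<circledast> \<rho> = \<nu>2 \<circledast> \<rho>" and tb: "tail_bounded (\<nu>1 \<circledast> \<rho>) \<alpha>"
    and f: "continuous_on UNIV f" "\<And>z. \<bar>f z\<bar> \<le> B"
  shows "integrable \<nu>1 (bump_weight A j c)"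
    "(LINT y|\<nu>1. bump_weight A j c y * f (log_coords A y, sgn_coords A y)) =
     (LINT y|\<nu>2. bump_weight A j c y * f (log_coords A y, sgn_coords A y))"
proof -
  have tb2: "tail_bounded (\<nu>2 \<circledast> \<rho>) \<alpha>" using tb eq by simp
  have i: "integrable \<nu> (bump_weight A j c)"
    if "sets \<nu> = sets borel" "sigma_finite_measure \<nu>" "tail_bounded (\<nu> \<circledast> \<rho>) \<alpha>" for \<nu>
  proof -
    \<comment> \<open>The trivial character isolates the integrability of the weight itself.\<close>
    have "chr (log_coords A) (sgn_coords A) (\<lambda>_. 0) (\<lambda>_. 0) = (\<lambda>y. 1)" by (auto simp: chr_def)
    moreover have "integrable \<nu> (\<lambda>y. of_real (bump_weight A j c y) * mchar A (\<lambda>_. 0) (\<lambda>_. 0) y)"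
      by (rule integral_mult_conv_character[OF j _ c that, where \<theta>="\<lambda>_. 0" and m="\<lambda>_. 0"]) auto
    ultimately have "integrable \<nu> (\<lambda>y. complex_of_real (bump_weight A j c y))" by simp
    then show ?thesis by (simp only: complex_of_real_integrable_eq)
  qed
  show i1: "integrable \<nu>1 (bump_weight A j c)" using i[OF \<nu>1 tb] .
  show "(LINT y|\<nu>1. bump_weight A j c y * f (log_coords A y, sgn_coords A y)) =
     (LINT y|\<nu>2. bump_weight A j c y * f (log_coords A y, sgn_coords A y))"
  proof (rule integral_eq_if_characters_eq[OF _ _ _ sgn_coords_le_1 i1 i[OF \<nu>2 tb2] _ f])
    show "sets \<nu>1 = sets \<nu>2" using \<nu>1 \<nu>2 by simp
    show "log_coords A \<in> borel_measurable \<nu>1" "sgn_coords A \<in> borel_measurable \<nu>1"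
      using log_coords_measurable sgn_coords_measurable measurable_cong_sets[OF \<nu>1(1) refl] by blast+
    fix \<theta> :: "'n \<Rightarrow> real" and m :: "'n \<Rightarrow> nat"
    show "(LINT y|\<nu>1. of_real (bump_weight A j c y) * mchar A \<theta> m y) = (LINT y|\<nu>2. of_real (bump_weight A j c y) * mchar A \<theta> m y)"
    proof (cases "\<forall>k. k \<notin> A \<longrightarrow> m k = 0")
      case True
      obtain G :: "_ \<Rightarrow> complex" where G: "\<And>\<nu>'. sets \<nu>' = sets borel \<Longrightarrow> sigma_finite_measure \<nu>' \<Longrightarrow> \<nu>' \<circledast> \<rho> = \<nu>1 \<circledast> \<rho> \<Longrightarrow>
       (LINT y|\<nu>'. of_real (bump_weight A j c y) * mchar A \<theta> m y) = integral\<^sup>L (\<nu>1 \<circledast> \<rho>) G"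
        using integral_mult_conv_character[OF j True c \<nu>1 tb, of \<theta>] by metis
      show ?thesis using G[OF \<nu>1 refl] G[OF \<nu>2 eq[symmetric]] by simp
    next
      \<comment> \<open>A recorded sign outside \<open>A\<close> is 0 and occurs here to a positive
        power, so both integrands vanish.\<close>
      case False
      then obtain k where "k \<notin> A" "m k \<noteq> 0" by blast
      then have "mchar A \<theta> m y = 0" for y
        unfolding chr_def by (auto intro!: bexI[of _ k] simp: sgn_coords_def)
      then show ?thesis by simp
    qed
  qed
qed

text \<open>For c > 0 a triangle in the logarithm, supported in the window \<bar>ln
  \<bar>y_j\<bar>\<bar> \<le> 1/c on which the bump transform is positive, and increasing to 1 as c
  decreases to 0. At \<open>y $ j = 0\<close> the convention \<open>ln 0 = 0\<close> gives the value
  1; the indicator of a stratum with \<open>j \<in> A\<close> removes such points.\<close>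

definition hat :: "real \<Rightarrow> 'n \<Rightarrow> real^'n \<Rightarrow> real" where
  "hat c j y = max 0 (1 - c * \<bar>ln \<bar>y $ j\<bar>\<bar>)"

lemma integral_hat_eq:
  assumes j: "j \<in> A" and c: "c > 0"
    and \<nu>1: "sets \<nu>1 = sets borel" "sigma_finite_measure \<nu>1" and \<nu>2: "sets \<nu>2 = sets borel" "sigma_finite_measure \<nu>2"
    and eq: "\<nu>1 \<circledast> \<rho> = \<nu>2 \<circledast> \<rho>" and tb: "tail_bounded (\<nu>1 \<circledast> \<rho>) \<alpha>"
    and F: "continuous_on UNIV F" "\<And>z. \<bar>F z\<bar> \<le> B"
  shows "(LINT y|\<nu>1. indicator (stratum A) y * hat c j y * F y) = (LINT y|\<nu>2. indicator (stratum A) y * hat c j y * F y)"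
proof -
  have "compact {-(1/c)..1/c}" "{-(1/c)..1/c} \<noteq> {}" using c by auto
  then obtain v0 where v0: "v0 \<in> {-(1/c)..1/c}" "\<And>v. v \<in> {-(1/c)..1/c} \<Longrightarrow> bump_transform c v0 \<le> bump_transform c v"
    using continuous_attains_inf[OF _ _ continuous_on_bump_transform] by metis
  define b0 where "b0 = bump_transform c v0"
  have b0: "b0 > 0" unfolding b0_def by (rule bump_transform_pos[OF c]) (use v0 in auto)
  \<comment> \<open>Divides the hat by \<bar>y_j\<bar>^\<alpha> and by the bump transform, as
    functions of v = ln \<bar>y_j\<bar>. The maximum with \<open>b0\<close>, the minimum over the
    window, changes nothing where the hat is positive and keeps \<open>k\<close> continuous
    everywhere.\<close>
  define k where "k v = max 0 (1 - c * \<bar>v\<bar>) / (exp (\<alpha> * v) * max b0 (bump_transform c v))" for v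
  have kc: "continuous_on UNIV k"
    unfolding k_def[abs_def] using b0 by (intro continuous_intros continuous_on_bump_transform) auto
  have k: "\<bar>v\<bar> \<le> 1 / c" "bump_transform c v \<ge> b0" if "k v \<noteq> 0" for v
  proof -
    have "1 - c * \<bar>v\<bar> > 0" using that by (auto simp: k_def max_def split: if_splits)
    then show "\<bar>v\<bar> \<le> 1 / c" using c by (simp add: field_simps)
    then show "bump_transform c v \<ge> b0" unfolding b0_def by (intro v0(2)) auto
  qed
  have kb: "0 \<le> k v" "k v \<le> exp (\<alpha> / c) / b0" for v
  proof -
    show "0 \<le> k v" using b0 by (auto simp: k_def)
    show "k v \<le> exp (\<alpha> / c) / b0"
    proof (cases "k v = 0")
      case False
      have "exp (- \<alpha> / c) \<le> exp (\<alpha> * v)" using k(1)[OF False] alpha c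
        using mult_left_mono[of "- (1 / c)" v \<alpha>] by simp
      then have "k v \<le> 1 / (exp (- \<alpha> / c) * b0)"
        unfolding k_def using b0 c by (intro frac_le mult_mono) auto
      then show ?thesis by (simp add: exp_minus field_simps)
    qed (use b0 in auto)
  qed
  \<comment> \<open>Undoes the passage to logarithms and signs, so that a function of the vector
    becomes a continuous function of the two coordinate vectors.\<close>
  define f where "f z = F (\<chi> i. snd z $ i * exp (fst z $ i)) * k (fst z $ j)" for z
  have fc: "continuous_on UNIV f"
    unfolding f_def[abs_def]
    by (intro continuous_intros continuous_on_compose2[OF F(1)] continuous_on_compose2[OF kc] continuous_on_vec_lambda) auto
  have "0 \<le> B" using F(2)[of undefined] by linarith
  then have fb: "\<bar>f z\<bar> \<le> B * (exp (\<alpha> / c) / b0)" for z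
    unfolding f_def abs_mult using kb by (intro mult_mono F(2)) auto
  have "bump_weight A j c y * f (log_coords A y, sgn_coords A y) = indicator (stratum A) y * hat c j y * F y" for y
  proof (cases "y \<in> stratum A")
    case True
    have yj: "y $ j \<noteq> 0" using True j by (auto simp: stratum_def)
    have "(\<chi> i. sgn_coords A y $ i * exp (log_coords A y $ i)) = y"
      using True by (auto simp: vec_eq_iff sgn_coords_def log_coords_def stratum_def sgn_mult_abs)
    moreover have "\<bar>y $ j\<bar> powr \<alpha> * bump_transform c (ln \<bar>y $ j\<bar>) * k (ln \<bar>y $ j\<bar>) = hat c j y"
    proof (cases "k (ln \<bar>y $ j\<bar>) = 0")
      case True
      then have "max 0 (1 - c * \<bar>ln \<bar>y $ j\<bar>\<bar>) = 0" using b0 by (auto simp: k_def)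
      then show ?thesis using True by (simp add: hat_def)
    next
      case False
      have "max b0 (bump_transform c (ln \<bar>y $ j\<bar>)) = bump_transform c (ln \<bar>y $ j\<bar>)" using k(2)[OF False] by simp
      moreover have "bump_transform c (ln \<bar>y $ j\<bar>) > 0" using k(2)[OF False] b0 by linarith
      moreover have "\<bar>y $ j\<bar> powr \<alpha> = exp (\<alpha> * ln \<bar>y $ j\<bar>)" using yj by (simp add: powr_def)
      ultimately show ?thesis by (simp add: k_def hat_def)
    qed
    ultimately show ?thesis using True j by (simp add: bump_weight_def f_def log_coords_def mult_ac)
  qed (simp add: bump_weight_def)
  then show ?thesis
    using integral_bump_weight_eq(2)[OF j c \<nu>1 \<nu>2 eq tb fc fb] by simp
qed

text \<open>Weighted by the hats, the restrictions to a stratum agree as measures; monotone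
  convergence removes the hats, and the finitely many strata add up. The stratum of the empty set is
  the origin, which is null by hypothesis.\<close>

lemma mult_conv_cancel:
  assumes \<nu>1: "tail_bounded \<nu>1 \<alpha>" "emeasure \<nu>1 {0} = 0" and \<nu>2: "tail_bounded \<nu>2 \<alpha>" "emeasure \<nu>2 {0} = 0"
    and eq: "\<nu>1 \<circledast> \<rho> = \<nu>2 \<circledast> \<rho>" and tb: "tail_bounded (\<nu>1 \<circledast> \<rho>) \<alpha>"
  shows "\<nu>1 = \<nu>2"
proof -
  have s: "sets \<nu>1 = sets borel" "sets \<nu>2 = sets borel" using \<nu>1 \<nu>2 by (auto simp: tail_bounded_def)
  have sf: "sigma_finite_measure \<nu>1" "sigma_finite_measure \<nu>2"
    using tail_bounded_sigma_finite \<nu>1 \<nu>2 by auto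
  define D where "D A j n \<nu> = density \<nu> (\<lambda>y. ennreal (indicator (stratum A) y * hat (1 / real (Suc n)) j y))" for A j n and \<nu> :: "(real^'n) measure"
  have hatm[measurable]: "hat c j \<in> borel_measurable borel" for c j unfolding hat_def[abs_def] by measurable
  have hat: "0 \<le> hat c j y" "hat c j y \<le> 1" if "c > 0" for c j y using that by (auto simp: hat_def)
  have emD: "emeasure (D A j n \<nu>) X = (\<integral>\<^sup>+y. ennreal (indicator (stratum A) y * hat (1 / real (Suc n)) j y) * indicator X y \<partial>\<nu>)"
    if "sets \<nu> = sets borel" "X \<in> sets borel" for \<nu> X A j n
  proof -
    note [measurable_cong] = that(1)
    show ?thesis unfolding D_def using that by (subst emeasure_density) auto
  qed
  have D_eq: "D A j n \<nu>1 = D A j n \<nu>2" if j: "j \<in> A" for A j n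
  proof (rule measure_eqI_away_test)
    have c: "1 / real (Suc n) > 0" by simp
    have "finite_away (D A j n \<nu>)" if \<nu>: "tail_bounded \<nu> \<alpha>" for \<nu>
    proof -
      have s: "sets \<nu> = sets borel" using \<nu> by (simp add: tail_bounded_def)
      note [measurable_cong] = s
      have "emeasure (D A j n \<nu>) {x. r \<le> norm x} < \<infinity>" if "r > 0" for r
      proof -
        have "emeasure (D A j n \<nu>) {x. r \<le> norm x} \<le> (\<integral>\<^sup>+y. indicator {x. r \<le> norm x} y \<partial>\<nu>)"
        proof (subst emD[OF s])
          have "ennreal (indicator (stratum A) y * hat (1 / real (Suc n)) j y) \<le> 1" for y
            using hat[OF c, where y=y and j=j] by (cases "y \<in> stratum A") (simp_all add: ennreal_le_1)
          from mult_right_mono[OF this]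
          show "(\<integral>\<^sup>+y. ennreal (indicator (stratum A) y * hat (1 / real (Suc n)) j y) * indicator {x. r \<le> norm x} y \<partial>\<nu>)
              \<le> (\<integral>\<^sup>+y. indicator {x. r \<le> norm x} y \<partial>\<nu>)"
            by (intro nn_integral_mono) (metis mult_1 zero_le)
        qed simp
        also have "\<dots> = emeasure \<nu> {x. r \<le> norm x}" by simp
        also have "\<dots> < \<infinity>" using tail_bounded_finite_away[OF \<nu>] that by (simp add: finite_away_def)
        finally show ?thesis .
      qed
      then show ?thesis by (simp add: finite_away_def D_def s)
    qed
    then show "finite_away (D A j n \<nu>1)" "finite_away (D A j n \<nu>2)" using \<nu>1 \<nu>2 by auto
    have "0 \<notin> stratum A" using j by (auto simp: stratum_def)
    then have zz: "ennreal (indicator (stratum A) y * hat (1 / real (Suc n)) j y) * indicator {0} y = 0" for y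
      by (auto simp: indicator_def)
    show "emeasure (D A j n \<nu>1) {0} = 0" "emeasure (D A j n \<nu>2) {0} = 0"
      by (subst emD, simp add: s, simp, simp only: zz, simp)+
    fix f :: "real^'n \<Rightarrow> real" assume f: "f \<in> away_test"
    then obtain B r where fc: "continuous_on UNIV f" "f \<in> borel_measurable borel" "\<And>x. \<bar>f x\<bar> \<le> B"
      using away_testE[OF f] by metis
    have "integral\<^sup>L (D A j n \<nu>) f = (LINT y|\<nu>. indicator (stratum A) y * hat (1 / real (Suc n)) j y * f y)"
      if "sets \<nu> = sets borel" for \<nu>
    proof -
      note [measurable_cong] = that and [measurable] = fc(2)
      show ?thesis unfolding D_def using hat[OF c] by (subst integral_real_density) auto
    qed
    then show "integral\<^sup>L (D A j n \<nu>1) f = integral\<^sup>L (D A j n \<nu>2) f"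
      using integral_hat_eq[OF j c s(1) sf(1) s(2) sf(2) eq tb fc(1,3)] s by simp
  qed
  have stratum_eq: "emeasure \<nu>1 (X \<inter> stratum A) = emeasure \<nu>2 (X \<inter> stratum A)"
    if X[measurable]: "X \<in> sets borel" for X A
  proof (cases "A = {}")
    case True
    have "X \<inter> stratum A \<subseteq> {0}" using True by (auto simp: stratum_def vec_eq_iff)
    then have "emeasure \<nu> (X \<inter> stratum A) = 0" if "emeasure \<nu> {0} = 0" "sets \<nu> = sets borel" for \<nu>
      using emeasure_mono[of "X \<inter> stratum A" "{0}" \<nu>] that by simp
    then show ?thesis using \<nu>1 \<nu>2 s by simp
  next
    case False
    then obtain j where j: "j \<in> A" by blast
    have lim: "(\<lambda>n. emeasure (D A j n \<nu>) X) \<longlonglongrightarrow> emeasure \<nu> (X \<inter> stratum A)" if "sets \<nu> = sets borel" for \<nu>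
    proof -
      note [measurable_cong] = that
      have hmono: "hat (1 / real (Suc m)) j y \<le> hat (1 / real (Suc n)) j y" if "m \<le> n" for m n y
        unfolding hat_def using that by (intro max.mono diff_left_mono mult_right_mono frac_le) auto
      have h1: "(\<lambda>n. hat (1 / real (Suc n)) j y) \<longlonglongrightarrow> 1" for y
      proof -
        have "(\<lambda>n. max 0 (1 - 1 / real (Suc n) * \<bar>ln \<bar>y $ j\<bar>\<bar>)) \<longlonglongrightarrow> max 0 (1 - 0 * \<bar>ln \<bar>y $ j\<bar>\<bar>)"
          by (intro tendsto_intros LIMSEQ_Suc[OF lim_1_over_n])
        then show ?thesis by (simp add: hat_def)
      qed
      have "(\<lambda>n. \<integral>\<^sup>+y. ennreal (indicator (stratum A) y * hat (1 / real (Suc n)) j y) * indicator X y \<partial>\<nu>) \<longlonglongrightarrow>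
          (\<integral>\<^sup>+y. indicator (X \<inter> stratum A) y \<partial>\<nu>)"
      proof (rule nn_integral_LIMSEQ)
        show "incseq (\<lambda>n y. ennreal (indicator (stratum A) y * hat (1 / real (Suc n)) j y) * indicator X y)"
          using hmono by (auto simp: incseq_def le_fun_def indicator_def intro!: ennreal_leI)
        show "(\<lambda>n. ennreal (indicator (stratum A) y * hat (1 / real (Suc n)) j y) * indicator X y) \<longlonglongrightarrow> indicator (X \<inter> stratum A) y" for y
          using tendsto_ennrealI[OF h1[of y]] by (auto simp: indicator_def)
      qed measurable
      then show ?thesis using that by (simp add: emD)
    qed
    show ?thesis using lim[OF s(1)] lim[OF s(2)] unfolding D_eq[OF j] by (rule LIMSEQ_unique)
  qed
  show ?thesis
  proof (rule measure_eqI)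
    show "sets \<nu>1 = sets \<nu>2" using s by simp
    fix X assume "X \<in> sets \<nu>1"
    then have X[measurable]: "X \<in> sets borel" using s by simp
    have "emeasure \<nu> X = (\<Sum>A\<in>UNIV. emeasure \<nu> (X \<inter> stratum A))" if "sets \<nu> = sets borel" for \<nu>
    proof -
      have "emeasure \<nu> (\<Union>A\<in>UNIV. X \<inter> stratum A) = (\<Sum>A\<in>UNIV. emeasure \<nu> (X \<inter> stratum A))"
      proof (rule sum_emeasure[symmetric])
        show "disjoint_family_on (\<lambda>A. X \<inter> stratum A) UNIV"
          by (auto simp: disjoint_family_on_def stratum_def)
      qed (auto simp: that)
      moreover have "(\<Union>A\<in>UNIV. X \<inter> stratum A) = X"
        by (auto simp: stratum_def intro: exI[of _ "{k. _ $ k \<noteq> 0}"])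
      ultimately show ?thesis by simp
    qed
    then show "emeasure \<nu>1 X = emeasure \<nu>2 X" using s stratum_eq[OF X] by simp
  qed
qed

end

subsection \<open>Regularly varying tails\<close>

lemma is_norm_nonneg: assumes "is_norm N" shows "0 \<le> N x"
proof -
  have N: "\<And>x. N x = 0 \<longleftrightarrow> x = 0" "\<And>c x. N (c *\<^sub>R x) = \<bar>c\<bar> * N x" "\<And>x y. N (x + y) \<le> N x + N y"
    using assms unfolding is_norm_def by blast+
  have "N (x + (-1) *\<^sub>R x) \<le> N x + N ((-1) *\<^sub>R x)" by (rule N(3))
  then show ?thesis using N(1)[of 0] N(2)[of "-1" x] by simp
qed

lemma is_norm_scale: "is_norm N \<Longrightarrow> N (c *\<^sub>R x) = \<bar>c\<bar> * N x"
  unfolding is_norm_def by blast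

lemma is_norm_upper:
  fixes N :: "real^'n \<Rightarrow> real"
  assumes "is_norm N"
  obtains c where "c > 0" "\<And>x. N x \<le> c * norm x"
proof -
  have N: "\<And>x. N x = 0 \<longleftrightarrow> x = 0" "\<And>c x. N (c *\<^sub>R x) = \<bar>c\<bar> * N x" "\<And>x y. N (x + y) \<le> N x + N y"
    using assms unfolding is_norm_def by blast+
  have Nsum: "finite S \<Longrightarrow> N (\<Sum>i\<in>S. f i) \<le> (\<Sum>i\<in>S. N (f i))" for S and f :: "'n \<Rightarrow> real^'n"
  proof (induction S rule: finite_induct)
    case empty
    show ?case using N(1)[of 0] by simp
  next
    case (insert i S)
    then show ?case using N(3)[of "f i" "\<Sum>i\<in>S. f i"] by simp
  qed
  define c where "c = (\<Sum>i\<in>(UNIV::'n set). N (axis i 1))"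
  have c: "0 \<le> c" unfolding c_def by (intro sum_nonneg is_norm_nonneg[OF assms])
  have "N x \<le> (c + 1) * norm x" for x
  proof -
    have "N x = N (\<Sum>k\<in>UNIV. x $ k *\<^sub>R axis k 1)" by (simp only: axis_expansion)
    also have "\<dots> \<le> (\<Sum>k\<in>UNIV. N (x $ k *\<^sub>R axis k 1))" by (rule Nsum) simp
    also have "\<dots> \<le> (\<Sum>k\<in>UNIV. norm x * N (axis k 1))"
      unfolding N(2) by (intro sum_mono mult_right_mono component_le_norm_cart is_norm_nonneg[OF assms])
    also have "\<dots> = c * norm x" by (simp add: c_def sum_distrib_left mult.commute)
    also have "\<dots> \<le> (c + 1) * norm x" by (intro mult_right_mono) auto
    finally show ?thesis .
  qed
  with c show ?thesis by (intro that[of "c + 1"]) auto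
qed

lemma is_norm_continuous:
  fixes N :: "real^'n \<Rightarrow> real"
  assumes "is_norm N"
  shows "continuous_on S N"
proof -
  have N: "\<And>c x. N (c *\<^sub>R x) = \<bar>c\<bar> * N x" "\<And>x y. N (x + y) \<le> N x + N y"
    using assms unfolding is_norm_def by blast+
  obtain c where c: "c > 0" "\<And>x. N x \<le> c * norm x" using is_norm_upper[OF assms] by blast
  have "dist (N x) (N y) \<le> c * dist x y" for x y
  proof -
    have "N x \<le> N y + N (x - y)" "N y \<le> N x + N (y - x)" using N(2)[of y "x - y"] N(2)[of x "y - x"] by auto
    then show ?thesis using c(2)[of "x - y"] c(2)[of "y - x"]
      by (simp add: dist_real_def dist_norm norm_minus_commute)
  qed
  then show ?thesis using c(1)
    by (intro lipschitz_on_continuous_on[of c] lipschitz_onI) auto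
qed

lemma is_norm_lower:
  fixes N :: "real^'n \<Rightarrow> real"
  assumes "is_norm N"
  obtains c where "c > 0" "\<And>x. c * norm x \<le> N x"
proof -
  have N: "\<And>x. N x = 0 \<longleftrightarrow> x = 0" "\<And>c x. N (c *\<^sub>R x) = \<bar>c\<bar> * N x"
    using assms unfolding is_norm_def by blast+
  have "compact (sphere (0::real^'n) 1)" "sphere (0::real^'n) 1 \<noteq> {}" by auto
  then obtain x0 where x0: "x0 \<in> sphere 0 1" "\<And>x. x \<in> sphere 0 1 \<Longrightarrow> N x0 \<le> N x"
    using continuous_attains_inf[OF _ _ is_norm_continuous[OF assms]] by metis
  have "x0 \<noteq> 0" using x0(1) by auto
  then have "N x0 > 0" using is_norm_nonneg[OF assms, of x0] N(1)[of x0] by linarith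
  moreover have "N x0 * norm x \<le> N x" for x
  proof (cases "x = 0")
    case False
    have "N x0 \<le> N ((1 / norm x) *\<^sub>R x)" by (rule x0(2)) (use False in simp)
    then show ?thesis using False unfolding N(2) by (simp add: field_simps)
  qed (use N(1)[of 0] in simp)
  ultimately show ?thesis by (rule that)
qed

text \<open>A continuous function between the indicators of N \<ge> b and of N > a, for sandwiching
  tails.\<close>

lemma away_test_ramp:
  fixes N :: "real^'n \<Rightarrow> real"
  assumes N: "is_norm N" and ab: "0 < a" "a < b"
  shows "(\<lambda>y. max 0 (min 1 ((N y - a) / (b - a)))) \<in> away_test"
proof -
  obtain c where c: "c > 0" "\<And>x. N x \<le> c * norm x" using is_norm_upper[OF N] by blast
  have "continuous_on UNIV (\<lambda>y. max 0 (min 1 ((N y - a) / (b - a))))"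
    using ab by (intro continuous_intros is_norm_continuous[OF N]) auto
  moreover have "max 0 (min 1 ((N y - a) / (b - a))) = 0" if "norm y < a / c" for y
  proof -
    have "c * norm y < a" using that c(1) by (simp add: field_simps)
    then have "N y - a \<le> 0" using c(2)[of y] by linarith
    then have "(N y - a) / (b - a) \<le> 0" using ab by (intro divide_nonpos_pos) auto
    then show ?thesis by simp
  qed
  ultimately show ?thesis unfolding away_test_def mem_Collect_eq using ab c
    by (intro conjI boundedI[of _ 1] exI[of _ "a / c"]) auto
qed

lemma finite_away_norm:
  fixes N :: "real^'n \<Rightarrow> real"
  assumes N: "is_norm N" and L: "finite_away L" and r: "r > 0"
  shows "{x. N x > r} \<in> sets L" "{x. N x \<ge> r} \<in> sets L"
    "emeasure L {x. N x > r} < \<infinity>" "emeasure L {x. N x \<ge> r} < \<infinity>"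
proof -
  have s: "sets L = sets borel" using L by (simp add: finite_away_def)
  have [measurable]: "N \<in> borel_measurable borel"
    by (intro borel_measurable_continuous_onI is_norm_continuous[OF N])
  show m: "{x. N x > r} \<in> sets L" "{x. N x \<ge> r} \<in> sets L" unfolding s by measurable
  obtain c where c: "c > 0" "\<And>x. N x \<le> c * norm x" using is_norm_upper[OF N] by blast
  have "{x. N x \<ge> r} \<subseteq> {x. r / c \<le> norm x}"
    using c by (auto simp: field_simps intro: order_trans)
  then have "emeasure L {x. N x \<ge> r} \<le> emeasure L {x. r / c \<le> norm x}"
    by (rule emeasure_mono) (simp add: s)
  also have "\<dots> < \<infinity>" using L r c(1) by (simp add: finite_away_def)
  finally show "emeasure L {x. N x \<ge> r} < \<infinity>" .
  moreover have "emeasure L {x. N x > r} \<le> emeasure L {x. N x \<ge> r}"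
    using m by (intro emeasure_mono) auto
  ultimately show "emeasure L {x. N x > r} < \<infinity>" by (rule order_le_less_trans[rotated])
qed

lemma away_test_scale:
  assumes f: "f \<in> away_test" and s: "s > 0"
  shows "(\<lambda>y. f (inverse s *\<^sub>R y)) \<in> away_test"
proof -
  obtain B r where *: "continuous_on UNIV f" "B > 0" "\<And>x. \<bar>f x\<bar> \<le> B" "r > 0" "\<And>x. norm x < r \<Longrightarrow> f x = 0"
    using away_testE[OF f] by metis
  have "continuous_on UNIV (\<lambda>y. f (inverse s *\<^sub>R y))"
    by (intro continuous_on_compose2[OF *(1)] continuous_intros) auto
  moreover have "f (inverse s *\<^sub>R y) = 0" if "norm y < r * s" for y
    using that s by (intro *(5)) (simp add: field_simps)
  ultimately show ?thesis unfolding away_test_def mem_Collect_eq using *(2,3,4) s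
    by (intro conjI boundedI[of _ B] exI[of _ "r * s"]) auto
qed

text \<open>Convergence of M(s .)/V(s) against all of \<open>away_test\<close>; tightness at
  infinity is included, since tests may be 1 near infinity. The normalisation \<open>V\<close> is
  free, so that tails of \<nu> \<circledast> \<rho> and tails of \<nu> can both be used.\<close>

definition scaled_conv :: "(real^'n) measure \<Rightarrow> (real \<Rightarrow> real) \<Rightarrow> (real^'n) measure \<Rightarrow> bool" where
  "scaled_conv M V L \<longleftrightarrow> (\<forall>f\<in>away_test. ((\<lambda>s. (LINT y|M. f (inverse s *\<^sub>R y)) / V s) \<longlongrightarrow> integral\<^sup>L L f) at_top)"

text \<open>Ramps on either side of \<open>t\<close> bound the tail from above and below. The
  limiting tail is a power and therefore continuous in \<open>t\<close>, so the two bounds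
  meet.\<close>

lemma scaled_conv_tail:
  fixes N :: "real^'n \<Rightarrow> real"
  assumes N: "is_norm N" and M: "finite_away M" and L: "finite_away L"
    and V: "\<And>s. s > 0 \<Longrightarrow> V s > 0" and conv: "scaled_conv M V L"
    and hom: "\<And>t. t > 0 \<Longrightarrow> measure L {x. N x > t} = t powr (- \<alpha>) * \<kappa>" and t: "t > 0"
  shows "((\<lambda>s. measure M {x. N x > t * s} / V s) \<longlongrightarrow> t powr (- \<alpha>) * \<kappa>) at_top"
proof -
  have sM: "sets M = sets borel" and sL: "sets L = sets borel" using M L by (auto simp: finite_away_def)
  note [measurable_cong] = sM sL
  have spL: "space L = UNIV" "space M = UNIV" using sets_eq_imp_space_eq[OF sL] sets_eq_imp_space_eq[OF sM] by auto
  define R where "R a b y = max 0 (min 1 ((N y - a) / (b - a)))" for a b y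
  have test: "R a b \<in> away_test" if "0 < a" "a < b" for a b
    unfolding R_def[abs_def] by (rule away_test_ramp[OF N that])
  have R1: "R a b y = 1" if "a < b" "N y \<ge> b" for a b y using that by (simp add: R_def)
  have R0: "R a b y = 0" if "a < b" "\<not> N y > a" for a b y
    using that divide_nonpos_pos[of "N y - a" "b - a"] by (simp add: R_def)
  have R: "0 \<le> R a b y" "R a b y \<le> 1" for a b y by (auto simp: R_def)
  have ind: "integrable K (indicator {x. N x > r} :: _ \<Rightarrow> real)" if "finite_away K" "r > 0" for K r
    using finite_away_norm[OF N that] by (intro integrable_real_indicator) auto
  have scale: "N (inverse s *\<^sub>R y) > a \<longleftrightarrow> N y > a * s" "N (inverse s *\<^sub>R y) \<ge> a \<longleftrightarrow> N y \<ge> a * s" if "s > 0" for s y a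
    using that by (simp_all add: is_norm_scale[OF N] field_simps)
  have upper: "measure M {x. N x > t * s} / V s \<le> (LINT y|M. R a t (inverse s *\<^sub>R y)) / V s" if "0 < a" "a < t" "s > 0" for a s
  proof (intro divide_right_mono less_imp_le[OF V[OF that(3)]])
    have "measure M {x. N x > t * s} = (LINT y|M. indicator {x. N x > t * s} y)" by (simp add: spL)
    also have "\<dots> \<le> (LINT y|M. R a t (inverse s *\<^sub>R y))"
      using that t R scale[OF that(3)] R1[OF that(2)]
      by (intro integral_mono ind M integrable_away_test[OF M away_test_scale[OF test]]) (auto simp: indicator_def less_imp_le)
    finally show "measure M {x. N x > t * s} \<le> (LINT y|M. R a t (inverse s *\<^sub>R y))" .
  qed
  have lower: "(LINT y|M. R t b (inverse s *\<^sub>R y)) / V s \<le> measure M {x. N x > t * s} / V s" if "t < b" "s > 0" for b s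
  proof (intro divide_right_mono less_imp_le[OF V[OF that(2)]])
    have "(LINT y|M. R t b (inverse s *\<^sub>R y)) \<le> (LINT y|M. indicator {x. N x > t * s} y)"
      using that t R scale[OF that(2)] R0[OF that(1)]
      by (intro integral_mono ind M integrable_away_test[OF M away_test_scale[OF test]]) (auto simp: indicator_def less_imp_le)
    then show "(LINT y|M. R t b (inverse s *\<^sub>R y)) \<le> measure M {x. N x > t * s}" by (simp add: spL)
  qed
  have upper_lim: "integral\<^sup>L L (R a b) \<le> a powr (- \<alpha>) * \<kappa>" if "0 < a" "a < b" for a b
  proof -
    have "integral\<^sup>L L (R a b) \<le> (LINT y|L. indicator {x. N x > a} y)"
      using that R R0[OF that(2)]
      by (intro integral_mono ind L integrable_away_test[OF L test]) (auto simp: indicator_def)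
    then show ?thesis using hom[OF that(1)] by (simp add: spL)
  qed
  have lower_lim: "b powr (- \<alpha>) * \<kappa> \<le> integral\<^sup>L L (R a b)" if "0 < a" "a < b" for a b
  proof -
    have "(LINT y|L. indicator {x. N x > b} y) \<le> integral\<^sup>L L (R a b)"
      using that R R1[OF that(2)]
      by (intro integral_mono ind L integrable_away_test[OF L test]) (auto simp: indicator_def)
    then show ?thesis using hom[of b] that by (simp add: spL)
  qed
  have conv': "((\<lambda>s. (LINT y|M. f (inverse s *\<^sub>R y)) / V s) \<longlongrightarrow> integral\<^sup>L L f) at_top" if "f \<in> away_test" for f
    using conv that by (auto simp: scaled_conv_def)
  have cont: "((\<lambda>b. b powr (- \<alpha>) * \<kappa>) \<longlongrightarrow> t powr (- \<alpha>) * \<kappa>) (at t within S)" for S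
    using t by (intro tendsto_intros) auto
  show ?thesis
  proof (rule order_tendstoI)
    fix l assume "l < t powr (- \<alpha>) * \<kappa>"
    then have "eventually (\<lambda>b. l < b powr (- \<alpha>) * \<kappa>) (at_right t)" by (rule order_tendstoD(1)[OF cont])
    then have "eventually (\<lambda>b. l < b powr (- \<alpha>) * \<kappa> \<and> t < b) (at_right t)"
      using eventually_at_right_less[of t] by (rule eventually_conj)
    then obtain b where b: "l < b powr (- \<alpha>) * \<kappa>" "t < b"
      using eventually_happens trivial_limit_at_right_real by blast
    then have "l < integral\<^sup>L L (R t b)" using lower_lim[OF t b(2)] by linarith
    from order_tendstoD(1)[OF conv'[OF test[OF t b(2)]] this] eventually_gt_at_top[of 0]
    show "eventually (\<lambda>s. l < measure M {x. N x > t * s} / V s) at_top"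
      by eventually_elim (use lower[OF b(2)] in force)
  next
    fix l assume "t powr (- \<alpha>) * \<kappa> < l"
    then have "eventually (\<lambda>b. b powr (- \<alpha>) * \<kappa> < l) (at_left t)" by (rule order_tendstoD(2)[OF cont])
    then have "eventually (\<lambda>b. b powr (- \<alpha>) * \<kappa> < l \<and> b \<in> {0<..<t}) (at_left t)"
      using eventually_at_left_real[OF t] by (rule eventually_conj)
    then obtain b where b: "b powr (- \<alpha>) * \<kappa> < l" "0 < b" "b < t"
      using eventually_happens trivial_limit_at_left_real by fastforce
    then have "integral\<^sup>L L (R b t) < l" using upper_lim[OF b(2,3)] by linarith
    from order_tendstoD(2)[OF conv'[OF test[OF b(2,3)]] this] eventually_gt_at_top[of 0]
    show "eventually (\<lambda>s. measure M {x. N x > t * s} / V s < l) at_top"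
      by eventually_elim (use upper[OF b(2,3)] in force)
  qed
qed

section \<open>Potter bounds for a monotone regularly varying function\<close>

definition potter_bound :: "real \<Rightarrow> real \<Rightarrow> real \<Rightarrow> real" where
  "potter_bound p q u = max (u powr (- p)) (u powr (- q))"

lemma potter_bound_antimono:
  assumes "0 < p" "0 < q" "0 < u" "u \<le> v" shows "potter_bound p q v \<le> potter_bound p q u"
  unfolding potter_bound_def using assms by (intro max.mono powr_mono2') auto

text \<open>Regular variation is used along doublings only: from \<open>s0\<close> on, V(2 s)/V(s)
  lies between 2^-p and 2^-q. Iteration gives powers, and monotonicity fills the gaps between dyadic
  points at the price of a factor 2^p or 2^q. The argument \<open>v\<close> may fall below
  \<open>s0\<close>, down to \<open>b\<close>, where monotonicity alone is available.\<close>

lemma potter: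
  fixes V :: "real \<Rightarrow> real"
  assumes pos: "\<And>s. s > 0 \<Longrightarrow> V s > 0" and anti: "\<And>s t. 0 < s \<Longrightarrow> s \<le> t \<Longrightarrow> V t \<le> V s"
    and lim: "((\<lambda>s. V (2 * s) / V s) \<longlongrightarrow> 2 powr (- \<alpha>)) at_top"
    and \<delta>: "0 < \<delta>" "\<delta> < \<alpha>" and b: "b > 0"
  obtains C s0 where "C > 0" "s0 > 0"
    "\<And>s v. s0 \<le> s \<Longrightarrow> b \<le> v \<Longrightarrow> V v \<le> C * potter_bound (\<alpha> + \<delta>) (\<alpha> - \<delta>) (v / s) * V s"
proof -
  define p where "p = \<alpha> + \<delta>"
  define q where "q = \<alpha> - \<delta>"
  have pq: "p > 0" "q > 0" using \<delta> by (auto simp: p_def q_def)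
  have "eventually (\<lambda>s. V (2 * s) / V s < 2 powr (- q)) at_top"
    by (rule order_tendstoD(2)[OF lim]) (use \<delta> in \<open>simp add: q_def\<close>)
  moreover have "eventually (\<lambda>s. V (2 * s) / V s > 2 powr (- p)) at_top"
    by (rule order_tendstoD(1)[OF lim]) (use \<delta> in \<open>simp add: p_def\<close>)
  ultimately have "eventually (\<lambda>s. V (2 * s) / V s < 2 powr (- q) \<and> V (2 * s) / V s > 2 powr (- p)) at_top"
    by (rule eventually_conj)
  then obtain s1 where s1: "\<And>s. s1 \<le> s \<Longrightarrow> V (2 * s) / V s < 2 powr (- q) \<and> V (2 * s) / V s > 2 powr (- p)"
    by (auto simp: eventually_at_top_linorder)
  define s0 where "s0 = max s1 1"
  have s0: "s0 > 0" by (simp add: s0_def)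
  have up: "V (2 * s) \<le> 2 powr (- q) * V s" and low: "V s \<le> 2 powr p * V (2 * s)" if "s0 \<le> s" for s
  proof -
    have "V s > 0" using that s0 by (intro pos) auto
    then show "V (2 * s) \<le> 2 powr (- q) * V s" using s1[of s] that by (simp add: s0_def divide_less_eq)
    have "V (2 * s) > 2 powr (- p) * V s" using s1[of s] that \<open>V s > 0\<close> by (simp add: s0_def less_divide_eq)
    then show "V s \<le> 2 powr p * V (2 * s)" by (simp add: powr_minus field_simps)
  qed
  have up_n: "V (2 ^ n * s) \<le> (2 ^ n) powr (- q) * V s" if "s0 \<le> s" for n s
  proof (induction n)
    case (Suc n)
    have "s \<le> 2 ^ n * s" using that s0 by simp
    then have "V (2 * (2 ^ n * s)) \<le> 2 powr (- q) * V (2 ^ n * s)" using that by (intro up) auto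
    also have "\<dots> \<le> 2 powr (- q) * ((2 ^ n) powr (- q) * V s)" using Suc by (intro mult_left_mono) auto
    finally show ?case by (simp add: powr_mult mult_ac)
  qed simp
  have low_n: "V s \<le> (2 ^ n) powr p * V (2 ^ n * s)" if "s0 \<le> s" for n s
  proof (induction n)
    case (Suc n)
    have "s \<le> 2 ^ n * s" using that s0 by simp
    then have "V (2 ^ n * s) \<le> 2 powr p * V (2 * (2 ^ n * s))" using that by (intro low) auto
    then have "(2 ^ n) powr p * V (2 ^ n * s) \<le> (2 ^ n) powr p * (2 powr p * V (2 * (2 ^ n * s)))" by (intro mult_left_mono) auto
    with Suc have "V s \<le> (2 ^ n) powr p * (2 powr p * V (2 * (2 ^ n * s)))" by linarith
    then show ?case by (simp add: powr_mult mult_ac)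
  qed simp
  have dyadic: "\<exists>n. 2 ^ n * a \<le> c \<and> c < 2 * (2 ^ n * a)" if "0 < a" "a \<le> c" for a c :: real
  proof -
    obtain m where m: "c / a < 2 ^ m" using real_arch_pow[of 2 "c / a"] by auto
    define k where "k = (LEAST m. c / a < 2 ^ m)"
    have k: "c / a < 2 ^ k" unfolding k_def by (rule LeastI[of "\<lambda>m. c / a < 2 ^ m"]) (rule m)
    have "k \<noteq> 0" using k that by (intro notI) (simp add: field_simps)
    then obtain n where n: "k = Suc n" using not0_implies_Suc by blast
    have "\<not> c / a < 2 ^ n" using not_less_Least[of n "\<lambda>m. c / a < 2 ^ m"] n unfolding k_def[symmetric] by simp
    then show ?thesis using k that unfolding n by (intro exI[of _ n]) (simp add: field_simps)
  qed
  \<comment> \<open>Pays for arguments below \<open>s0\<close>, where V v is compared with V s0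
    through V b.\<close>
  define K where "K = max 1 (V b / V s0)"
  define C where "C = K * 2 powr p"
  have K: "K \<ge> 1" by (simp add: K_def)
  have case1: "V v \<le> 2 powr q * (v / s) powr (- q) * V s" if sv: "s0 \<le> s" "s \<le> v" for s v
  proof -
    have sp: "s > 0" using sv s0 by linarith
    obtain n where n: "2 ^ n * s \<le> v" "v < 2 * (2 ^ n * s)" using dyadic[OF sp sv(2)] by blast
    have "V v \<le> V (2 ^ n * s)" using n sp by (intro anti) auto
    also have "\<dots> \<le> (2 ^ n) powr (- q) * V s" by (rule up_n[OF sv(1)])
    also have "\<dots> \<le> (v / s / 2) powr (- q) * V s"
      using n sp pq pos[OF sp] sv by (intro mult_right_mono powr_mono2') (auto simp: field_simps)
    also have "(v / s / 2) powr (- q) = 2 powr q * (v / s) powr (- q)"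
    proof -
      have "(v / s / 2) powr (- q) = (v / s) powr (- q) / 2 powr (- q)" by (rule powr_divide)
      also have "\<dots> = 2 powr q * (v / s) powr (- q)" by (simp only: powr_minus[of 2] divide_inverse inverse_inverse_eq mult.commute)
      finally show ?thesis .
    qed
    finally show ?thesis .
  qed
  have case2: "V v \<le> 2 powr p * (v / s) powr (- p) * V s" if vs: "s0 \<le> v" "v < s" for s v
  proof -
    have vp: "v > 0" using vs s0 by linarith
    obtain n where n: "2 ^ n * v \<le> s" "s < 2 * (2 ^ n * v)" using dyadic[OF vp, of s] vs by auto
    have "V v \<le> (2 ^ Suc n) powr p * V (2 ^ Suc n * v)" by (rule low_n[OF vs(1)])
    also have "\<dots> \<le> (2 ^ Suc n) powr p * V s" using n vp vs by (intro mult_left_mono anti) auto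
    also have "\<dots> \<le> (2 * (s / v)) powr p * V s"
      using n vp pq pos[of s] vs by (intro mult_right_mono powr_mono2) (auto simp: field_simps)
    also have "(2 * (s / v)) powr p = 2 powr p * (v / s) powr (- p)"
      using vs vp by (simp add: powr_mult powr_divide powr_minus field_simps)
    finally show ?thesis .
  qed
  show ?thesis
  proof (rule that[of C s0])
    show "C > 0" using K by (simp add: C_def)
    show "s0 > 0" by fact
    fix s v assume sv: "s0 \<le> s" "b \<le> v"
    have sp: "s > 0" and vp: "v > 0" using sv s0 b by auto
    have Vs: "V s > 0" by (rule pos[OF sp])
    have pb: "(v / s) powr (- p) \<le> potter_bound p q (v / s)" "(v / s) powr (- q) \<le> potter_bound p q (v / s)"
      by (auto simp: potter_bound_def)
    then have pb0: "potter_bound p q (v / s) \<ge> 0" using powr_ge_zero order_trans by blast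
    have fin: "V v \<le> C * potter_bound p q (v / s) * V s" if "V v \<le> k * (v / s) powr (- e) * V s" "k \<le> C" "k \<ge> 0" "e = p \<or> e = q" for k e
    proof -
      have "k * (v / s) powr (- e) \<le> C * potter_bound p q (v / s)"
        using that pb by (intro mult_mono) auto
      then show ?thesis using that(1) Vs by (meson mult_right_mono less_imp_le order_trans)
    qed
    have "V v \<le> C * potter_bound p q (v / s) * V s"
    proof -
      consider "s \<le> v" | "s0 \<le> v" "v < s" | "v < s0" by linarith
      then show ?thesis
      proof cases
        case 1
        have "2 powr q \<le> 1 * 2 powr p" using \<delta> by (simp add: p_def q_def)
        also have "\<dots> \<le> C" unfolding C_def using K by (intro mult_right_mono) auto
        finally show ?thesis by (intro fin[OF case1[OF sv(1) 1]]) auto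
      next
        case 2
        have "1 * 2 powr p \<le> C" unfolding C_def using K by (intro mult_right_mono) auto
        then show ?thesis by (intro fin[OF case2[OF 2]]) auto
      next
        case 3
        have "V v \<le> V b" using b sv by (intro anti) auto
        also have "\<dots> = (V b / V s0) * V s0" using pos[OF s0] by simp
        also have "\<dots> \<le> K * V s0" using pos[OF s0] by (intro mult_right_mono) (auto simp: K_def)
        also have "\<dots> \<le> K * (2 powr p * (s0 / s) powr (- p) * V s)"
        proof (intro mult_left_mono)
          show "V s0 \<le> 2 powr p * (s0 / s) powr (- p) * V s"
          proof (cases "s0 = s")
            case True
            then show ?thesis using Vs s0 pq by (simp add: ge_one_powr_ge_zero)
          next
            case False
            then show ?thesis using case2[of s0 s] sv by simp
          qed
        qed (use K in auto)
        also have "\<dots> \<le> K * (2 powr p * (v / s) powr (- p) * V s)"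
          using 3 vp sp pq Vs K by (intro mult_left_mono mult_right_mono powr_mono2') (auto simp: divide_right_mono)
        finally have "V v \<le> C * (v / s) powr (- p) * V s" by (simp add: C_def mult_ac)
        then show ?thesis using K by (intro fin[of C p]) (auto simp: C_def)
      qed
    qed
    then show "V v \<le> C * potter_bound (\<alpha> + \<delta>) (\<alpha> - \<delta>) (v / s) * V s" by (simp add: p_def q_def)
  qed
qed


lemma norm_diag_map_le: "norm (diag_map x y) \<le> norm x * norm y"
proof -
  have "norm (diag_map x y) \<le> norm (norm x *\<^sub>R y)"
    by (rule norm_le_componentwise_cart)
       (auto simp: diag_map_def abs_mult intro!: mult_right_mono component_le_norm_cart)
  then show ?thesis by simp
qed

lemma diag_map_scaleR: "diag_map x (c *\<^sub>R y) = c *\<^sub>R diag_map x y"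
  by (simp add: diag_map_def vec_eq_iff)

lemma away_test_diag_map:
  assumes f: "f \<in> away_test" shows "(\<lambda>y. f (diag_map x y)) \<in> away_test"
proof -
  obtain B r where *: "continuous_on UNIV f" "B > 0" "\<And>x. \<bar>f x\<bar> \<le> B" "r > 0" "\<And>x. norm x < r \<Longrightarrow> f x = 0"
    using away_testE[OF f] by metis
  have "continuous_on UNIV (\<lambda>y. f (diag_map x y))"
    unfolding diag_map_def
    by (intro continuous_on_compose2[OF *(1)] continuous_intros continuous_on_vec_lambda) auto
  moreover have "f (diag_map x y) = 0" if "norm y < r / (norm x + 1)" for y
  proof (rule *(5))
    have "(norm x + 1) * norm y < r" using that by (simp add: field_simps add_pos_nonneg pos_less_divide_eq)
    moreover have "norm x * norm y \<le> (norm x + 1) * norm y" by (intro mult_right_mono) auto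
    ultimately show "norm (diag_map x y) < r" using norm_diag_map_le[of x y] by linarith
  qed
  ultimately show ?thesis unfolding away_test_def mem_Collect_eq using *(2,3,4)
    by (intro conjI boundedI[of _ B] exI[of _ "r / (norm x + 1)"]) (auto simp: add_nonneg_pos)
qed

lemma norm_powr_le_sum:
  fixes x :: "real^'n"
  assumes "a > 0"
  shows "norm x powr a \<le> real CARD('n) powr a * (\<Sum>j\<in>UNIV. \<bar>x $ j\<bar> powr a)"
proof -
  have "Max (range (\<lambda>i. \<bar>x $ i\<bar>)) \<in> range (\<lambda>i. \<bar>x $ i\<bar>)" by (intro Max_in) auto
  then obtain j where "Max (range (\<lambda>i. \<bar>x $ i\<bar>)) = \<bar>x $ j\<bar>" by blast
  then have j: "\<bar>x $ i\<bar> \<le> \<bar>x $ j\<bar>" for i by (metis Max_ge finite finite_imageI rangeI)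
  have "norm x \<le> (\<Sum>i\<in>UNIV. \<bar>x $ i\<bar>)" by (rule norm_le_l1_cart)
  also have "\<dots> \<le> (\<Sum>i\<in>(UNIV::'n set). \<bar>x $ j\<bar>)" by (intro sum_mono j)
  finally have "norm x powr a \<le> (real CARD('n) * \<bar>x $ j\<bar>) powr a" using assms by (intro powr_mono2) auto
  also have "\<dots> = real CARD('n) powr a * \<bar>x $ j\<bar> powr a" by (simp add: powr_mult)
  also have "\<dots> \<le> real CARD('n) powr a * (\<Sum>j\<in>UNIV. \<bar>x $ j\<bar> powr a)"
    by (intro mult_left_mono member_le_sum) auto
  finally show ?thesis .
qed

text \<open>The factor 2 is what makes the inequality strict.\<close>

lemma large_coordinate:
  fixes z :: "real^'n"
  assumes "r > 0" "r \<le> norm z" shows "\<exists>j. r / (2 * real CARD('n)) < \<bar>z $ j\<bar>"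
proof (rule ccontr)
  assume "\<not> ?thesis"
  then have "(\<Sum>i\<in>UNIV. \<bar>z $ i\<bar>) \<le> (\<Sum>i\<in>(UNIV::'n set). r / (2 * real CARD('n)))" by (intro sum_mono) (auto simp: not_less)
  then have "norm z \<le> r / 2" using norm_le_l1_cart[of z] by simp
  then show False using assms by simp
qed

lemma is_norm_norm: "is_norm (norm :: real^'n \<Rightarrow> real)"
  unfolding is_norm_def by (auto intro: norm_triangle_ineq)

text \<open>The analytic setting with all measures on the finite space. Here \<mu> is the finite
  part of the tail measure; of its homogeneity only the tails with respect to \<open>N\<close> are
  recorded, with a constant \<kappa> still to be determined.\<close>

locale tauberian = nonvanishing \<rho> \<alpha> for \<rho> :: "(real^'n) measure" and \<alpha> +
  fixes N :: "real^'n \<Rightarrow> real" and \<nu> \<mu> :: "(real^'n) measure" and \<delta> \<kappa> :: real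
  assumes norm_N: "is_norm N"
    and sets_nu: "sets \<nu> = sets borel" and sigma_nu: "sigma_finite_measure \<nu>"
    and delta: "0 < \<delta>" "\<delta> < \<alpha>"
    and moment: "\<And>j. integrable \<rho> (\<lambda>x. \<bar>x $ j\<bar> powr (\<alpha> + \<delta>))" "\<And>j. integrable \<rho> (\<lambda>x. \<bar>x $ j\<bar> powr (\<alpha> - \<delta>))"
    and conv_fin: "finite_away (\<nu> \<circledast> \<rho>)"
    and conv_pos: "\<And>s. s > 0 \<Longrightarrow> measure (\<nu> \<circledast> \<rho>) {x. N x > s} > 0"
    and small: "\<And>j. ((\<lambda>b::real. Limsup at_top (\<lambda>s::real.
            (\<integral>\<^sup>+ y \<in> {y. 0 < \<bar>y $ j\<bar> \<and> \<bar>y $ j\<bar> \<le> b}. emeasure \<rho> {x. \<bar>x $ j\<bar> > s / \<bar>y $ j\<bar>} \<partial>\<nu>)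
            / emeasure (\<nu> \<circledast> \<rho>) {x. N x > s})) \<longlongrightarrow> 0) (at_right 0)"
    and mu_fin: "finite_away \<mu>" and mu_0: "emeasure \<mu> {0} = 0"
    and mu_hom: "\<And>t. t > 0 \<Longrightarrow> measure \<mu> {x. N x > t} = t powr (- \<alpha>) * \<kappa>" and kappa: "\<kappa> > 0"
    and conv_scaled: "scaled_conv (\<nu> \<circledast> \<rho>) (\<lambda>s. measure (\<nu> \<circledast> \<rho>) {x. N x > s}) \<mu>"
begin

section \<open>The normalisation V and the tails of \<nu>\<close>

definition V :: "real \<Rightarrow> real" where "V s = measure (\<nu> \<circledast> \<rho>) {x. N x > s}"

lemma V_pos: "s > 0 \<Longrightarrow> V s > 0" by (simp add: V_def conv_pos)

lemma N_measurable[measurable]: "N \<in> borel_measurable borel"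
  by (intro borel_measurable_continuous_onI is_norm_continuous[OF norm_N])

lemma emeasure_V: assumes "s > 0" shows "emeasure (\<nu> \<circledast> \<rho>) {x. N x > s} = ennreal (V s)"
  unfolding V_def using finite_away_norm(3)[OF norm_N conv_fin assms] by (intro emeasure_eq_ennreal_measure) simp

lemma V_antimono: assumes "0 < s" "s \<le> t" shows "V t \<le> V s"
proof -
  have "emeasure (\<nu> \<circledast> \<rho>) {x. N x > t} \<le> emeasure (\<nu> \<circledast> \<rho>) {x. N x > s}"
    using assms finite_away_norm[OF norm_N conv_fin] by (intro emeasure_mono) auto
  then show ?thesis using assms V_pos[of s] by (simp add: emeasure_V ennreal_le_iff)
qed

text \<open>At t = 1 the quotient is identically 1 for positive s, which forces the value of
  \<kappa>; what remains is regular variation of \<open>V\<close>.\<close>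

lemma kappa_eq: "\<kappa> = 1" and V_lim: "t > 0 \<Longrightarrow> ((\<lambda>s. V (t * s) / V s) \<longlongrightarrow> t powr (- \<alpha>)) at_top"
proof -
  have *: "((\<lambda>s. V (t * s) / V s) \<longlongrightarrow> t powr (- \<alpha>) * \<kappa>) at_top" if "t > 0" for t
    using scaled_conv_tail[OF norm_N conv_fin mu_fin conv_pos conv_scaled mu_hom that] by (simp add: V_def)
  have "((\<lambda>s. V s / V s) \<longlongrightarrow> 1) at_top"
  proof (rule tendsto_eventually)
    show "eventually (\<lambda>s. V s / V s = 1) at_top" using eventually_gt_at_top[of 0]
      by eventually_elim (use V_pos in force)
  qed
  then show "\<kappa> = 1" using *[of 1] tendsto_unique[OF trivial_limit_at_top_linorder] by fastforce
  then show "((\<lambda>s. V (t * s) / V s) \<longlongrightarrow> t powr (- \<alpha>)) at_top" if "t > 0" using *[OF that] by simp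
qed

text \<open>Were all these boxes null, \<rho> would be null, and the integral with the trivial
  character would vanish.\<close>

lemma rho_box:
  obtains e where "e > 0" "emeasure \<rho> {x. \<forall>i. e \<le> \<bar>x $ i\<bar>} > 0"
proof -
  have "\<exists>n::nat. emeasure \<rho> {x. \<forall>i. 1 / real (Suc n) \<le> \<bar>x $ i\<bar>} \<noteq> 0"
  proof (rule ccontr)
    assume a: "\<not> ?thesis"
    have "AE x in \<rho>. \<not> (\<forall>i. 1 / real (Suc n) \<le> \<bar>x $ i\<bar>)" for n
      by (rule AE_I[where N="{x. \<forall>i. 1 / real (Suc n) \<le> \<bar>x $ i\<bar>}"]) (use a in \<open>auto simp: sets_rho\<close>)
    then have "AE x in \<rho>. \<forall>n::nat. \<not> (\<forall>i. 1 / real (Suc n) \<le> \<bar>x $ i\<bar>)" by (subst AE_all_countable) auto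
    then have "AE x in \<rho>. False" using AE_nonzero_coordinates[OF sets_rho rho_coord]
    proof eventually_elim
      case (elim x)
      define c where "c = Min (range (\<lambda>i. \<bar>x $ i\<bar>))"
      have "c > 0" unfolding c_def using elim(2) by (subst Min_gr_iff) auto
      then obtain n where "1 / real (Suc n) < c" using nat_approx_posE by blast
      moreover have "c \<le> \<bar>x $ i\<bar>" for i unfolding c_def by (intro Min_le) auto
      ultimately have "\<forall>i. 1 / real (Suc n) \<le> \<bar>x $ i\<bar>" by (meson less_imp_le order_less_le_trans)
      then show ?case using elim(1) by blast
    qed
    then have "(LINT x|\<rho>. complex_of_real (\<bar>x $ j\<bar> powr \<alpha>)
             * (\<Prod>k\<in>UNIV. complex_of_real \<bar>x $ k\<bar> powr (\<i> * complex_of_real 0))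
             * (\<Prod>k\<in>UNIV. complex_of_real (sgn (x $ k)) ^ 0)) = 0" for j
      by (intro integral_eq_zero_AE) (auto elim: eventually_mono)
    then show False using nonvanish[of "\<lambda>_. 0" undefined "\<lambda>_. 0"] by simp
  qed
  then obtain n where "emeasure \<rho> {x. \<forall>i. 1 / real (Suc n) \<le> \<bar>x $ i\<bar>} \<noteq> 0" by blast
  then show ?thesis by (intro that[of "1 / real (Suc n)"]) (auto simp: zero_less_iff_neq_zero)
qed

text \<open>For x in the box the product has Euclidean norm at least \<open>e * norm y\<close>.
  Hence a tail set for y lies in the preimage of a tail set for the product, with the level changed
  by a constant factor, and integration over the box turns this into a bound of measures.\<close>

lemma nu_tail_le_V:
  obtains C c where "C > 0" "c > 0" "\<And>v. v > 0 \<Longrightarrow> emeasure \<nu> {y. v < norm y} \<le> ennreal (C * V (c * v))"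
proof -
  obtain e where e: "e > 0" "emeasure \<rho> {x. \<forall>i. e \<le> \<bar>x $ i\<bar>} > 0" using rho_box by blast
  define E where "E = {x::real^'n. \<forall>i. e \<le> \<bar>x $ i\<bar>}"
  have Em: "E \<in> sets \<rho>" unfolding E_def sets_rho by measurable
  obtain c1 where c1: "c1 > 0" "\<And>x. c1 * norm x \<le> N x" using is_norm_lower[OF norm_N] by blast
  \<comment> \<open>A positive real not exceeding the mass of the box; the value 1 serves should
    that mass be infinite.\<close>
  define c0 where "c0 = (if emeasure \<rho> E = top then 1 else enn2real (emeasure \<rho> E))"
  have c0: "c0 > 0" "ennreal c0 \<le> emeasure \<rho> E"
    using e(2) by (auto simp: c0_def E_def[symmetric] enn2real_positive_iff less_top)
  show ?thesis
  proof (rule that[of "1 / c0" "c1 * e"])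
    fix v :: real assume v: "v > 0"
    have sub: "{y::real^'n. v < norm y} \<subseteq> diag_map x -` {z. N z > c1 * e * v}" if "x \<in> E" for x
    proof
      fix y :: "real^'n" assume "y \<in> {y. v < norm y}"
      then have "v < norm y" by simp
      have "norm (e *\<^sub>R y) \<le> norm (diag_map x y)"
        using that e(1) by (intro norm_le_componentwise_cart) (auto simp: diag_map_def abs_mult E_def intro!: mult_right_mono)
      then have "e * norm y \<le> norm (diag_map x y)" using e(1) by simp
      then have "c1 * (e * norm y) \<le> N (diag_map x y)" using c1 mult_left_mono[of _ _ c1] by (meson less_imp_le order_trans)
      moreover have "c1 * (e * v) < c1 * (e * norm y)" using c1 e \<open>v < norm y\<close> by simp
      ultimately show "y \<in> diag_map x -` {z. N z > c1 * e * v}" by (simp add: mult.assoc)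
    qed
    have dm: "diag_map x -` {z. N z > c1 * e * v} \<in> sets \<nu>" for x
    proof -
      have "diag_map x \<in> borel_measurable borel" unfolding diag_map_def[abs_def] by measurable
      then have "diag_map x -` {z. N z > c1 * e * v} \<inter> space borel \<in> sets borel" by (rule measurable_sets) measurable
      then show ?thesis by (simp add: sets_nu)
    qed
    have "ennreal c0 * emeasure \<nu> {y. v < norm y} \<le> emeasure \<rho> E * emeasure \<nu> {y. v < norm y}"
      using c0 by (intro mult_right_mono) auto
    also have "\<dots> = (\<integral>\<^sup>+ x. emeasure \<nu> {y. v < norm y} * indicator E x \<partial>\<rho>)"
      by (subst nn_integral_cmult_indicator[OF Em]) (simp add: mult.commute)
    also have "\<dots> \<le> (\<integral>\<^sup>+ x. emeasure \<nu> (diag_map x -` {z. N z > c1 * e * v}) \<partial>\<rho>)"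
      using emeasure_mono[OF sub dm] by (intro nn_integral_mono) (auto simp: indicator_def)
    also have "\<dots> = emeasure (\<nu> \<circledast> \<rho>) {z. N z > c1 * e * v}"
      by (subst emeasure_mult_conv[OF sets_rho sets_nu sigma_nu]) auto
    also have "\<dots> = ennreal (V (c1 * e * v))" using c1 e v by (intro emeasure_V) auto
    finally have "ennreal (1 / c0) * (ennreal c0 * emeasure \<nu> {y. v < norm y}) \<le> ennreal (1 / c0) * ennreal (V (c1 * e * v))"
      by (rule mult_left_mono) simp
    moreover have "ennreal (1 / c0) * (ennreal c0 * emeasure \<nu> {y. v < norm y}) = emeasure \<nu> {y. v < norm y}"
      using c0 by (simp add: mult.assoc[symmetric] ennreal_mult[symmetric])
    moreover have "ennreal (1 / c0) * ennreal (V (c1 * e * v)) = ennreal (1 / c0 * V (c1 * e * v))"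
      using c0 by (subst ennreal_mult[symmetric]) (auto simp: V_def)
    ultimately show "emeasure \<nu> {y. v < norm y} \<le> ennreal (1 / c0 * V (c1 * e * v))" by (simp only:)
  qed (use c0 c1 e in auto)
qed

lemma nu_fin: "finite_away \<nu>"
  unfolding finite_away_def
proof (intro conjI allI impI)
  show "sets \<nu> = sets borel" by (rule sets_nu)
  fix r :: real assume "r > 0"
  obtain C c where "emeasure \<nu> {y. r / 2 < norm y} \<le> ennreal (C * V (c * (r / 2)))"
    using nu_tail_le_V half_gt_zero[OF \<open>r > 0\<close>] by metis
  moreover have "emeasure \<nu> {y. r \<le> norm y} \<le> emeasure \<nu> {y. r / 2 < norm y}"
    using \<open>r > 0\<close> by (intro emeasure_mono) (auto simp: sets_nu)
  ultimately show "emeasure \<nu> {y. r \<le> norm y} < \<infinity>"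
    by (metis ennreal_less_top infinity_ennreal_def order_le_less_trans)
qed

abbreviation "pb \<equiv> potter_bound (\<alpha> + \<delta>) (\<alpha> - \<delta>)"

text \<open>The constant \<open>c\<close> inside the argument of \<open>V\<close> is moved out
  because the Potter function is submultiplicative: its value at c u is at most \<open>pb c\<close>
  times its value at u.\<close>

lemma nu_potter:
  assumes b: "b > 0"
  obtains C s0 where "C > 0" "s0 > 0"
    "\<And>s v. s0 \<le> s \<Longrightarrow> b \<le> v \<Longrightarrow> emeasure \<nu> {y. v < norm y} \<le> ennreal (C * pb (v / s) * V s)"
proof -
  obtain C1 c where c: "C1 > 0" "c > 0" "\<And>v. v > 0 \<Longrightarrow> emeasure \<nu> {y. v < norm y} \<le> ennreal (C1 * V (c * v))"
    using nu_tail_le_V by metis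
  obtain C s0 where C: "C > 0" "s0 > 0" "\<And>s v. s0 \<le> s \<Longrightarrow> c * b \<le> v \<Longrightarrow> V v \<le> C * pb (v / s) * V s"
    using potter[OF V_pos V_antimono V_lim delta, of "c * b"] b c(2) by auto
  define K where "K = pb c"
  have K: "K > 0" using c(2) by (simp add: K_def potter_bound_def less_max_iff_disj)
  show ?thesis
  proof (rule that[of "C1 * (C * K)" s0])
    fix s v assume sv: "s0 \<le> s" "b \<le> v"
    have p: "s > 0" "v > 0" using sv C(2) b by auto
    have "pb (c * v / s) \<le> K * pb (v / s)"
    proof -
      have "(c * v / s) powr (- a) = c powr (- a) * (v / s) powr (- a)" for a
        using p c(2) powr_mult[of c "v / s" "- a"] by simp
      moreover have "c powr (- a) * (v / s) powr (- a) \<le> K * pb (v / s)" if "a = \<alpha> + \<delta> \<or> a = \<alpha> - \<delta>" for a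
        using that K unfolding K_def potter_bound_def by (intro mult_mono) auto
      ultimately have kk: "(c * v / s) powr (- a) \<le> K * pb (v / s)" if "a = \<alpha> + \<delta> \<or> a = \<alpha> - \<delta>" for a
        using that by metis
      then show ?thesis unfolding potter_bound_def[of _ _ "c * v / s"] by (intro max.boundedI kk) auto
    qed
    then have "C * pb (c * v / s) * V s \<le> C * (K * pb (v / s)) * V s"
      using C(1) V_pos[OF p(1)] by (intro mult_right_mono mult_left_mono) auto
    moreover have "V (c * v) \<le> C * pb (c * v / s) * V s"
      using sv c(2) by (intro C(3)) auto
    ultimately have "V (c * v) \<le> C * (K * pb (v / s)) * V s" by linarith
    then have "C1 * V (c * v) \<le> C1 * (C * K) * pb (v / s) * V s"
      using mult_left_mono[of "V (c * v)" _ C1] c(1) by (simp add: mult.assoc)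
    then show "emeasure \<nu> {y. v < norm y} \<le> ennreal (C1 * (C * K) * pb (v / s) * V s)"
      using order_trans[OF c(3)[OF p(2)] ennreal_leI] by blast
  qed (use c C K in auto)
qed

lemma integrable_norm_powr:
  assumes "a > 0" "\<And>j. integrable \<rho> (\<lambda>x. \<bar>x $ j\<bar> powr a)"
  shows "integrable \<rho> (\<lambda>x. norm x powr a)"
proof (rule Bochner_Integration.integrable_bound)
  note [measurable_cong] = sets_rho
  show "integrable \<rho> (\<lambda>x. real CARD('n) powr a * (\<Sum>j\<in>UNIV. \<bar>x $ j\<bar> powr a))"
    by (intro integrable_mult_right Bochner_Integration.integrable_sum assms)
  show "(\<lambda>x. norm x powr a) \<in> borel_measurable \<rho>" by measurable
  show "AE x in \<rho>. norm (norm x powr a) \<le> norm (real CARD('n) powr a * (\<Sum>j\<in>UNIV. \<bar>x $ j\<bar> powr a))"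
    using norm_powr_le_sum[OF assms(1)] by (intro AE_I2) (auto intro: order_trans[OF _ abs_ge_self])
qed

lemma integrable_norm_alpha: "integrable \<rho> (\<lambda>x. norm x powr \<alpha>)"
  using moments[of 0] by (intro integrable_norm_powr alpha) simp

text \<open>The product has norm at most \<open>norm x * norm y\<close>, so the level u becomes u /
  norm x for y, and the tail bound acquires the factor \<open>norm x powr \<alpha>\<close>, which is
  integrable under \<rho>.\<close>

lemma tail_bounded_mult_conv:
  assumes L: "tail_bounded L \<alpha>" "emeasure L {0} = 0"
  shows "tail_bounded (L \<circledast> \<rho>) \<alpha>" "emeasure (L \<circledast> \<rho>) {0} = 0"
proof -
  have sL: "sets L = sets borel" using L by (simp add: tail_bounded_def)
  have sf: "sigma_finite_measure L" by (rule tail_bounded_sigma_finite[OF L])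
  obtain C where C: "C \<ge> 0" "\<And>u. u > 0 \<Longrightarrow> emeasure L {y. u < norm y} \<le> ennreal (C * u powr (- \<alpha>))"
    using L(1) by (auto simp: tail_bounded_def)
  define I where "I = integral\<^sup>L \<rho> (\<lambda>x. norm x powr \<alpha>)"
  have "emeasure (L \<circledast> \<rho>) {y. u < norm y} \<le> ennreal (C * I * u powr (- \<alpha>))" if u: "u > 0" for u
  proof -
    have "emeasure (L \<circledast> \<rho>) {y. u < norm y} = (\<integral>\<^sup>+ x. emeasure L (diag_map x -` {y. u < norm y}) \<partial>\<rho>)"
      by (rule emeasure_mult_conv[OF sets_rho sL sf]) measurable
    also have "\<dots> \<le> (\<integral>\<^sup>+ x. ennreal (C * u powr (- \<alpha>) * norm x powr \<alpha>) \<partial>\<rho>)"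
    proof (rule nn_integral_mono)
      fix x :: "real^'n"
      show "emeasure L (diag_map x -` {y. u < norm y}) \<le> ennreal (C * u powr (- \<alpha>) * norm x powr \<alpha>)"
      proof (cases "x = 0")
        case True
        then have "diag_map x -` {y. u < norm y} = {}" using u by (auto simp: diag_map_def zero_vec_def[symmetric])
        then show ?thesis by simp
      next
        case False
        then have nx: "norm x > 0" by simp
        have "diag_map x -` {y. u < norm y} \<subseteq> {y. u / norm x < norm y}"
        proof
          fix y assume "y \<in> diag_map x -` {y. u < norm y}"
          then have "u < norm x * norm y" using norm_diag_map_le[of x y] by simp
          then show "y \<in> {y. u / norm x < norm y}" using nx by (simp add: divide_less_eq mult.commute)
        qed
        then have "emeasure L (diag_map x -` {y. u < norm y}) \<le> emeasure L {y. u / norm x < norm y}"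
          by (intro emeasure_mono) (auto simp: sL)
        also have "\<dots> \<le> ennreal (C * (u / norm x) powr (- \<alpha>))" using u nx by (intro C(2)) simp
        also have "C * (u / norm x) powr (- \<alpha>) = C * u powr (- \<alpha>) * norm x powr \<alpha>"
          using u nx by (simp add: powr_divide powr_minus field_simps)
        finally show ?thesis .
      qed
    qed
    also have "\<dots> = ennreal (integral\<^sup>L \<rho> (\<lambda>x. C * u powr (- \<alpha>) * norm x powr \<alpha>))"
      using C(1) by (intro nn_integral_eq_integral integrable_mult_right integrable_norm_alpha) auto
    also have "integral\<^sup>L \<rho> (\<lambda>x. C * u powr (- \<alpha>) * norm x powr \<alpha>) = C * I * u powr (- \<alpha>)"
      by (simp add: I_def)
    finally show ?thesis .
  qed
  moreover have "C * I \<ge> 0" using C(1) by (simp add: I_def)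
  ultimately show "tail_bounded (L \<circledast> \<rho>) \<alpha>" unfolding tail_bounded_def by auto
  have "emeasure (L \<circledast> \<rho>) {0} = (\<integral>\<^sup>+ x. emeasure L (diag_map x -` {0}) \<partial>\<rho>)"
    by (rule emeasure_mult_conv[OF sets_rho sL sf]) simp
  also have "\<dots> = (\<integral>\<^sup>+ x. 0 \<partial>\<rho>)"
  proof (rule nn_integral_cong_AE)
    show "AE x in \<rho>. emeasure L (diag_map x -` {0}) = 0"
      using AE_nonzero_coordinates[OF sets_rho rho_coord]
    proof eventually_elim
      case (elim x)
      then have "diag_map x -` {0} = {0}" by (auto simp: diag_map_def vec_eq_iff)
      then show ?case using L(2) by simp
    qed
  qed
  finally show "emeasure (L \<circledast> \<rho>) {0} = 0" by simp
qed


section \<open>Integrals E against the measures \<mu>_s and their subsequential limits\<close>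

definition E :: "real \<Rightarrow> (real^'n \<Rightarrow> real) \<Rightarrow> real" where
  "E s f = (LINT y|\<nu>. f (inverse s *\<^sub>R y)) / V s"

lemma exists_radius:
  assumes "C > 0" "e > 0"
  obtains R where "R \<ge> 1" "C * pb R \<le> e"
proof -
  define q where "q = \<alpha> - \<delta>"
  have q: "q > 0" using delta by (simp add: q_def)
  define R where "R = max 1 ((C / e) powr (1 / q))"
  have R: "R \<ge> 1" by (simp add: R_def)
  have "pb R \<le> R powr (- q)" unfolding potter_bound_def q_def using R delta by (intro max.boundedI powr_mono) auto
  also have "\<dots> \<le> ((C / e) powr (1 / q)) powr (- q)" using q assms by (intro powr_mono2') (auto simp: R_def)
  also have "\<dots> = e / C" using q assms by (simp add: powr_powr powr_minus)
  finally have "C * pb R \<le> C * (e / C)" using assms by (intro mult_left_mono) auto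
  then show ?thesis using assms R by (intro that[of R]) auto
qed

text \<open>The measures \<open>\<mu>\<^sub>s\<close> need not be finite. Restricted to \<open>\<bar>y\<bar> > 1 / s\<close>, which test functions do not
  notice for large \<open>s\<close>, and weighted by \<open>w(y) = min 1 \<bar>y\<bar>\<^sup>\<beta>\<close> with \<open>\<beta> > \<alpha> + \<delta>\<close>, they have bounded
  mass by the Potter bound, so that Prokhorov's theorem applies.\<close>

lemma subsequence_limit:
  assumes X: "filterlim X at_top sequentially"
  obtains r L where "strict_mono (r :: nat \<Rightarrow> nat)" "tail_bounded L \<alpha>" "emeasure L {0} = 0"
    "\<And>f. f \<in> away_test \<Longrightarrow> (\<lambda>n. E (X (r n)) f) \<longlonglongrightarrow> integral\<^sup>L L f"
proof -
  define p where "p = \<alpha> + \<delta>"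
  define q where "q = \<alpha> - \<delta>"
  have pq: "0 < q" "q < p" using delta by (auto simp: p_def q_def)
  obtain C s0 where C: "C > 0" "s0 > 0"
    "\<And>s v. s0 \<le> s \<Longrightarrow> 1 \<le> v \<Longrightarrow> emeasure \<nu> {y. v < norm y} \<le> ennreal (C * pb (v / s) * V s)"
    using nu_potter[of 1] by (metis zero_less_one)
  have "eventually (\<lambda>n. max s0 1 \<le> X n) sequentially" using X by (simp only: filterlim_at_top)
  then obtain n0 where n0: "\<And>n. n \<ge> n0 \<Longrightarrow> max s0 1 \<le> X n" by (auto simp: eventually_sequentially)
  \<comment> \<open>From \<open>n0\<close> on the Potter bound applies; the shift is undone in the
    subsequence returned at the end.\<close>
  define Y where "Y n = X (n + n0)" for n
  have Y: "s0 \<le> Y n" "1 \<le> Y n" "0 < Y n" for n using n0[of "n + n0"] by (auto simp: Y_def)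
  have Ylim: "filterlim Y at_top sequentially" unfolding Y_def by (rule filterlim_compose[OF X filterlim_add_const_nat_at_top])
  \<comment> \<open>One more than the Potter exponent \<open>p\<close>: the weighted mass of the
    shell of radius about exp(-m) is then of order exp(-m), hence summable.\<close>
  define \<beta> where "\<beta> = p + 1"
  define w where "w y = min 1 (norm y powr \<beta>)" for y :: "real^'n"
  have wm[measurable]: "w \<in> borel_measurable borel" unfolding w_def[abs_def] by measurable
  have w: "0 \<le> w y" "w y \<le> 1" for y by (auto simp: w_def)
  define D where "D n = distr \<nu> borel (\<lambda>y. inverse (Y n) *\<^sub>R y)" for n
  have sD: "sets (D n) = sets borel" for n by (simp add: D_def)
  note [measurable_cong] = sD sets_nu
  have D_tail: "emeasure (D n) {y. u < norm y} \<le> ennreal (C * pb u * V (Y n))" if "1 / Y n \<le> u" for n u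
  proof -
    have "emeasure (D n) {y. u < norm y} = emeasure \<nu> {y. u * Y n < norm y}"
    proof -
      have "(\<lambda>y. inverse (Y n) *\<^sub>R y) -` {y. u < norm y} \<inter> space \<nu> = {y. u * Y n < norm y}"
        using Y(3)[of n] sets_eq_imp_space_eq[OF sets_nu] by (auto simp: field_simps)
      then show ?thesis unfolding D_def by (subst emeasure_distr) auto
    qed
    also have "\<dots> \<le> ennreal (C * pb (u * Y n / Y n) * V (Y n))"
      using Y[of n] that by (intro C(3)) (auto simp: field_simps)
    also have "u * Y n / Y n = u" using Y(3)[of n] by simp
    finally show ?thesis .
  qed
  define M where "M n = density (D n) (\<lambda>y. ennreal (w y * indicator {y. 1 / Y n < norm y} y / V (Y n)))" for n
  have VY: "V (Y n) > 0" for n using V_pos Y by blast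
  have mass: "emeasure (M n) UNIV \<le> ennreal (\<Sum>k. C * exp (p + 1) * exp (-1) ^ k)" for n
  proof -
    \<comment> \<open>Index 0 is the exterior of the unit ball, and index \<open>Suc k\<close>
      serves the shell exp(-(k + 1)) < norm y \<le> exp(-k). The maximum with \<open>1 / Y n\<close>
      is there because the tail bound starts at that radius, where the restricted measure starts as
      well.\<close>
    define F where "F k y = (case k of 0 \<Rightarrow> ennreal (1 / V (Y n)) * indicator {y. 1 < norm y} y
      | Suc k \<Rightarrow> ennreal (exp (- real k * \<beta>) / V (Y n)) * indicator {y. max (exp (- real (Suc k))) (1 / Y n) < norm y} y)" for k and y :: "real^'n"
    have "emeasure (M n) UNIV = (\<integral>\<^sup>+ y. ennreal (w y * indicator {y. 1 / Y n < norm y} y / V (Y n)) \<partial>D n)"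
      unfolding M_def by (subst emeasure_density) auto
    also have "\<dots> \<le> (\<Sum>k. \<integral>\<^sup>+ y. F k y \<partial>D n)"
    proof (rule nn_integral_le_suminf)
      show "F k \<in> borel_measurable (D n)" for k unfolding F_def[abs_def] by (cases k) auto
      fix y :: "real^'n"
      show "\<exists>k. ennreal (w y * indicator {y. 1 / Y n < norm y} y / V (Y n)) \<le> F k y"
      proof (cases "1 / Y n < norm y")
        case False
        then show ?thesis by simp
      next
        case True
        then have y0: "norm y > 0" using Y(3)[of n] by (meson divide_pos_pos less_trans zero_less_one)
        show ?thesis
        proof (cases "1 < norm y")
          case y1: True
          have "w y / V (Y n) \<le> 1 / V (Y n)" using w(2) VY by (intro divide_right_mono) (auto simp: less_imp_le)
          then show ?thesis using True y1 by (intro exI[of _ 0]) (simp add: F_def ennreal_leI)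
        next
          case False
          define v where "v = ln (norm y)"
          have nv: "norm y = exp v" using y0 by (simp add: v_def)
          have v: "v \<le> 0" using False y0 by (simp add: v_def)
          define k where "k = nat \<lfloor>- v\<rfloor>"
          have k: "real k \<le> - v" "- v < real (Suc k)" using v unfolding k_def by linarith+
          have "w y \<le> norm y powr \<beta>" by (simp add: w_def)
          also have "\<dots> = exp (v * \<beta>)" unfolding nv by (simp add: powr_def mult.commute)
          also have "\<dots> \<le> exp (- real k * \<beta>)" 
            using mult_right_mono[of v "- real k" \<beta>] k(1) pq by (simp add: \<beta>_def)
          finally have "w y / V (Y n) \<le> exp (- real k * \<beta>) / V (Y n)" using VY by (intro divide_right_mono) (auto simp: less_imp_le)
          moreover have "exp (- real (Suc k)) < norm y" unfolding nv using k(2) by simp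
          ultimately show ?thesis using True by (intro exI[of _ "Suc k"]) (simp add: F_def ennreal_leI)
        qed
      qed
    qed
    also have "\<dots> \<le> ennreal (\<Sum>k. C * exp (p + 1) * exp (-1) ^ k)"
    proof (rule ennreal_suminf_le_finite)
      show "summable (\<lambda>k. C * exp (p + 1) * exp (-1) ^ k)" by (intro summable_mult summable_geometric) simp
      show "0 \<le> C * exp (p + 1) * exp (-1) ^ k" for k using C(1) by simp
      fix k
      have aux: "(\<integral>\<^sup>+ y. ennreal (a / V (Y n)) * indicator {y. u < norm y} y \<partial>D n) \<le> ennreal (a * (C * pb u))"
        if "1 / Y n \<le> u" "a \<ge> 0" for a u
      proof -
        have "(\<integral>\<^sup>+ y. ennreal (a / V (Y n)) * indicator {y. u < norm y} y \<partial>D n) = ennreal (a / V (Y n)) * emeasure (D n) {y. u < norm y}"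
          by (rule nn_integral_cmult_indicator) measurable
        also have "\<dots> \<le> ennreal (a / V (Y n)) * ennreal (C * pb u * V (Y n))"
          by (intro mult_left_mono D_tail that) auto
        also have "\<dots> = ennreal (a / V (Y n) * (C * pb u * V (Y n)))"
          using that VY[of n] by (subst ennreal_mult'[symmetric]) (auto simp: less_imp_le)
        also have "a / V (Y n) * (C * pb u * V (Y n)) = a * (C * pb u)" using VY[of n] by simp
        finally show ?thesis .
      qed
      show "(\<integral>\<^sup>+ y. F k y \<partial>D n) \<le> ennreal (C * exp (p + 1) * exp (-1) ^ k)"
      proof (cases k)
        case 0
        have "(\<integral>\<^sup>+ y. F k y \<partial>D n) \<le> ennreal (1 * (C * pb 1))"
          unfolding F_def 0 using Y[of n] by (simp only: nat.case, intro aux) (auto simp: field_simps)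
        also have "\<dots> \<le> ennreal (C * exp (p + 1) * exp (-1) ^ k)"
          unfolding 0 using C(1) pq by (intro ennreal_leI) (simp add: potter_bound_def)
        finally show ?thesis .
      next
        case (Suc m)
        let ?u = "max (exp (- real (Suc m))) (1 / Y n)"
        have "(\<integral>\<^sup>+ y. F k y \<partial>D n) \<le> ennreal (exp (- real m * \<beta>) * (C * pb ?u))"
          unfolding F_def Suc by (simp only: nat.case, intro aux) auto
        also have "\<dots> \<le> ennreal (C * exp (p + 1) * exp (-1) ^ k)"
        proof (rule ennreal_leI)
          have "pb ?u \<le> pb (exp (- real (Suc m)))" using delta by (intro potter_bound_antimono) auto
          also have "\<dots> \<le> exp (real (Suc m) * p)"
          proof -
            have "exp (- real (Suc m)) powr (- a) = exp (real (Suc m) * a)" for a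
              by (simp add: powr_def algebra_simps)
            then show ?thesis
              unfolding potter_bound_def p_def[symmetric] q_def[symmetric] using pq
              by (intro max.boundedI) (simp_all add: mult_left_mono)
          qed
          finally have "exp (- real m * \<beta>) * (C * pb ?u) \<le> exp (- real m * \<beta>) * (C * exp (real (Suc m) * p))"
            using C(1) by (intro mult_left_mono) auto
          also have "\<dots> = C * (exp (- real m * \<beta>) * exp (real (Suc m) * p))" by simp
          also have "exp (- real m * \<beta>) * exp (real (Suc m) * p) = exp (p + 1) * exp (-1) ^ k"
            unfolding exp_add[symmetric] exp_of_nat_mult[symmetric] Suc by (simp add: \<beta>_def algebra_simps)
          finally show "exp (- real m * \<beta>) * (C * pb ?u) \<le> C * exp (p + 1) * exp (-1) ^ k" by simp
        qed
        finally show ?thesis .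
      qed
    qed
    finally show ?thesis .
  qed
  have tight: "\<exists>R. \<forall>n. emeasure (M n) {x. norm x > R} \<le> ennreal e" if "e > 0" for e
  proof -
    obtain R where R: "R \<ge> 1" "C * pb R \<le> e" using exists_radius[OF C(1) \<open>e > 0\<close>] by blast
    have "emeasure (M n) {x. norm x > R} \<le> ennreal e" for n
    proof -
      have "emeasure (M n) {x. norm x > R} = (\<integral>\<^sup>+ y. ennreal (w y * indicator {y. 1 / Y n < norm y} y / V (Y n)) * indicator {x. norm x > R} y \<partial>D n)"
        unfolding M_def by (subst emeasure_density) auto
      also have "\<dots> \<le> (\<integral>\<^sup>+ y. ennreal (1 / V (Y n)) * indicator {x. R < norm x} y \<partial>D n)"
      proof (intro nn_integral_mono mult_right_mono ennreal_leI divide_right_mono)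
        show "w y * indicator {y. 1 / Y n < norm y} y \<le> 1" for y using w(2)[of y] by (auto simp: indicator_def)
      qed (use VY[of n] in auto)
      also have "\<dots> = ennreal (1 / V (Y n)) * emeasure (D n) {x. R < norm x}"
        by (rule nn_integral_cmult_indicator) measurable
      also have "\<dots> \<le> ennreal (1 / V (Y n)) * ennreal (C * pb R * V (Y n))"
      proof (intro mult_left_mono D_tail)
        have "1 / Y n \<le> 1" using Y[of n] by simp
        then show "1 / Y n \<le> R" using R(1) by linarith
      qed auto
      also have "\<dots> = ennreal (1 / V (Y n) * (C * pb R * V (Y n)))"
        using VY[of n] by (subst ennreal_mult'[symmetric]) (auto simp: less_imp_le)
      also have "1 / V (Y n) * (C * pb R * V (Y n)) = C * pb R" using VY[of n] by simp
      also have "ennreal (C * pb R) \<le> ennreal e" using R(2) by (rule ennreal_leI)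
      finally show ?thesis .
    qed
    then show ?thesis by blast
  qed
  have sM: "sets (M n) = sets borel" for n by (simp add: M_def sD)
  obtain r L0 where r: "strict_mono r" and L0: "sets L0 = sets borel" "emeasure L0 UNIV < \<infinity>"
    and lim: "\<And>f :: real^'n \<Rightarrow> real. continuous_on UNIV f \<Longrightarrow> bounded (range f) \<Longrightarrow> (\<lambda>n. integral\<^sup>L (M (r n)) f) \<longlonglongrightarrow> integral\<^sup>L L0 f"
  proof (rule prokhorov[where M=M, OF sM mass tight])
    fix r :: "nat \<Rightarrow> nat" and L :: "(real^'n) measure"
    assume a: "strict_mono r" "sets L = sets borel" "emeasure L UNIV < \<infinity>"
      and b: "\<And>f :: real^'n \<Rightarrow> real. continuous_on UNIV f \<Longrightarrow> bounded (range f) \<Longrightarrow> (\<lambda>n. integral\<^sup>L (M (r n)) f) \<longlonglongrightarrow> integral\<^sup>L L f"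
    show thesis by (rule that[OF a]) (rule b)
  qed
  note [measurable_cong] = L0(1)
  \<comment> \<open>Removes the weight. At the origin \<open>1 / w\<close> is 0 by the convention
    for division by zero, so any mass of \<open>L0\<close> there disappears.\<close>
  define L where "L = density L0 (\<lambda>y. ennreal (1 / w y))"
  have w0: "w y = 0 \<longleftrightarrow> y = 0" for y by (auto simp: w_def min_def)
  have wge: "min 1 (a powr \<beta>) \<le> w y" if "a \<le> norm y" "0 < a" for a y
    unfolding w_def using that pq by (intro min.mono powr_mono2) (auto simp: \<beta>_def)
  have Llim: "(\<lambda>n. E (Y (r n)) f) \<longlonglongrightarrow> integral\<^sup>L L f" if f: "f \<in> away_test" for f
  proof -
    obtain B a where f: "continuous_on UNIV f" "f \<in> borel_measurable borel" "B > 0" "\<And>x. \<bar>f x\<bar> \<le> B" "a > 0" "\<And>x. norm x < a \<Longrightarrow> f x = 0"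
      using away_testE[OF f] by metis
    note [measurable] = f(2)
    define m where "m = min 1 (a powr \<beta>)"
    have m: "m > 0" using f(5) by (simp add: m_def)
    \<comment> \<open>The quotient of \<open>f\<close> by \<open>w\<close>, with the denominator
      kept above \<open>m\<close> so that continuity at the origin is evident; where
      \<open>f\<close> is nonzero, \<open>w\<close> is at least \<open>m\<close> anyway.\<close>
    define h where "h y = f y / max m (w y)" for y
    have hw: "h y = f y / w y" for y
      using wge[of a y] f(5) f(6)[of y] by (cases "norm y < a") (auto simp: h_def m_def max_def)
    have "continuous_on UNIV w" unfolding w_def[abs_def] using pq
      by (intro continuous_intros continuous_on_powr') (auto simp: \<beta>_def)
    then have hc: "continuous_on UNIV h" unfolding h_def[abs_def] using m
      by (intro continuous_intros f(1)) auto
    have "\<bar>h y\<bar> \<le> B / m" for y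
      unfolding h_def abs_divide using f(3,4) m by (intro frac_le) auto
    then have hb: "bounded (range h)" by (intro boundedI[of _ "B / m"]) auto
    have [measurable]: "h \<in> borel_measurable borel" using hc by (rule borel_measurable_continuous_onI)
    have "integral\<^sup>L L f = integral\<^sup>L L0 (\<lambda>y. 1 / w y * f y)"
      unfolding L_def using w by (subst integral_real_density) auto
    then have L_eq: "integral\<^sup>L L f = integral\<^sup>L L0 h" by (simp add: hw[abs_def])
    have "eventually (\<lambda>n. 1 / a < Y n) sequentially" using Ylim by (auto simp: filterlim_at_top_dense)
    then have ev: "eventually (\<lambda>n. integral\<^sup>L (M n) h = E (Y n) f) sequentially"
    proof eventually_elim
      case (elim n)
      have an: "1 / Y n < a" using elim f(5) Y(3)[of n] by (simp add: field_simps)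
      have "integral\<^sup>L (M n) h = integral\<^sup>L (D n) (\<lambda>y. w y * indicator {y. 1 / Y n < norm y} y / V (Y n) * h y)"
        unfolding M_def using w VY[of n] by (subst integral_real_density) auto
      also have "\<dots> = integral\<^sup>L (D n) (\<lambda>y. f y / V (Y n))"
      proof (rule Bochner_Integration.integral_cong[OF refl])
        fix y
        show "w y * indicator {y. 1 / Y n < norm y} y / V (Y n) * h y = f y / V (Y n)"
        proof (cases "f y = 0")
          case False
          then have "a \<le> norm y" using f(6) not_le by blast
          then have "1 / Y n < norm y" "y \<noteq> 0" using an f(5) by auto
          then show ?thesis using w0[of y] by (simp add: hw)
        qed (simp add: hw)
      qed
      also have "\<dots> = integral\<^sup>L (D n) f / V (Y n)" by simp
      also have "integral\<^sup>L (D n) f = (LINT y|\<nu>. f (inverse (Y n) *\<^sub>R y))"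
        unfolding D_def by (subst integral_distr) auto
      finally show ?case by (simp add: E_def)
    qed
    have "(\<lambda>n. integral\<^sup>L (M (r n)) h) \<longlonglongrightarrow> integral\<^sup>L L f" unfolding L_eq by (rule lim[OF hc hb])
    moreover have "eventually (\<lambda>n. integral\<^sup>L (M (r n)) h = E (Y (r n)) f) sequentially"
      using filterlim_subseq[OF r] ev by (auto simp: filterlim_iff)
    ultimately show ?thesis by (rule Lim_transform_eventually)
  qed
  have Lfin: "finite_away L"
    unfolding finite_away_def
  proof (intro conjI allI impI)
    show sL: "sets L = sets borel" by (simp add: L_def L0)
    fix a :: real assume a: "a > 0"
    have "emeasure L {y. a \<le> norm y} = (\<integral>\<^sup>+ y. ennreal (1 / w y) * indicator {y. a \<le> norm y} y \<partial>L0)"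
      unfolding L_def by (subst emeasure_density) auto
    also have "\<dots> \<le> (\<integral>\<^sup>+ y. ennreal (1 / min 1 (a powr \<beta>)) \<partial>L0)"
    proof (rule nn_integral_mono)
      fix y
      show "ennreal (1 / w y) * indicator {y. a \<le> norm y} y \<le> ennreal (1 / min 1 (a powr \<beta>))"
        using wge[of a y] a by (auto simp: indicator_def intro!: ennreal_leI divide_left_mono mult_pos_pos simp: w_def min_less_iff_conj split: if_splits)
    qed
    also have "\<dots> = ennreal (1 / min 1 (a powr \<beta>)) * emeasure L0 UNIV"
      using sets_eq_imp_space_eq[OF L0(1)] by simp
    also have "\<dots> < \<infinity>" using L0(2) by (simp add: ennreal_mult_less_top)
    finally show "emeasure L {y. a \<le> norm y} < \<infinity>" .
  qed
  have L00: "emeasure L {0} = 0"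
    unfolding L_def by (subst emeasure_density) (auto simp: w_def nn_integral_0_iff_AE indicator_def)
  \<comment> \<open>The Potter bound would lose \<delta> in the exponent. Letting n tend to infinity
    in the comparison of \<nu> with \<open>V\<close> instead, regular variation yields the exact
    power u^-\<alpha> with one constant for all u.\<close>
  have Ltb: "tail_bounded L \<alpha>"
    unfolding tail_bounded_def
  proof (intro conjI)
    show sL: "sets L = sets borel" by (simp add: L_def L0)
    obtain C1 c where c: "C1 > 0" "c > 0" "\<And>v. v > 0 \<Longrightarrow> emeasure \<nu> {y. v < norm y} \<le> ennreal (C1 * V (c * v))"
      using nu_tail_le_V by metis
    have "emeasure L {y. u < norm y} \<le> ennreal (C1 * (c / 2) powr (- \<alpha>) * u powr (- \<alpha>))" if u: "u > 0" for u
    proof -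
      define f where "f y = max 0 (min 1 ((norm y - u/2) / (u - u/2)))" for y :: "real^'n"
      have f: "f \<in> away_test" unfolding f_def[abs_def] by (rule away_test_ramp[OF is_norm_norm]) (use u in auto)
      have f1: "f y = 1" if "u < norm y" for y using that u by (auto simp: f_def min_def max_def field_simps)
      have f0: "f y = 0" if "\<not> u/2 < norm y" for y using that u by (auto simp: f_def min_def max_def field_simps)
      have fb: "0 \<le> f y" "f y \<le> 1" for y by (auto simp: f_def)
      have E_le: "E (Y n) f \<le> C1 * (V (c * u / 2 * Y n) / V (Y n))" for n
      proof -
        have up: "u/2 * Y n > 0" using u Y(3)[of n] by simp
        have "emeasure \<nu> {y. u/2 * Y n < norm y} < \<infinity>"
          by (rule finite_away_norm(3)[OF is_norm_norm nu_fin up])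
        then have fin: "emeasure \<nu> {y. u/2 * Y n < norm y} = ennreal (measure \<nu> {y. u/2 * Y n < norm y})"
          by (intro emeasure_eq_ennreal_measure) simp
        have "(LINT y|\<nu>. f (inverse (Y n) *\<^sub>R y)) \<le> (LINT y|\<nu>. indicator {y. u/2 * Y n < norm y} y)"
        proof (rule integral_mono)
          show "integrable \<nu> (\<lambda>y. f (inverse (Y n) *\<^sub>R y))"
            by (rule integrable_away_test[OF nu_fin away_test_scale[OF f Y(3)]])
          show "integrable \<nu> (\<lambda>y. indicator {y. u/2 * Y n < norm y} y :: real)"
            using fin by (intro integrable_real_indicator) auto
          fix y :: "real^'n"
          show "f (inverse (Y n) *\<^sub>R y) \<le> indicator {y. u/2 * Y n < norm y} y"
            using fb[of "inverse (Y n) *\<^sub>R y"] f0[of "inverse (Y n) *\<^sub>R y"] Y(3)[of n]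
            by (auto simp: indicator_def field_simps)
        qed
        also have "\<dots> = measure \<nu> {y. u/2 * Y n < norm y}" using sets_eq_imp_space_eq[OF sets_nu] by simp
        also have "\<dots> \<le> C1 * V (c * (u/2 * Y n))"
          using c(3)[OF up] c(1) unfolding fin by (subst (asm) ennreal_le_iff) (auto simp: V_def)
        finally show ?thesis unfolding E_def using VY[of n] by (simp add: divide_right_mono mult.assoc[symmetric])
      qed
      have "(\<lambda>n. C1 * (V (c * u / 2 * Y (r n)) / V (Y (r n)))) \<longlonglongrightarrow> C1 * (c * u / 2) powr (- \<alpha>)"
        using filterlim_compose[OF V_lim filterlim_compose[OF Ylim filterlim_subseq[OF r]], of "c * u / 2"] c u
        by (intro tendsto_mult_left) auto
      then have "integral\<^sup>L L f \<le> C1 * (c * u / 2) powr (- \<alpha>)"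
        using E_le by (intro LIMSEQ_le[OF Llim[OF f]]) auto
      also have "(c * u / 2) powr (- \<alpha>) = (c / 2) powr (- \<alpha>) * u powr (- \<alpha>)"
        by (simp add: powr_mult[symmetric])
      finally have fle: "integral\<^sup>L L f \<le> C1 * (c / 2) powr (- \<alpha>) * u powr (- \<alpha>)" by (simp add: mult.assoc)
      have "emeasure L {y. u < norm y} = ennreal (measure L {y. u < norm y})"
        using finite_away_norm(3)[OF is_norm_norm Lfin u] by (intro emeasure_eq_ennreal_measure) simp
      also have "measure L {y. u < norm y} = (LINT y|L. indicator {y. u < norm y} y)"
        using sets_eq_imp_space_eq[OF sL] by simp
      also have "\<dots> \<le> integral\<^sup>L L f"
        using finite_away_norm(1,3)[OF is_norm_norm Lfin u] fb f1
        by (intro integral_mono integrable_away_test[OF Lfin f] integrable_real_indicator) (auto simp: indicator_def)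
      finally show ?thesis using fle by (meson ennreal_leI order_trans)
    qed
    then show "\<exists>C\<ge>0. \<forall>u>0. emeasure L {y. u < norm y} \<le> ennreal (C * u powr (- \<alpha>))"
      using c by (intro exI[of _ "C1 * (c / 2) powr (- \<alpha>)"]) auto
  qed
  show ?thesis
  proof (rule that[of "\<lambda>n. r n + n0" L])
    show "strict_mono (\<lambda>n. r n + n0)" using r by (auto simp: strict_mono_def)
    show "(\<lambda>n. E (X (r n + n0)) f) \<longlonglongrightarrow> integral\<^sup>L L f" if "f \<in> away_test" for f
      using Llim[OF that] by (simp add: Y_def)
  qed (fact Ltb L00)+
qed


section \<open>The convolution equation for limit points\<close>

lemma integral_mult_conv:
  fixes L :: "(real^'n) measure" and f :: "real^'n \<Rightarrow> real"
  assumes L: "sets L = sets borel" "sigma_finite_measure L" and f: "integrable (L \<circledast> \<rho>) f" "f \<in> borel_measurable borel"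
  shows "integrable (\<rho> \<Otimes>\<^sub>M L) (\<lambda>p. f (diag_map (fst p) (snd p)))"
    "integral\<^sup>L (L \<circledast> \<rho>) f = (LINT p|(\<rho> \<Otimes>\<^sub>M L). f (diag_map (fst p) (snd p)))"
proof -
  note [measurable_cong] = sets_rho L(1)
  have dm: "(\<lambda>p. diag_map (fst p) (snd p)) \<in> (\<rho> \<Otimes>\<^sub>M L) \<rightarrow>\<^sub>M borel" by measurable
  show "integrable (\<rho> \<Otimes>\<^sub>M L) (\<lambda>p. f (diag_map (fst p) (snd p)))"
    using f(1) unfolding mult_conv_eq_distr[OF sets_rho L] by (subst (asm) integrable_distr_eq[OF dm f(2)])
  show "integral\<^sup>L (L \<circledast> \<rho>) f = (LINT p|(\<rho> \<Otimes>\<^sub>M L). f (diag_map (fst p) (snd p)))"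
    unfolding mult_conv_eq_distr[OF sets_rho L] by (rule integral_distr[OF dm f(2)])
qed

text \<open>Identifies the numerator in the smallness hypothesis as the product mass of the event
  that the j-th product is large although y_j is small.\<close>

lemma emeasure_bad_set:
  assumes s: "s > 0"
  shows "emeasure (\<rho> \<Otimes>\<^sub>M \<nu>) {p. s < \<bar>fst p $ j * snd p $ j\<bar> \<and> 0 < \<bar>snd p $ j\<bar> \<and> \<bar>snd p $ j\<bar> \<le> b} =
    (\<integral>\<^sup>+ y \<in> {y. 0 < \<bar>y $ j\<bar> \<and> \<bar>y $ j\<bar> \<le> b}. emeasure \<rho> {x. \<bar>x $ j\<bar> > s / \<bar>y $ j\<bar>} \<partial>\<nu>)" (is "emeasure _ ?A = _")
proof -
  note [measurable_cong] = sets_rho sets_nu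
  have sp: "space (\<rho> \<Otimes>\<^sub>M \<nu>) = UNIV"
    using sets_eq_imp_space_eq[OF sets_rho] sets_eq_imp_space_eq[OF sets_nu] by (simp add: space_pair_measure)
  interpret pair_sigma_finite \<rho> \<nu> unfolding pair_sigma_finite_def using sigma_rho sigma_nu by auto
  have "{p \<in> space (\<rho> \<Otimes>\<^sub>M \<nu>). s < \<bar>fst p $ j * snd p $ j\<bar> \<and> 0 < \<bar>snd p $ j\<bar> \<and> \<bar>snd p $ j\<bar> \<le> b} \<in> sets (\<rho> \<Otimes>\<^sub>M \<nu>)"
    by measurable
  then have "?A \<in> sets (\<rho> \<Otimes>\<^sub>M \<nu>)" by (simp add: sp)
  then have "emeasure (\<rho> \<Otimes>\<^sub>M \<nu>) ?A = (\<integral>\<^sup>+y. emeasure \<rho> ((\<lambda>x. (x, y)) -` ?A) \<partial>\<nu>)"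
    by (rule emeasure_pair_measure_alt2)
  also have "\<dots> = (\<integral>\<^sup>+ y \<in> {y. 0 < \<bar>y $ j\<bar> \<and> \<bar>y $ j\<bar> \<le> b}. emeasure \<rho> {x. \<bar>x $ j\<bar> > s / \<bar>y $ j\<bar>} \<partial>\<nu>)"
  proof (rule nn_integral_cong)
    fix y
    show "emeasure \<rho> ((\<lambda>x. (x, y)) -` ?A) = emeasure \<rho> {x. \<bar>x $ j\<bar> > s / \<bar>y $ j\<bar>} * indicator {y. 0 < \<bar>y $ j\<bar> \<and> \<bar>y $ j\<bar> \<le> b} y"
    proof (cases "0 < \<bar>y $ j\<bar> \<and> \<bar>y $ j\<bar> \<le> b")
      case True
      then have "(\<lambda>x. (x, y)) -` ?A = {x. \<bar>x $ j\<bar> > s / \<bar>y $ j\<bar>}"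
        by (auto simp: abs_mult divide_less_eq)
      then show ?thesis using True by simp
    next
      case False
      then have *: "(\<lambda>x. (x, y)) -` ?A = {}" by auto
      show ?thesis unfolding * using False by simp
    qed
  qed
  finally show ?thesis .
qed

text \<open>The iterated limit becomes a single \<open>b\<close> that serves all coordinates, there
  being finitely many of them.\<close>

lemma small_eventually:
  assumes e: "e > 0"
  obtains b where "b > 0" "\<forall>\<^sub>F s in at_top. \<forall>j.
    (\<integral>\<^sup>+ y \<in> {y. 0 < \<bar>y $ j\<bar> \<and> \<bar>y $ j\<bar> \<le> b}. emeasure \<rho> {x. \<bar>x $ j\<bar> > s / \<bar>y $ j\<bar>} \<partial>\<nu>) \<le> ennreal (e * V s)"
proof -
  let ?Q = "\<lambda>j b s. (\<integral>\<^sup>+ y \<in> {y. 0 < \<bar>y $ j\<bar> \<and> \<bar>y $ j\<bar> \<le> b}. emeasure \<rho> {x. \<bar>x $ j\<bar> > s / \<bar>y $ j\<bar>} \<partial>\<nu>)"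
  have "eventually (\<lambda>b. Limsup at_top (\<lambda>s. ?Q j b s / emeasure (\<nu> \<circledast> \<rho>) {x. N x > s}) < ennreal e) (at_right 0)" for j
    by (rule order_tendstoD(2)[OF small]) (use e in simp)
  then have "eventually (\<lambda>b. \<forall>j. Limsup at_top (\<lambda>s. ?Q j b s / emeasure (\<nu> \<circledast> \<rho>) {x. N x > s}) < ennreal e) (at_right 0)"
    by (rule eventually_all_finite)
  then have "eventually (\<lambda>b. (\<forall>j. Limsup at_top (\<lambda>s. ?Q j b s / emeasure (\<nu> \<circledast> \<rho>) {x. N x > s}) < ennreal e) \<and> 0 < b) (at_right 0)"
    using eventually_at_right_less[of "0::real"] by (rule eventually_conj)
  then obtain b where b: "\<And>j. Limsup at_top (\<lambda>s. ?Q j b s / emeasure (\<nu> \<circledast> \<rho>) {x. N x > s}) < ennreal e" "0 < b"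
    using eventually_happens trivial_limit_at_right_real by blast
  have "eventually (\<lambda>s. ?Q j b s / emeasure (\<nu> \<circledast> \<rho>) {x. N x > s} < ennreal e) at_top" for j
    by (rule Limsup_lessD[OF b(1)])
  then have "eventually (\<lambda>s. \<forall>j. ?Q j b s / emeasure (\<nu> \<circledast> \<rho>) {x. N x > s} < ennreal e) at_top"
    by (rule eventually_all_finite)
  then have "eventually (\<lambda>s. \<forall>j. ?Q j b s \<le> ennreal (e * V s)) at_top"
    using eventually_gt_at_top[of 0]
  proof eventually_elim
    case (elim s)
    show ?case
    proof
      fix j
      have v: "emeasure (\<nu> \<circledast> \<rho>) {x. N x > s} = ennreal (V s)" "ennreal (V s) \<noteq> 0" "V s > 0"
        using emeasure_V[OF elim(2)] V_pos[OF elim(2)] by auto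
      have "?Q j b s = ennreal (V s) * ?Q j b s / ennreal (V s)"
        using v by (subst mult.commute, subst mult_divide_eq_ennreal) auto
      also have "\<dots> = ennreal (V s) * (?Q j b s / ennreal (V s))" by (rule ennreal_times_divide[symmetric])
      also have "\<dots> \<le> ennreal (V s) * ennreal e"
        using elim(1) v(1) by (intro mult_left_mono) (auto simp: less_imp_le)
      also have "\<dots> = ennreal (e * V s)" using v e by (simp add: ennreal_mult'' mult.commute)
      finally show "?Q j b s \<le> ennreal (e * V s)" .
    qed
  qed
  with b(2) show ?thesis by (rule that)
qed

text \<open>The cut at \<open>b\<close> makes the Potter bound for \<open>\<nu>\<close> applicable; it costs only the part of the
  integral controlled by \<open>small\<close>.\<close>

definition cut :: "(real^'n \<Rightarrow> real) \<Rightarrow> real \<Rightarrow> real \<Rightarrow> real \<Rightarrow> real^'n \<Rightarrow> real^'n \<Rightarrow> real" where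
  "cut f a b s x y = (if \<exists>j. a * s < \<bar>x $ j * y $ j\<bar> \<and> b < \<bar>y $ j\<bar> then f (inverse s *\<^sub>R diag_map x y) else 0)"

lemma cut_measurable:
  assumes [measurable]: "f \<in> borel_measurable borel"
  shows "(\<lambda>p. cut f a b s (fst p) (snd p)) \<in> borel_measurable (borel \<Otimes>\<^sub>M borel)"
  unfolding cut_def[abs_def] by measurable

text \<open>Where \<open>f\<close> is nonzero at the rescaled product, some coordinate of the
  product exceeds a s; if the cut drops this value, that coordinate of y is at most b in absolute
  value. The discrepancy is therefore carried by one bad event for each coordinate, each of small
  mass relative to V(a s).\<close>

lemma cut_error:
  assumes f: "f \<in> away_test" and B: "\<And>x. \<bar>f x\<bar> \<le> B" and r: "r > 0" "\<And>x. norm x < r \<Longrightarrow> f x = 0"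
    and a: "a = r / (2 * real CARD('n))" and s: "s > 0" and e: "e > 0"
    and bad: "\<And>j. (\<integral>\<^sup>+ y \<in> {y. 0 < \<bar>y $ j\<bar> \<and> \<bar>y $ j\<bar> \<le> b}. emeasure \<rho> {x. \<bar>x $ j\<bar> > a * s / \<bar>y $ j\<bar>} \<partial>\<nu>) \<le> ennreal (e * V (a * s))"
  shows "\<bar>(LINT z|(\<nu> \<circledast> \<rho>). f (inverse s *\<^sub>R z)) / V s - (LINT x|\<rho>. (LINT y|\<nu>. cut f a b s x y) / V s)\<bar>
    \<le> real CARD('n) * B * e * (V (a * s) / V s)"
proof -
  note [measurable_cong] = sets_rho sets_nu
  have a0: "a > 0" using r(1) by (simp add: a)
  have B0: "B \<ge> 0" using B[of undefined] by linarith
  interpret pair_sigma_finite \<rho> \<nu> unfolding pair_sigma_finite_def using sigma_rho sigma_nu by auto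
  have fs: "(\<lambda>z. f (inverse s *\<^sub>R z)) \<in> away_test" by (rule away_test_scale[OF f s])
  have fm[measurable]: "f \<in> borel_measurable borel" using away_testE[OF f] by metis
  have fsm: "(\<lambda>z. f (inverse s *\<^sub>R z)) \<in> borel_measurable borel" by measurable
  define T where "T p = f (inverse s *\<^sub>R diag_map (fst p) (snd p))" for p
  define G where "G p = cut f a b s (fst p) (snd p)" for p
  have Ti: "integrable (\<rho> \<Otimes>\<^sub>M \<nu>) T" and T_eq: "(LINT z|(\<nu> \<circledast> \<rho>). f (inverse s *\<^sub>R z)) = integral\<^sup>L (\<rho> \<Otimes>\<^sub>M \<nu>) T"
    using integral_mult_conv[OF sets_nu sigma_nu integrable_away_test[OF conv_fin fs] fsm] unfolding T_def[abs_def] by auto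
  have Gm: "G \<in> borel_measurable (\<rho> \<Otimes>\<^sub>M \<nu>)"
    unfolding G_def[abs_def] using cut_measurable[OF fm] by measurable
  have Gi: "integrable (\<rho> \<Otimes>\<^sub>M \<nu>) G"
    by (rule Bochner_Integration.integrable_bound[OF Ti Gm]) (auto simp: G_def T_def cut_def)
  have G_eq: "(LINT x|\<rho>. (LINT y|\<nu>. cut f a b s x y) / V s) = integral\<^sup>L (\<rho> \<Otimes>\<^sub>M \<nu>) G / V s"
    using integral_fst'[OF Gi] by (simp add: G_def)
  define A where "A j = {p. a * s < \<bar>fst p $ j * snd p $ j\<bar> \<and> 0 < \<bar>snd p $ j\<bar> \<and> \<bar>snd p $ j\<bar> \<le> b}" for j :: 'n
  have sp: "space (\<rho> \<Otimes>\<^sub>M \<nu>) = UNIV"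
    using sets_eq_imp_space_eq[OF sets_rho] sets_eq_imp_space_eq[OF sets_nu] by (simp add: space_pair_measure)
  have "{p \<in> space (\<rho> \<Otimes>\<^sub>M \<nu>). a * s < \<bar>fst p $ j * snd p $ j\<bar> \<and> 0 < \<bar>snd p $ j\<bar> \<and> \<bar>snd p $ j\<bar> \<le> b} \<in> sets (\<rho> \<Otimes>\<^sub>M \<nu>)" for j
    by measurable
  then have Am[measurable]: "A j \<in> sets (\<rho> \<Otimes>\<^sub>M \<nu>)" for j by (simp add: sp A_def)
  have pt: "\<bar>T p - G p\<bar> \<le> (\<Sum>j\<in>UNIV. B * indicator (A j) p)" for p
  proof (cases "T p - G p = 0")
    case True
    then show ?thesis using B0 by (auto intro!: sum_nonneg)
  next
    case False
    then have G0: "\<not> (\<exists>j. a * s < \<bar>fst p $ j * snd p $ j\<bar> \<and> b < \<bar>snd p $ j\<bar>)" and T0: "T p \<noteq> 0"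
      by (auto simp: G_def T_def cut_def split: if_splits)
    have "r \<le> norm (inverse s *\<^sub>R diag_map (fst p) (snd p))" using T0 r(2) unfolding T_def by (meson not_le)
    then obtain j where "a < \<bar>(inverse s *\<^sub>R diag_map (fst p) (snd p)) $ j\<bar>"
      using large_coordinate[OF r(1)] a by blast
    then have j: "a * s < \<bar>fst p $ j * snd p $ j\<bar>" using s by (simp add: diag_map_def abs_mult field_simps)
    moreover have "0 < \<bar>fst p $ j * snd p $ j\<bar>" using j a0 s by (meson mult_pos_pos less_trans)
    moreover have "\<bar>snd p $ j\<bar> \<le> b" using G0 j by (meson not_le)
    ultimately have "p \<in> A j" by (auto simp: A_def)
    have "G p = 0" unfolding G_def cut_def using G0 by (rule if_not_P)
    then have "\<bar>T p - G p\<bar> = \<bar>T p\<bar>" by simp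
    also have "\<dots> \<le> B * indicator (A j) p" using B \<open>p \<in> A j\<close> by (simp add: T_def)
    also have "\<dots> \<le> (\<Sum>j\<in>UNIV. B * indicator (A j) p)" using B0 by (intro member_le_sum) auto
    finally show ?thesis .
  qed
  have "ennreal \<bar>integral\<^sup>L (\<rho> \<Otimes>\<^sub>M \<nu>) (\<lambda>p. T p - G p)\<bar> \<le> (\<integral>\<^sup>+p. ennreal \<bar>T p - G p\<bar> \<partial>(\<rho> \<Otimes>\<^sub>M \<nu>))"
    using integral_norm_bound_ennreal[OF Bochner_Integration.integrable_diff[OF Ti Gi]] by simp
  also have "\<dots> \<le> (\<integral>\<^sup>+p. (\<Sum>j\<in>UNIV. ennreal B * indicator (A j) p) \<partial>(\<rho> \<Otimes>\<^sub>M \<nu>))"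
  proof (rule nn_integral_mono)
    fix p
    have "ennreal \<bar>T p - G p\<bar> \<le> ennreal (\<Sum>j\<in>UNIV. B * indicator (A j) p)" using pt by (rule ennreal_leI)
    also have "\<dots> = (\<Sum>j\<in>UNIV. ennreal (B * indicator (A j) p))" using B0 by (intro sum_ennreal[symmetric]) auto
    also have "\<dots> = (\<Sum>j\<in>UNIV. ennreal B * indicator (A j) p)" by (intro sum.cong) (auto simp: indicator_def)
    finally show "ennreal \<bar>T p - G p\<bar> \<le> (\<Sum>j\<in>UNIV. ennreal B * indicator (A j) p)" .
  qed
  also have "\<dots> = (\<Sum>j\<in>UNIV. ennreal B * emeasure (\<rho> \<Otimes>\<^sub>M \<nu>) (A j))"
    by (subst nn_integral_sum) (auto simp: nn_integral_cmult_indicator)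
  also have "\<dots> \<le> (\<Sum>j\<in>(UNIV::'n set). ennreal B * ennreal (e * V (a * s)))"
  proof (intro sum_mono mult_left_mono)
    have "a * s > 0" using a0 s by simp
    then show "emeasure (\<rho> \<Otimes>\<^sub>M \<nu>) (A j) \<le> ennreal (e * V (a * s))" for j
      unfolding A_def by (subst emeasure_bad_set) (auto simp only: bad)
  qed simp
  also have "\<dots> = ennreal (real CARD('n) * (B * (e * V (a * s))))"
    using B0 by (simp add: ennreal_mult' ennreal_of_nat_eq_real_of_nat)
  finally have "\<bar>integral\<^sup>L (\<rho> \<Otimes>\<^sub>M \<nu>) (\<lambda>p. T p - G p)\<bar> \<le> real CARD('n) * (B * (e * V (a * s)))"
    using B0 e V_pos[of "a * s"] a0 s by (subst (asm) ennreal_le_iff) auto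
  then have "\<bar>integral\<^sup>L (\<rho> \<Otimes>\<^sub>M \<nu>) T - integral\<^sup>L (\<rho> \<Otimes>\<^sub>M \<nu>) G\<bar> / V s \<le> real CARD('n) * (B * (e * V (a * s))) / V s"
    using Ti Gi V_pos[OF s] by (intro divide_right_mono) auto
  then show ?thesis
    unfolding T_eq G_eq using V_pos[OF s] by (simp add: diff_divide_distrib[symmetric] mult.assoc)
qed

text \<open>Dominated convergence in x. For fixed x and large s the cut is inactive, since a s <
  \<bar>x_j y_j\<bar> already forces \<bar>y_j\<bar> > b; hence the inner integral tends to the one
  against \<open>L\<close>. The dominating function comes from the Potter bound and is integrable by
  the two-sided moments of \<rho>.\<close>

lemma cut_limit:
  assumes X: "filterlim X at_top sequentially" and L: "tail_bounded L \<alpha>" "emeasure L {0} = 0"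
    and conv: "\<And>f. f \<in> away_test \<Longrightarrow> (\<lambda>n. E (X n) f) \<longlonglongrightarrow> integral\<^sup>L L f"
    and f: "f \<in> away_test" and B: "\<And>x. \<bar>f x\<bar> \<le> B" and r: "r > 0" "\<And>x. norm x < r \<Longrightarrow> f x = 0"
    and a: "a = r / (2 * real CARD('n))" and b: "b > 0"
  shows "(\<lambda>n. (LINT x|\<rho>. (LINT y|\<nu>. cut f a b (X n) x y) / V (X n))) \<longlonglongrightarrow> integral\<^sup>L (L \<circledast> \<rho>) f"
proof -
  note [measurable_cong] = sets_rho sets_nu
  have sL: "sets L = sets borel" using L by (simp add: tail_bounded_def)
  have sf: "sigma_finite_measure L" by (rule tail_bounded_sigma_finite[OF L])
  have a0: "a > 0" using r(1) by (simp add: a)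
  have B0: "B \<ge> 0" using B[of undefined] by linarith
  have fm[measurable]: "f \<in> borel_measurable borel" using away_testE[OF f] by metis
  have cutm: "cut f a b s x \<in> borel_measurable borel" for s x
    unfolding cut_def[abs_def] diag_map_def by measurable
  interpret L: pair_sigma_finite \<rho> L unfolding pair_sigma_finite_def using sigma_rho sf by auto
  have J: "integral\<^sup>L (L \<circledast> \<rho>) f = (LINT x|\<rho>. (LINT y|L. f (diag_map x y)))"
    using integral_mult_conv[OF sL sf integrable_away_test[OF tail_bounded_finite_away[OF tail_bounded_mult_conv(1)[OF L]] f] fm]
      L.integral_fst'[of "\<lambda>p. f (diag_map (fst p) (snd p))"] by simp
  obtain C s0 where C: "C > 0" "s0 > 0"
    "\<And>s v. s0 \<le> s \<Longrightarrow> b \<le> v \<Longrightarrow> emeasure \<nu> {y. v < norm y} \<le> ennreal (C * pb (v / s) * V s)"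
    using nu_potter[OF b] by metis
  have "eventually (\<lambda>n. s0 \<le> X n) sequentially" using X by (simp only: filterlim_at_top)
  then obtain n0 where n0: "\<And>n. n \<ge> n0 \<Longrightarrow> s0 \<le> X n" by (auto simp: eventually_sequentially)
  define p where "p = \<alpha> + \<delta>"
  define q where "q = \<alpha> - \<delta>"
  have pq: "p > 0" "q > 0" using delta by (auto simp: p_def q_def)
  \<comment> \<open>A constant times the Potter bound at a / norm x, with the maximum of the two
    powers replaced by their sum.\<close>
  define w where "w x = B * (C * (a powr (- p) * norm x powr p + a powr (- q) * norm x powr q))" for x :: "real^'n"
  have wi: "integrable \<rho> w"
    unfolding w_def[abs_def] using moment pq
    by (intro integrable_mult_right Bochner_Integration.integrable_add integrable_norm_powr) (auto simp: p_def q_def)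
  define Y where "Y n = X (n + n0)" for n
  have Y: "s0 \<le> Y n" "0 < Y n" for n using n0[of "n + n0"] C(2) by (auto simp: Y_def)
  have Ylim: "filterlim Y at_top sequentially" unfolding Y_def by (rule filterlim_compose[OF X filterlim_add_const_nat_at_top])
  have dom: "\<bar>(LINT y|\<nu>. cut f a b s x y) / V s\<bar> \<le> w x" if s: "s0 \<le> s" and x: "x \<noteq> 0" for s x
  proof -
    have sp: "s > 0" using s C(2) by linarith
    have nx: "norm x > 0" using x by simp
    \<comment> \<open>The cut lets through only y whose norm exceeds both thresholds:
      \<open>b\<close>, which makes the Potter bound applicable, and \<open>a * s / norm x\<close>,
      which makes its argument u / s at least a / norm x.\<close>
    define u where "u = max b (a * s / norm x)"
    have u: "u > 0" "b \<le> u" using b by (auto simp: u_def)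
    have pt: "\<bar>cut f a b s x y\<bar> \<le> B * indicator {y. u < norm y} y" for y
    proof (cases "\<exists>j. a * s < \<bar>x $ j * y $ j\<bar> \<and> b < \<bar>y $ j\<bar>")
      case True
      then obtain j where j: "a * s < \<bar>x $ j * y $ j\<bar>" "b < \<bar>y $ j\<bar>" by blast
      have "b < norm y" using j(2) component_le_norm_cart[of y j] by linarith
      moreover have "\<bar>x $ j * y $ j\<bar> \<le> norm x * norm y"
        unfolding abs_mult by (intro mult_mono component_le_norm_cart) auto
      then have "a * s / norm x < norm y" using j(1) nx by (simp add: divide_less_eq mult.commute)
      ultimately show ?thesis using B B0 by (simp add: cut_def u_def)
    next
      case False
      then have "cut f a b s x y = 0" unfolding cut_def by (rule if_not_P)
      then show ?thesis using B0 by simp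
    qed
    have fin: "emeasure \<nu> {y. u < norm y} < \<infinity>" by (rule finite_away_norm(3)[OF is_norm_norm nu_fin u(1)])
    have i2: "integrable \<nu> (\<lambda>y. B * indicator {y. u < norm y} y)"
      using fin by (intro integrable_mult_right integrable_real_indicator) (auto simp: sets_nu)
    have "integrable \<nu> (cut f a b s x)"
      by (rule Bochner_Integration.integrable_bound[OF i2])
         (use pt cutm[of s x] in \<open>auto simp: measurable_cong_sets[OF sets_nu refl] intro: order_trans[OF _ abs_ge_self]\<close>)
    then have "\<bar>(LINT y|\<nu>. cut f a b s x y)\<bar> \<le> (LINT y|\<nu>. B * indicator {y. u < norm y} y)"
      using pt i2 by (intro order_trans[OF integral_abs_bound integral_mono]) auto
    also have "\<dots> = B * measure \<nu> {y. u < norm y}" using sets_eq_imp_space_eq[OF sets_nu] by simp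
    also have "\<dots> \<le> B * (C * pb (u / s) * V s)"
    proof (rule mult_left_mono[OF _ B0])
      have "ennreal (measure \<nu> {y. u < norm y}) \<le> ennreal (C * pb (u / s) * V s)"
        using C(3)[OF s u(2)] fin by (subst emeasure_eq_ennreal_measure[symmetric]) auto
      moreover have "0 \<le> C * pb (u / s) * V s"
        using C(1) V_pos[OF sp] by (auto intro!: mult_nonneg_nonneg simp: potter_bound_def le_max_iff_disj)
      ultimately show "measure \<nu> {y. u < norm y} \<le> C * pb (u / s) * V s" by (subst (asm) ennreal_le_iff)
    qed
    finally have "\<bar>(LINT y|\<nu>. cut f a b s x y)\<bar> \<le> B * (C * pb (u / s)) * V s" by (simp add: mult.assoc)
    then have 1: "\<bar>(LINT y|\<nu>. cut f a b s x y) / V s\<bar> \<le> B * (C * pb (u / s))"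
      using V_pos[OF sp] by (simp add: abs_divide divide_le_eq)
    have "a / norm x \<le> u / s" using sp nx by (auto simp: u_def field_simps le_max_iff_disj)
    then have "pb (u / s) \<le> pb (a / norm x)" using pq a0 nx unfolding p_def q_def by (intro potter_bound_antimono) auto
    also have "\<dots> \<le> a powr (- p) * norm x powr p + a powr (- q) * norm x powr q"
    proof -
      have "(a / norm x) powr (- t) = a powr (- t) * norm x powr t" for t
        by (simp add: powr_divide powr_minus_divide[of "norm x"])
      then show ?thesis unfolding potter_bound_def p_def[symmetric] q_def[symmetric] by simp
    qed
    finally have "B * (C * pb (u / s)) \<le> w x" unfolding w_def using B0 C(1) by (intro mult_left_mono) auto
    with 1 show ?thesis by linarith
  qed
  have "(\<lambda>n. (LINT x|\<rho>. (LINT y|\<nu>. cut f a b (Y n) x y) / V (Y n))) \<longlonglongrightarrow> (LINT x|\<rho>. (LINT y|L. f (diag_map x y)))"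
  proof (rule integral_dominated_convergence[where w=w])
    note [measurable_cong] = sL
    show "(\<lambda>x. (LINT y|L. f (diag_map x y))) \<in> borel_measurable \<rho>"
    proof (rule sigma_finite_measure.borel_measurable_lebesgue_integral[OF sf])
      show "(\<lambda>(x, y). f (diag_map x y)) \<in> borel_measurable (\<rho> \<Otimes>\<^sub>M L)"
        unfolding case_prod_beta' by measurable
    qed
    show "(\<lambda>x. (LINT y|\<nu>. cut f a b (Y n) x y) / V (Y n)) \<in> borel_measurable \<rho>" for n
    proof (intro borel_measurable_divide borel_measurable_const sigma_finite_measure.borel_measurable_lebesgue_integral[OF sigma_nu])
      show "(\<lambda>(x, y). cut f a b (Y n) x y) \<in> borel_measurable (\<rho> \<Otimes>\<^sub>M \<nu>)"
        unfolding case_prod_beta' using cut_measurable[OF fm] by measurable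
    qed
    show "integrable \<rho> w" by (rule wi)
    show "AE x in \<rho>. norm ((LINT y|\<nu>. cut f a b (Y n) x y) / V (Y n)) \<le> w x" for n
      using AE_nonzero_coordinates[OF sets_rho rho_coord]
    proof eventually_elim
      case (elim x)
      then have "x \<noteq> 0" by auto
      then show ?case using dom[OF Y(1)] by simp
    qed
    show "AE x in \<rho>. (\<lambda>n. (LINT y|\<nu>. cut f a b (Y n) x y) / V (Y n)) \<longlonglongrightarrow> (LINT y|L. f (diag_map x y))"
      using AE_nonzero_coordinates[OF sets_rho rho_coord]
    proof eventually_elim
      case (elim x)
      then have "x \<noteq> 0" by auto
      then have nx: "norm x > 0" by simp
      have "(\<lambda>n. E (X (n + n0)) (\<lambda>y. f (diag_map x y))) \<longlonglongrightarrow> (LINT y|L. f (diag_map x y))"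
        using LIMSEQ_ignore_initial_segment[OF conv[OF away_test_diag_map[OF f]]] .
      then have lim: "(\<lambda>n. E (Y n) (\<lambda>y. f (diag_map x y))) \<longlonglongrightarrow> (LINT y|L. f (diag_map x y))"
        by (simp add: Y_def)
      have "eventually (\<lambda>n. b * norm x / a \<le> Y n) sequentially" using Ylim by (simp only: filterlim_at_top)
      then have "eventually (\<lambda>n. E (Y n) (\<lambda>y. f (diag_map x y)) = (LINT y|\<nu>. cut f a b (Y n) x y) / V (Y n)) sequentially"
      proof eventually_elim
        case (elim n)
        have "f (diag_map x (inverse (Y n) *\<^sub>R y)) = cut f a b (Y n) x y" for y
        proof (cases "f (inverse (Y n) *\<^sub>R diag_map x y) = 0")
          case True
          then show ?thesis by (simp add: cut_def diag_map_scaleR)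
        next
          case False
          then have "r \<le> norm (inverse (Y n) *\<^sub>R diag_map x y)" using r(2) by (meson not_le)
          then obtain j where "a < \<bar>(inverse (Y n) *\<^sub>R diag_map x y) $ j\<bar>"
            using large_coordinate[OF r(1)] a by blast
          then have j: "a * Y n < \<bar>x $ j * y $ j\<bar>" using Y(2)[of n] by (simp add: diag_map_def abs_mult field_simps)
          have "\<bar>x $ j * y $ j\<bar> \<le> norm x * \<bar>y $ j\<bar>"
            unfolding abs_mult by (intro mult_right_mono component_le_norm_cart) auto
          moreover have "b * norm x \<le> a * Y n" using elim a0 by (simp add: divide_le_eq mult.commute)
          ultimately have "norm x * b < norm x * \<bar>y $ j\<bar>" using j by (simp add: mult.commute)
          then have "b < \<bar>y $ j\<bar>" using nx by simp
          with j show ?thesis by (auto simp: cut_def diag_map_scaleR)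
        qed
        then show ?case by (simp add: E_def)
      qed
      from Lim_transform_eventually[OF lim this] show ?case .
    qed
  qed
  then show ?thesis unfolding J by (simp add: Y_def LIMSEQ_offset[of _ n0])
qed

text \<open>A given e fixes \<open>b\<close> through the smallness hypothesis; then n tends to
  infinity, where V(a X_n)/V(X_n) tends to a^-\<alpha>; finally e tends to 0. The order of limits is
  harmless because the limit of the cut integrals is the same for every \<open>b\<close>.\<close>

lemma limit_equation:
  assumes X: "filterlim X at_top sequentially" and L: "tail_bounded L \<alpha>" "emeasure L {0} = 0"
    and conv: "\<And>f. f \<in> away_test \<Longrightarrow> (\<lambda>n. E (X n) f) \<longlonglongrightarrow> integral\<^sup>L L f"
  shows "L \<circledast> \<rho> = \<mu>"
proof (rule measure_eqI_away_test)
  show "finite_away (L \<circledast> \<rho>)" by (rule tail_bounded_finite_away[OF tail_bounded_mult_conv(1)[OF L]])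
  show "finite_away \<mu>" "emeasure \<mu> {0} = 0" by (rule mu_fin mu_0)+
  show "emeasure (L \<circledast> \<rho>) {0} = 0" by (rule tail_bounded_mult_conv(2)[OF L])
  fix f :: "real^'n \<Rightarrow> real" assume f: "f \<in> away_test"
  obtain B r where B: "B > 0" "\<And>x. \<bar>f x\<bar> \<le> B" and r: "r > 0" "\<And>x. norm x < r \<Longrightarrow> f x = 0"
    using away_testE[OF f] by metis
  define a where "a = r / (2 * real CARD('n))"
  have a0: "a > 0" using r(1) by (simp add: a_def)
  define J where "J = integral\<^sup>L (L \<circledast> \<rho>) f"
  define K where "K = real CARD('n) * B * a powr (- \<alpha>)"
  have K: "K > 0" using B(1) a0 by (simp add: K_def)
  have lim1: "(\<lambda>n. (LINT z|(\<nu> \<circledast> \<rho>). f (inverse (X n) *\<^sub>R z)) / V (X n)) \<longlonglongrightarrow> integral\<^sup>L \<mu> f"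
    using conv_scaled f X unfolding scaled_conv_def V_def[symmetric] by (auto intro: filterlim_compose)
  have bound: "\<bar>integral\<^sup>L \<mu> f - J\<bar> \<le> K * e" if e: "e > 0" for e
  proof -
    obtain b where b: "b > 0" and sm: "\<forall>\<^sub>F s in at_top. \<forall>j.
      (\<integral>\<^sup>+ y \<in> {y. 0 < \<bar>y $ j\<bar> \<and> \<bar>y $ j\<bar> \<le> b}. emeasure \<rho> {x. \<bar>x $ j\<bar> > s / \<bar>y $ j\<bar>} \<partial>\<nu>) \<le> ennreal (e * V s)"
      using small_eventually[OF e] by blast
    define F where "F n = (LINT x|\<rho>. (LINT y|\<nu>. cut f a b (X n) x y) / V (X n))" for n
    have limF: "F \<longlonglongrightarrow> J" unfolding F_def[abs_def] J_def by (rule cut_limit[OF X L conv f B(2) r a_def b])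
    have "filterlim (\<lambda>n. a * X n) at_top sequentially"
      by (rule filterlim_tendsto_pos_mult_at_top[OF tendsto_const a0 X])
    from filterlim_iff[THEN iffD1, OF this, rule_format, OF sm]
    have "eventually (\<lambda>n. \<bar>(LINT z|(\<nu> \<circledast> \<rho>). f (inverse (X n) *\<^sub>R z)) / V (X n) - F n\<bar>
        \<le> real CARD('n) * B * e * (V (a * X n) / V (X n))) sequentially"
      using filterlim_at_top_dense[THEN iffD1, OF X, rule_format, of 0]
    proof eventually_elim
      case (elim n)
      show ?case unfolding F_def by (rule cut_error[OF f B(2) r a_def elim(2) e]) (use elim(1) in auto)
    qed
    moreover have "(\<lambda>n. \<bar>(LINT z|(\<nu> \<circledast> \<rho>). f (inverse (X n) *\<^sub>R z)) / V (X n) - F n\<bar>) \<longlonglongrightarrow> \<bar>integral\<^sup>L \<mu> f - J\<bar>"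
      by (intro tendsto_intros lim1 limF)
    moreover have "(\<lambda>n. real CARD('n) * B * e * (V (a * X n) / V (X n))) \<longlonglongrightarrow> real CARD('n) * B * e * a powr (- \<alpha>)"
      by (intro tendsto_mult_left filterlim_compose[OF V_lim[OF a0] X])
    ultimately have "\<bar>integral\<^sup>L \<mu> f - J\<bar> \<le> real CARD('n) * B * e * a powr (- \<alpha>)"
      by (intro tendsto_le[OF sequentially_bot]) auto
    then show ?thesis by (simp add: K_def mult_ac)
  qed
  have "\<bar>integral\<^sup>L \<mu> f - J\<bar> \<le> 0 + e" if "e > 0" for e
    using bound[of "e / K"] that K by simp
  then have "\<bar>integral\<^sup>L \<mu> f - J\<bar> \<le> 0" by (rule field_le_epsilon)
  then show "integral\<^sup>L (L \<circledast> \<rho>) f = integral\<^sup>L \<mu> f" by (simp add: J_def)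
qed

lemma scaled_conv_nu:
  obtains L where "tail_bounded L \<alpha>" "emeasure L {0} = 0" "L \<circledast> \<rho> = \<mu>" "scaled_conv \<nu> V L"
proof -
  have R: "filterlim real at_top sequentially" by (rule filterlim_real_sequentially)
  obtain r L where r: "strict_mono (r :: nat \<Rightarrow> nat)" and L: "tail_bounded L \<alpha>" "emeasure L {0} = 0"
    "\<And>f. f \<in> away_test \<Longrightarrow> (\<lambda>n. E (real (r n)) f) \<longlonglongrightarrow> integral\<^sup>L L f"
    using subsequence_limit[OF R] by metis
  have eqL: "L \<circledast> \<rho> = \<mu>"
    by (rule limit_equation[OF filterlim_compose[OF R filterlim_subseq[OF r]] L(1,2)]) (rule L(3))
  have "((\<lambda>s. E s f) \<longlongrightarrow> integral\<^sup>L L f) at_top" if f: "f \<in> away_test" for f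
  proof (rule tendsto_at_topI_sequentially)
    fix X :: "nat \<Rightarrow> real" assume X: "filterlim X at_top sequentially"
    show "(\<lambda>n. E (X n) f) \<longlonglongrightarrow> integral\<^sup>L L f"
    proof (rule ccontr)
      assume "\<not> ?thesis"
      then obtain e where e: "e > 0" "\<not> eventually (\<lambda>n. dist (E (X n) f) (integral\<^sup>L L f) < e) sequentially"
        unfolding tendsto_iff by blast
      then obtain k where k: "strict_mono (k :: nat \<Rightarrow> nat)" "\<And>n. \<not> dist (E (X (k n)) f) (integral\<^sup>L L f) < e"
        using not_eventually_sequentiallyD by blast
      have Xk: "filterlim (\<lambda>n. X (k n)) at_top sequentially" by (rule filterlim_compose[OF X filterlim_subseq[OF k(1)]])
      obtain r' L' where r': "strict_mono (r' :: nat \<Rightarrow> nat)" and L': "tail_bounded L' \<alpha>" "emeasure L' {0} = 0"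
        "\<And>f. f \<in> away_test \<Longrightarrow> (\<lambda>n. E (X (k (r' n))) f) \<longlonglongrightarrow> integral\<^sup>L L' f"
        using subsequence_limit[OF Xk] by metis
      have "L' \<circledast> \<rho> = \<mu>"
        by (rule limit_equation[OF filterlim_compose[OF Xk filterlim_subseq[OF r']] L'(1,2)]) (rule L'(3))
      then have "L' = L"
        using mult_conv_cancel[OF L'(1,2) L(1,2)] eqL tail_bounded_mult_conv(1)[OF L'(1,2)] by simp
      then have "(\<lambda>n. E (X (k (r' n))) f) \<longlonglongrightarrow> integral\<^sup>L L f" using L'(3)[OF f] by simp
      then have "eventually (\<lambda>n. dist (E (X (k (r' n))) f) (integral\<^sup>L L f) < e) sequentially"
        using e(1) by (rule tendstoD)
      then show False using k(2) by (auto simp: eventually_sequentially)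
    qed
  qed
  then have "scaled_conv \<nu> V L" by (simp add: scaled_conv_def E_def)
  with L(1,2) eqL show ?thesis by (rule that)
qed

text \<open>The integral of f(y/(t s)) can be normalised by V(t s) or by V(s). The quotient of the
  normalisations tends to t^-\<alpha>, so the two limits differ by this factor.\<close>

lemma limit_homogeneous:
  assumes L: "tail_bounded L \<alpha>" "emeasure L {0} = 0" "scaled_conv \<nu> V L" and t: "t > 0" and A: "A \<in> sets borel"
  shows "emeasure L ((\<lambda>y. inverse t *\<^sub>R y) -` A) = ennreal (t powr (- \<alpha>)) * emeasure L A"
proof -
  have sL: "sets L = sets borel" using L by (simp add: tail_bounded_def)
  note [measurable_cong] = sL
  have fin: "finite_away L" by (rule tail_bounded_finite_away[OF L(1)])
  have spL: "space L = UNIV" using sets_eq_imp_space_eq[OF sL] by simp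
  define D where "D = distr L borel (\<lambda>y. inverse t *\<^sub>R y)"
  define D' where "D' = density L (\<lambda>_. ennreal (t powr (- \<alpha>)))"
  have emD: "emeasure D B = emeasure L ((\<lambda>y. inverse t *\<^sub>R y) -` B)" if "B \<in> sets borel" for B
    unfolding D_def using that by (subst emeasure_distr) (auto simp: spL)
  have emD': "emeasure D' B = ennreal (t powr (- \<alpha>)) * emeasure L B" if "B \<in> sets borel" for B
    unfolding D'_def using that by (subst emeasure_density) (auto simp: sL nn_integral_cmult_indicator)
  have "D = D'"
  proof (rule measure_eqI_away_test)
    show "finite_away D"
      unfolding finite_away_def
    proof (intro conjI allI impI)
      fix r :: real assume "r > 0"
      have "(\<lambda>y::real^'n. inverse t *\<^sub>R y) -` {x. r \<le> norm x} = {x. r * t \<le> norm x}" using t by (auto simp: field_simps)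
      moreover have "{x::real^'n. r \<le> norm x} \<in> sets borel" by measurable
      moreover have "emeasure L {x. r * t \<le> norm x} < \<infinity>" using fin t \<open>r > 0\<close> by (simp add: finite_away_def)
      ultimately show "emeasure D {x. r \<le> norm x} < \<infinity>" by (simp only: emD)
    qed (simp add: D_def)
    show "finite_away D'"
      unfolding finite_away_def
    proof (intro conjI allI impI)
      fix r :: real assume "r > 0"
      have "emeasure L {x. r \<le> norm x} < \<infinity>" using fin \<open>r > 0\<close> by (simp add: finite_away_def)
      then show "emeasure D' {x. r \<le> norm x} < \<infinity>" by (subst emD') (auto simp: ennreal_mult_less_top)
    qed (simp add: D'_def sL)
    have "(\<lambda>y::real^'n. inverse t *\<^sub>R y) -` {0} = {0}" using t by auto
    then show "emeasure D {0} = 0" using L(2) by (subst emD) auto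
    show "emeasure D' {0} = 0" using L(2) by (subst emD') auto
    fix f :: "real^'n \<Rightarrow> real" assume f: "f \<in> away_test"
    have fm[measurable]: "f \<in> borel_measurable borel" using away_testE[OF f] by metis
    have conv: "((\<lambda>s. E s g) \<longlongrightarrow> integral\<^sup>L L g) at_top" if "g \<in> away_test" for g
      using L(3) that by (simp add: scaled_conv_def E_def)
    have ts: "filterlim (\<lambda>s. t * s) at_top at_top"
      by (rule filterlim_tendsto_pos_mult_at_top[OF tendsto_const t filterlim_ident])
    have "((\<lambda>s. E (t * s) f * (V (t * s) / V s)) \<longlongrightarrow> integral\<^sup>L L f * t powr (- \<alpha>)) at_top"
      by (intro tendsto_mult filterlim_compose[OF conv[OF f] ts] V_lim t)
    moreover have "eventually (\<lambda>s. E (t * s) f * (V (t * s) / V s) = E s (\<lambda>y. f (inverse t *\<^sub>R y))) at_top"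
      using eventually_gt_at_top[of 0]
    proof eventually_elim
      case (elim s)
      then show ?case using V_pos[of "t * s"] t by (simp add: E_def mult.commute)
    qed
    ultimately have "((\<lambda>s. E s (\<lambda>y. f (inverse t *\<^sub>R y))) \<longlongrightarrow> integral\<^sup>L L f * t powr (- \<alpha>)) at_top"
      by (rule Lim_transform_eventually)
    then have "(LINT y|L. f (inverse t *\<^sub>R y)) = integral\<^sup>L L f * t powr (- \<alpha>)"
      using conv[OF away_test_scale[OF f t]] tendsto_unique trivial_limit_at_top_linorder by blast
    moreover have "integral\<^sup>L D f = (LINT y|L. f (inverse t *\<^sub>R y))" unfolding D_def by (subst integral_distr) auto
    moreover have "integral\<^sup>L D' f = integral\<^sup>L L f * t powr (- \<alpha>)"
      unfolding D'_def by (subst integral_real_density) auto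
    ultimately show "integral\<^sup>L D f = integral\<^sup>L D' f" by simp
  qed
  then show ?thesis using emD[OF A] emD'[OF A] by simp
qed

end

subsection \<open>The compactified space\<close>

lemma continuous_on_vec_nth_ext: "continuous_on S (\<lambda>z::'a::topological_space^'n. z $ i)"
  unfolding continuous_on_def by (auto intro!: tendsto_vec_nth tendsto_ident_at)

lemma continuous_on_ext: "continuous_on S ext"
  unfolding ext_def[abs_def] continuous_on_def
  by (auto intro!: tendsto_vec_lambda tendsto_vec_nth tendsto_ident_at)

text \<open>Tychonoff's theorem for functions on the index set, carried over by the continuous
  surjection onto vectors.\<close>

lemma compact_UNIV_ereal_vec: "compact (UNIV :: (ereal^'n) set)"
proof -
  have "compactin (product_topology (\<lambda>_::'n. euclidean :: ereal topology) UNIV) (PiE UNIV (\<lambda>_. UNIV))"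
    by (subst compactin_PiE) (simp add: compact_UNIV)
  then have c: "compact (UNIV :: ('n \<Rightarrow> ereal) set)"
    unfolding euclidean_product_topology by (simp add: PiE_UNIV_domain)
  have "continuous_on UNIV (\<lambda>f::'n \<Rightarrow> ereal. (\<chi> i. f i))"
    unfolding continuous_on_def
    by (auto intro!: tendsto_vec_lambda continuous_on_product_coordinates[unfolded continuous_on_def, rule_format])
  from compact_continuous_image[OF this c] have "compact (range (\<lambda>f::'n \<Rightarrow> ereal. (\<chi> i. f i)))" .
  moreover have "range (\<lambda>f::'n \<Rightarrow> ereal. (\<chi> i. f i)) = UNIV"
    by (metis surjI vec_lambda_eta)
  ultimately show ?thesis by simp
qed

text \<open>A left inverse of \<open>ext\<close>. Infinite coordinates go to 0 by the convention of
  \<open>real_of_ereal\<close>, so values at infinite points carry no information and such points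
  have to be treated separately.\<close>

definition fin_vec :: "ereal^'n \<Rightarrow> real^'n" where
  "fin_vec z = (\<chi> i. real_of_ereal (z $ i))"

lemma fin_vec_ext[simp]: "fin_vec (ext y) = y"
  by (simp add: fin_vec_def ext_def vec_eq_iff)

lemma ext_fin_vec: "z \<notin> infinite_points \<Longrightarrow> ext (fin_vec z) = z"
  by (simp add: fin_vec_def ext_def vec_eq_iff infinite_points_def ereal_real)

lemma ext_not_infinite[simp]: "ext y \<notin> infinite_points"
  by (simp add: ext_def infinite_points_def)

lemma ext_eq_0_iff[simp]: "ext y = 0 \<longleftrightarrow> y = 0"
  by (auto simp: ext_def vec_eq_iff zero_ereal_def)

lemma fin_vec_eq_0: "z \<notin> infinite_points \<Longrightarrow> fin_vec z = 0 \<longleftrightarrow> z = 0"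
  using ext_fin_vec[of z] ext_eq_0_iff[of "fin_vec z"] by auto

lemma ext_image: "ext ` B = {z. z \<notin> infinite_points \<and> fin_vec z \<in> B}"
  by (auto simp: image_iff) (metis ext_fin_vec)

lemma ext_0[simp]: "ext 0 = 0"
  by simp

lemma fin_vec_0[simp]: "fin_vec 0 = 0"
  using fin_vec_ext[of 0] by simp

lemma infinite_pointsE:
  assumes "z \<in> infinite_points" obtains i where "\<bar>z $ i\<bar> = \<infinity>"
  using assms unfolding infinite_points_def mem_Collect_eq by (rule exE) (rule that)

lemma ereal_less_abs_iff: "0 < R \<Longrightarrow> ereal R < \<bar>x\<bar> \<longleftrightarrow> x \<in> {ereal R<..} \<union> {..<- ereal R}"
  by (cases x) auto

lemma ereal_le_abs_iff: "0 < R \<Longrightarrow> ereal R \<le> \<bar>x\<bar> \<longleftrightarrow> x \<in> {ereal R..} \<union> {..- ereal R}"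
  by (cases x) auto

lemma open_ereal_large: assumes "0 < R" shows "open {z::ereal^'n. \<exists>i. ereal R < \<bar>z $ i\<bar>}"
proof -
  have "{z::ereal^'n. \<exists>i. ereal R < \<bar>z $ i\<bar>} = (\<Union>i. (\<lambda>z. z $ i) -` ({ereal R<..} \<union> {..<- ereal R}))"
    unfolding ereal_less_abs_iff[OF assms] by blast
  then show ?thesis by (auto intro!: open_UN open_vimage_vec_nth)
qed

lemma closed_ereal_large: assumes "0 < R" shows "closed {z::ereal^'n. \<exists>i. ereal R \<le> \<bar>z $ i\<bar>}"
proof -
  have "{z::ereal^'n. \<exists>i. ereal R \<le> \<bar>z $ i\<bar>} = (\<Union>i. (\<lambda>z. z $ i) -` ({ereal R..} \<union> {..- ereal R}))"
    unfolding ereal_le_abs_iff[OF assms] by blast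
  then show ?thesis by (auto intro!: closed_UN closed_vimage_vec_nth)
qed

lemma ext_measurable[measurable]: "ext \<in> borel \<rightarrow>\<^sub>M borel"
  by (intro borel_measurable_continuous_onI continuous_on_ext)

lemma ereal_vec_nth_measurable[measurable]: "(\<lambda>z::ereal^'n. z $ i) \<in> borel \<rightarrow>\<^sub>M borel"
  by (intro borel_measurable_continuous_onI continuous_on_vec_nth_ext)

lemma fin_vec_measurable[measurable]: "fin_vec \<in> borel \<rightarrow>\<^sub>M borel"
  unfolding fin_vec_def[abs_def] by measurable

lemma infinite_points_measurable[measurable]: "infinite_points \<in> sets borel"
  unfolding infinite_points_def by measurable

lemma open_finite_points: "open (- infinite_points :: (ereal^'n) set)"
proof -
  have "{x::ereal. \<bar>x\<bar> \<noteq> \<infinity>} = {-\<infinity><..<\<infinity>}" by auto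
  then have o: "open {x::ereal. \<bar>x\<bar> \<noteq> \<infinity>}" by simp
  have "- infinite_points = (\<Inter>i. (\<lambda>z::ereal^'n. z $ i) -` {x. \<bar>x\<bar> \<noteq> \<infinity>})"
    by (simp add: infinite_points_def set_eq_iff)
  also have "open \<dots>" by (rule open_INT[OF finite]) (intro ballI open_vimage_vec_nth[OF o])
  finally show ?thesis .
qed

lemma continuous_on_fin_vec: "continuous_on (- infinite_points) fin_vec"
  unfolding continuous_on_def fin_vec_def[abs_def]
proof (intro ballI tendsto_vec_lambda)
  fix z :: "ereal^'n" and i assume "z \<in> - infinite_points"
  then have "isCont real_of_ereal (z $ i)" by (intro continuous_at_of_ereal) (auto simp: infinite_points_def)
  then show "((\<lambda>z. real_of_ereal (z $ i)) \<longlongrightarrow> real_of_ereal (z $ i)) (at z within - infinite_points)"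
    by (rule isCont_tendsto_compose) (intro tendsto_vec_nth tendsto_ident_at)
qed

lemma nonzero_sets: "- {0::ereal^'n} \<in> sets borel"
proof -
  have "- {0::ereal^'n} = (\<Union>i. {z \<in> space borel. z $ i \<noteq> 0})" by (auto simp: vec_eq_iff)
  also have "\<dots> \<in> sets borel" by measurable
  finally show ?thesis .
qed

lemma sets_ext_space: "A \<in> sets ext_space \<longleftrightarrow> A \<in> sets borel \<and> 0 \<notin> A"
  unfolding ext_space_def using nonzero_sets by (subst sets_restrict_space_iff) auto

lemma space_ext_space[simp]: "space ext_space = - {0}"
  by (simp add: ext_space_def space_restrict_space)

text \<open>A function constant near infinity extends by this constant, continuously, to the
  infinite points. The closure of its nonzero set is closed in a compact space and misses a
  neighbourhood of the origin, so it is compact and removing the origin changes nothing.\<close>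

lemma Cc_extI:
  fixes f :: "real^'n \<Rightarrow> real"
  assumes f: "continuous_on UNIV f" and r: "r > 0" "\<And>y. norm y < r \<Longrightarrow> f y = 0"
    and c: "R > 0" "\<And>y. R < norm y \<Longrightarrow> f y = c"
  shows "(\<lambda>z. if z \<in> infinite_points then c else f (fin_vec z)) \<in> Cc_ext"
proof -
  define F where "F z = (if z \<in> infinite_points then c else f (fin_vec z))" for z
  \<comment> \<open>An open neighbourhood of all infinite points on which the extension is constant;
    it is glued with the open set of finite points.\<close>
  define W where "W = {z::ereal^'n. \<exists>i. ereal R < \<bar>z $ i\<bar>}"
  have W: "open W" unfolding W_def by (rule open_ereal_large[OF c(1)])
  have FW: "F z = c" if zW: "z \<in> W" for z
  proof (cases "z \<in> infinite_points")
    case False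
    obtain i where i: "ereal R < \<bar>z $ i\<bar>" using zW unfolding W_def by blast
    have "z $ i = ereal (fin_vec z $ i)" using False by (auto simp: fin_vec_def infinite_points_def ereal_real)
    then have "R < \<bar>fin_vec z $ i\<bar>" using i by simp
    then have "R < norm (fin_vec z)" using component_le_norm_cart[of "fin_vec z" i] by linarith
    then show ?thesis using False c(2) by (simp add: F_def)
  qed (simp add: F_def)
  have "z \<in> W" if zi: "z \<in> infinite_points" for z
  proof -
    obtain i where "\<bar>z $ i\<bar> = \<infinity>" using zi by (rule infinite_pointsE)
    then have "ereal R < \<bar>z $ i\<bar>" by (simp only: less_ereal.simps)
    then show ?thesis unfolding W_def mem_Collect_eq by (rule exI)
  qed
  then have U: "UNIV = - infinite_points \<union> W" by blast
  have "continuous_on UNIV F"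
    unfolding U
  proof (rule continuous_on_open_Un[OF open_finite_points W])
    show "continuous_on (- infinite_points) F"
      by (rule continuous_on_eq[OF continuous_on_compose2[OF f continuous_on_fin_vec]]) (auto simp: F_def)
    show "continuous_on W F" by (rule continuous_on_eq[of _ "\<lambda>_. c"]) (auto simp: FW)
  qed
  then have cont: "continuous_on (- {0}) F" by (rule continuous_on_subset) simp
  define a where "a = r / (2 * real CARD('n))"
  have a: "a > 0" using r(1) by (simp add: a_def)
  define C where "C = {z::ereal^'n. \<exists>i. ereal a \<le> \<bar>z $ i\<bar>}"
  have C: "closed C" unfolding C_def by (rule closed_ereal_large[OF a])
  have "{z. z \<noteq> 0 \<and> F z \<noteq> 0} \<subseteq> C"
  proof
    fix z assume z: "z \<in> {z. z \<noteq> 0 \<and> F z \<noteq> 0}"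
    show "z \<in> C"
    proof (cases "z \<in> infinite_points")
      case True
      then obtain i where "\<bar>z $ i\<bar> = \<infinity>" by (rule infinite_pointsE)
      then have "ereal a \<le> \<bar>z $ i\<bar>" by (simp only: ereal_less_eq)
      then show ?thesis unfolding C_def mem_Collect_eq by (rule exI)
    next
      case False
      then have "r \<le> norm (fin_vec z)" using z r(2)[of "fin_vec z"] by (auto simp: F_def not_le[symmetric])
      then have "\<exists>j. a < \<bar>fin_vec z $ j\<bar>" unfolding a_def by (rule large_coordinate[OF r(1)])
      then obtain j where j: "a < \<bar>fin_vec z $ j\<bar>" by blast
      have "z $ j = ereal (fin_vec z $ j)" using False by (auto simp: fin_vec_def infinite_points_def ereal_real)
      then show ?thesis using j by (auto simp: C_def intro!: exI[of _ j])
    qed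
  qed
  then have cl: "closure {z. z \<noteq> 0 \<and> F z \<noteq> 0} \<subseteq> C" using C by (rule closure_minimal)
  have "0 \<notin> C" using a by (auto simp: C_def)
  then have "closure {z. z \<noteq> 0 \<and> F z \<noteq> 0} - {0} = closure {z. z \<noteq> 0 \<and> F z \<noteq> 0}" using cl by blast
  moreover have "compact (closure {z. z \<noteq> 0 \<and> F z \<noteq> 0})"
    using compact_Int_closed[OF compact_UNIV_ereal_vec closed_closure] by simp
  ultimately have "F \<in> Cc_ext" using cont by (simp add: Cc_ext_def)
  then show ?thesis by (simp add: F_def[abs_def])
qed

text \<open>A compact subset of the punctured space stays away from the origin, because finitely
  many of the nested open sets \<open>W n\<close> cover it; this yields the radius. Boundedness
  comes from the same compactness.\<close>

lemma Cc_ext_away_test: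
  fixes f :: "ereal^'n \<Rightarrow> real"
  assumes f: "f \<in> Cc_ext"
  shows "(\<lambda>y. if y = 0 then 0 else f (ext y)) \<in> away_test"
proof -
  define K where "K = closure {z. z \<noteq> 0 \<and> f z \<noteq> 0} - {0}"
  have K: "compact K" and fc: "continuous_on (- {0}) f" using f by (auto simp: Cc_ext_def K_def)
  have fK: "f z = 0" if "z \<noteq> 0" "z \<notin> K" for z
    using that closure_subset[of "{z. z \<noteq> 0 \<and> f z \<noteq> 0}"] by (auto simp: K_def)
  define W where "W n = {z::ereal^'n. \<exists>i. ereal (1 / real (Suc n)) < \<bar>z $ i\<bar>}" for n
  have Wo: "open (W n)" for n unfolding W_def by (rule open_ereal_large) simp
  have "K \<subseteq> (\<Union>n\<in>UNIV. W n)"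
  proof
    fix z assume "z \<in> K"
    then have "z \<noteq> 0" by (auto simp: K_def)
    then obtain i where "z $ i \<noteq> 0" by (auto simp: vec_eq_iff)
    then have "0 < \<bar>z $ i\<bar>" by (cases "z $ i") auto
    then obtain e where e: "0 < e" "ereal e < \<bar>z $ i\<bar>" using ereal_dense2[of 0 "\<bar>z $ i\<bar>"] by (auto simp: zero_ereal_def)
    obtain n where "1 / real (Suc n) < e" using nat_approx_posE[OF e(1)] by blast
    then have "ereal (1 / real (Suc n)) < \<bar>z $ i\<bar>" using e(2) by (meson less_ereal.simps(1) less_trans)
    then show "z \<in> (\<Union>n\<in>UNIV. W n)" by (auto simp: W_def)
  qed
  then obtain D where D: "finite D" "K \<subseteq> (\<Union>n\<in>D. W n)"
    using compactE_image[OF K, of UNIV W] Wo by auto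
  define m where "m = Max (insert 0 D)"
  have "W n \<subseteq> W m" if "n \<in> D" for n
  proof -
    have "n \<le> m" unfolding m_def using D(1) that by auto
    then have "ereal (1 / real (Suc m)) \<le> ereal (1 / real (Suc n))" by (simp add: frac_le)
    then show ?thesis unfolding W_def using le_less_trans by blast
  qed
  then have Km: "K \<subseteq> W m" using D(2) by blast
  define r where "r = 1 / real (Suc m)"
  have r: "r > 0" by (simp add: r_def)
  have small: "f (ext y) = 0" if "y \<noteq> 0" "norm y < r" for y
  proof (rule fK)
    show "ext y \<notin> K"
    proof
      assume "ext y \<in> K"
      then obtain i where "ereal r < \<bar>ext y $ i\<bar>" using Km by (auto simp: W_def r_def)
      then have "r < \<bar>y $ i\<bar>" by (simp add: ext_def)
      then show False using component_le_norm_cart[of y i] that(2) by linarith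
    qed
  qed (use that in simp)
  have "continuous_on K f" using fc by (rule continuous_on_subset) (auto simp: K_def)
  then have "bounded (f ` K)" using compact_continuous_image[OF _ K] compact_imp_bounded by blast
  then obtain B where B: "\<And>z. z \<in> K \<Longrightarrow> \<bar>f z\<bar> \<le> B" by (auto simp: bounded_iff)
  define g where "g y = (if y = 0 then 0 else f (ext y))" for y
  have gb: "\<bar>g y\<bar> \<le> max 0 B" for y
  proof (cases "y = 0 \<or> ext y \<notin> K")
    case True
    then show ?thesis using fK[of "ext y"] by (auto simp: g_def)
  next
    case False
    then show ?thesis using B[of "ext y"] by (auto simp: g_def)
  qed
  have g0: "g y = 0" if "norm y < r" for y using small[OF _ that] by (simp add: g_def)
  have "continuous_on ((- {0}) \<union> ball 0 r) g"
  proof (rule continuous_on_open_Un)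
    have "continuous_on (- {0}) (\<lambda>y. f (ext y))"
      by (rule continuous_on_compose2[OF fc continuous_on_ext]) auto
    then show "continuous_on (- {0}) g" by (rule continuous_on_eq) (auto simp: g_def)
    show "continuous_on (ball 0 r) g" by (rule continuous_on_eq[of _ "\<lambda>_. 0"]) (auto simp: g0)
  qed auto
  moreover have "(- {0::real^'n}) \<union> ball 0 r = UNIV" using r by auto
  ultimately have "continuous_on UNIV g" by simp
  then have "g \<in> away_test" unfolding away_test_def mem_Collect_eq using gb g0 r
    by (intro conjI boundedI[of _ "max 0 B"] exI[of _ r]) auto
  then show ?thesis by (simp add: g_def[abs_def])
qed

lemma Cc_ext_measurable:
  assumes "f \<in> Cc_ext" shows "f \<in> borel_measurable ext_space"
  using assms unfolding Cc_ext_def ext_space_def by (auto intro: borel_measurable_continuous_on_restrict)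

lemma ext_measurable_restrict:
  assumes "sets D = sets borel"
  shows "ext \<in> restrict_space D (- {0}) \<rightarrow>\<^sub>M ext_space"
  unfolding ext_space_def
proof (rule measurable_restrict_space2)
  show "ext \<in> space (restrict_space D (- {0})) \<rightarrow> - {0}" by (auto simp: space_restrict_space)
  have "ext \<in> D \<rightarrow>\<^sub>M borel" using ext_measurable measurable_cong_sets[OF assms refl] by blast
  then show "ext \<in> restrict_space D (- {0}) \<rightarrow>\<^sub>M borel" by (rule measurable_restrict_space1)
qed

lemma emeasure_to_ext:
  assumes s: "sets D = sets borel" and A: "A \<in> sets ext_space"
  shows "emeasure (to_ext D) A = emeasure D {y. ext y \<in> A}"
proof -
  have sp: "space D = UNIV" using sets_eq_imp_space_eq[OF s] by simp
  have A': "A \<in> sets borel" "0 \<notin> A" using A by (auto simp: sets_ext_space)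
  have "emeasure (to_ext D) A = emeasure (restrict_space D (- {0})) (ext -` A \<inter> space (restrict_space D (- {0})))"
    unfolding to_ext_def by (rule emeasure_distr[OF ext_measurable_restrict[OF s] A])
  also have "ext -` A \<inter> space (restrict_space D (- {0})) = {y. ext y \<in> A}"
    using A'(2) by (auto simp: space_restrict_space sp)
  also have "emeasure (restrict_space D (- {0})) {y. ext y \<in> A} = emeasure D {y. ext y \<in> A}"
    using A'(2) by (intro emeasure_restrict_space) (auto simp: s sp)
  finally show ?thesis .
qed

lemma sets_to_ext[simp]: "sets (to_ext D) = sets ext_space"
  by (simp add: to_ext_def)

lemma integral_to_ext:
  fixes f :: "ereal^'n \<Rightarrow> real"
  assumes s: "sets D = sets borel" and f: "f \<in> Cc_ext"
  shows "integral\<^sup>L (to_ext D) f = (LINT y|D. (if y = 0 then 0 else f (ext y)))"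
proof -
  have sp: "space D = UNIV" using sets_eq_imp_space_eq[OF s] by simp
  have "integral\<^sup>L (to_ext D) f = integral\<^sup>L (restrict_space D (- {0})) (\<lambda>y. f (ext y))"
    unfolding to_ext_def by (rule integral_distr[OF ext_measurable_restrict[OF s] Cc_ext_measurable[OF f]])
  also have "\<dots> = (LINT y|D. indicator (- {0}) y *\<^sub>R f (ext y))"
    by (rule integral_restrict_space) (simp add: s sp)
  also have "\<dots> = (LINT y|D. (if y = 0 then 0 else f (ext y)))"
    by (rule Bochner_Integration.integral_cong) auto
  finally show ?thesis .
qed

lemma scale_measure_eq_density: "scale_measure c M = density M (\<lambda>_. c)"
proof (rule measure_eqI)
  fix A assume "A \<in> sets (scale_measure c M)"
  then show "emeasure (scale_measure c M) A = emeasure (density M (\<lambda>_. c)) A"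
    by (subst emeasure_density) (auto simp: nn_integral_cmult_indicator)
qed simp

lemma integral_rescaled:
  fixes f :: "ereal^'n \<Rightarrow> real"
  assumes s: "sets M = sets borel" and f: "f \<in> Cc_ext" and c: "c > 0"
  shows "integral\<^sup>L (rescaled M (ennreal c) t) f = (LINT y|M. (if inverse t *\<^sub>R y = 0 then 0 else f (ext (inverse t *\<^sub>R y)))) / c"
proof -
  note [measurable_cong] = s
  obtain B r where gm: "(\<lambda>y. if y = 0 then 0 else f (ext y)) \<in> borel_measurable borel"
    using away_testE[OF Cc_ext_away_test[OF f]] by metis
  have fm: "f \<in> borel_measurable (to_ext (dilate t M))"
    using Cc_ext_measurable[OF f] measurable_cong_sets[OF sets_to_ext refl] by blast
  have "integral\<^sup>L (rescaled M (ennreal c) t) f = integral\<^sup>L (density (to_ext (dilate t M)) (\<lambda>_. ennreal (1 / c))) f"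
    using c by (simp add: rescaled_def scale_measure_eq_density inverse_ennreal inverse_eq_divide)
  also have "\<dots> = integral\<^sup>L (to_ext (dilate t M)) (\<lambda>y. 1 / c * f y)"
    using c fm by (subst integral_real_density) auto
  also have "\<dots> = integral\<^sup>L (to_ext (dilate t M)) f / c" by simp
  also have "integral\<^sup>L (to_ext (dilate t M)) f = (LINT y|dilate t M. (if y = 0 then 0 else f (ext y)))"
    by (rule integral_to_ext[OF _ f]) (simp add: dilate_def)
  also have "\<dots> = (LINT y|M. (if inverse t *\<^sub>R y = 0 then 0 else f (ext (inverse t *\<^sub>R y))))"
    unfolding dilate_def by (rule integral_distr[OF _ gm]) measurable
  finally show ?thesis .
qed

lemma ball_image_measurable:
  fixes N :: "real^'n \<Rightarrow> real"
  assumes N: "is_norm N"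
  shows "- {0} - ext ` {x. N x < r} \<in> sets ext_space"
proof -
  have [measurable]: "N \<in> borel_measurable borel"
    by (intro borel_measurable_continuous_onI is_norm_continuous[OF N])
  note nonzero_sets
  moreover have "ext ` {x. N x < r} \<in> sets borel"
  proof -
    have "{z. z \<notin> infinite_points \<and> fin_vec z \<in> {x. N x < r}} = (- infinite_points) \<inter> {z \<in> space borel. N (fin_vec z) < r}" by auto
    also have "\<dots> \<in> sets borel" by measurable
    finally show ?thesis unfolding ext_image .
  qed
  ultimately have "- {0} - ext ` {x. N x < r} \<in> sets borel" by auto
  then show ?thesis by (simp add: sets_ext_space)
qed

lemma from_ext_measurable:
  assumes "sets L = sets ext_space"
  shows "fin_vec \<in> restrict_space L (- infinite_points) \<rightarrow>\<^sub>M borel"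
proof -
  have "fin_vec \<in> ext_space \<rightarrow>\<^sub>M borel"
    unfolding ext_space_def by (intro measurable_restrict_space1 fin_vec_measurable)
  then have "fin_vec \<in> L \<rightarrow>\<^sub>M borel" using measurable_cong_sets[OF assms refl] by blast
  then show ?thesis by (rule measurable_restrict_space1)
qed

lemma from_ext_alt: "from_ext L = distr (restrict_space L (- infinite_points)) borel fin_vec"
  by (simp add: from_ext_def fin_vec_def[abs_def])

lemma sets_from_ext[simp]: "sets (from_ext L) = sets borel"
  by (simp add: from_ext_alt)

lemma finite_points_sets:
  assumes "sets L = sets ext_space"
  shows "- infinite_points \<inter> space L \<in> sets L"
proof -
  have "space L = - {0}" using sets_eq_imp_space_eq[OF assms] by simp
  moreover have "- infinite_points \<inter> - {0} \<in> sets borel"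
    by (rule sets.Int[OF _ nonzero_sets]) measurable
  ultimately show ?thesis unfolding assms by (simp only:) (simp add: sets_ext_space)
qed

lemma emeasure_from_ext:
  fixes L :: "(ereal^'n) measure"
  assumes s: "sets L = sets ext_space" and B: "B \<in> sets borel"
  shows "emeasure (from_ext L) B = emeasure L (ext ` (B - {0}))"
proof -
  have sp: "space L = - {0}" using sets_eq_imp_space_eq[OF s] by simp
  have "emeasure (from_ext L) B = emeasure (restrict_space L (- infinite_points)) (fin_vec -` B \<inter> space (restrict_space L (- infinite_points)))"
    unfolding from_ext_alt by (rule emeasure_distr[OF from_ext_measurable[OF s] B])
  also have "fin_vec -` B \<inter> space (restrict_space L (- infinite_points)) = ext ` (B - {0})"
    unfolding ext_image by (auto simp: space_restrict_space sp fin_vec_eq_0)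
  also have "emeasure (restrict_space L (- infinite_points)) (ext ` (B - {0})) = emeasure L (ext ` (B - {0}))"
    by (rule emeasure_restrict_space[OF finite_points_sets[OF s]]) auto
  finally show ?thesis .
qed

lemma integral_from_ext:
  fixes f :: "ereal^'n \<Rightarrow> real"
  assumes s: "sets L = sets ext_space" and z: "emeasure L infinite_points = 0" and f: "f \<in> Cc_ext"
  shows "integral\<^sup>L L f = (LINT y|from_ext L. (if y = 0 then 0 else f (ext y)))"
proof -
  have sp: "space L = - {0}" using sets_eq_imp_space_eq[OF s] by simp
  obtain B r where gm: "(\<lambda>y. if y = 0 then 0 else f (ext y)) \<in> borel_measurable borel"
    using away_testE[OF Cc_ext_away_test[OF f]] by metis
  have inf: "infinite_points \<in> sets L" unfolding s sets_ext_space by (simp add: infinite_points_def)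
  have "(LINT y|from_ext L. (if y = 0 then 0 else f (ext y))) =
    (LINT z|restrict_space L (- infinite_points). (if fin_vec z = 0 then 0 else f (ext (fin_vec z))))"
    unfolding from_ext_alt by (rule integral_distr[OF from_ext_measurable[OF s] gm])
  also have "\<dots> = (LINT z|restrict_space L (- infinite_points). f z)"
    by (rule Bochner_Integration.integral_cong) (auto simp: space_restrict_space sp fin_vec_eq_0 ext_fin_vec)
  also have "\<dots> = (LINT z|L. indicator (- infinite_points) z *\<^sub>R f z)"
    by (rule integral_restrict_space[OF finite_points_sets[OF s]])
  also have "\<dots> = integral\<^sup>L L f"
  proof (rule integral_cong_AE)
    have fm: "f \<in> borel_measurable L" using Cc_ext_measurable[OF f] measurable_cong_sets[OF s refl] by blast
    show "f \<in> borel_measurable L" by (rule fm)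
    have "(\<lambda>z. indicator (space L - infinite_points) z *\<^sub>R f z) \<in> borel_measurable L"
      using fm inf by measurable
    then show "(\<lambda>z. indicator (- infinite_points) z *\<^sub>R f z) \<in> borel_measurable L"
      by (rule measurable_cong[THEN iffD1, rotated]) (auto simp: indicator_def)
    show "AE z in L. indicator (- infinite_points) z *\<^sub>R f z = f z"
      by (rule AE_I[OF _ z inf]) (auto simp: indicator_def split: if_splits)
  qed
  finally show ?thesis by simp
qed

lemma from_ext_to_ext:
  assumes s: "sets D = sets borel" and z: "emeasure D {0} = 0"
  shows "from_ext (to_ext D) = (D :: (real^'n) measure)"
proof (rule measure_eqI)
  show "sets (from_ext (to_ext D)) = sets D" by (simp add: s)
  fix B assume "B \<in> sets (from_ext (to_ext D))"
  then have B: "B \<in> sets borel" by simp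
  have m: "ext ` (B - {0}) \<in> sets ext_space"
  proof -
    have "{z. z \<notin> infinite_points \<and> fin_vec z \<in> B - {0}} = (- infinite_points) \<inter> (fin_vec -` (B - {0}) \<inter> space borel)" by auto
    also have "\<dots> \<in> sets borel" using B by (intro sets.Int measurable_sets[OF fin_vec_measurable]) auto
    finally show ?thesis unfolding sets_ext_space ext_image by simp
  qed
  have "emeasure (from_ext (to_ext D)) B = emeasure D {y. ext y \<in> ext ` (B - {0})}"
    by (simp add: emeasure_from_ext[OF sets_to_ext B] emeasure_to_ext[OF s m])
  also have "{y. ext y \<in> ext ` (B - {0})} = B - {0}"
    unfolding ext_image by auto
  also have "emeasure D (B - {0}) = emeasure D B"
    using z B by (intro emeasure_Diff_null_set) (auto simp: s null_sets_def)
  finally show "emeasure (from_ext (to_ext D)) B = emeasure D B" .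
qed


section \<open>Logarithmic and coordinate moments of \<rho>\<close>

lemma power_le_exp_sum:
  fixes v \<delta> :: real
  assumes "\<delta> > 0"
  shows "\<bar>v\<bar> ^ k \<le> fact k / \<delta> ^ k * (exp (\<delta> * v) + exp (- \<delta> * v))"
proof -
  have "(\<delta> * \<bar>v\<bar>) ^ k / fact k \<le> exp (\<delta> * \<bar>v\<bar>)"
  proof -
    have s: "(\<lambda>n. (\<delta> * \<bar>v\<bar>) ^ n / fact n) sums exp (\<delta> * \<bar>v\<bar>)"
      using exp_converges[of "\<delta> * \<bar>v\<bar>"] by (simp add: divide_inverse mult.commute)
    have "sum (\<lambda>n. (\<delta> * \<bar>v\<bar>) ^ n / fact n) {k} \<le> (\<Sum>n. (\<delta> * \<bar>v\<bar>) ^ n / fact n)"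
      using assms by (intro sum_le_suminf sums_summable[OF s]) auto
    then show ?thesis using s by (simp add: sums_iff)
  qed
  also have "\<dots> \<le> exp (\<delta> * v) + exp (- \<delta> * v)" by (cases "v \<ge> 0") auto
  finally show ?thesis using assms by (simp add: power_mult_distrib field_simps)
qed

text \<open>Any power of the logarithm is absorbed by shifting the exponent by \<delta>, upwards for
  large coordinates and downwards for small ones.\<close>

lemma moment_log:
  fixes \<rho> :: "(real^'n) measure"
  assumes s: "sets \<rho> = sets borel" and \<delta>: "0 < \<delta>"
    and i: "integrable \<rho> (\<lambda>x. \<bar>x $ j\<bar> powr (\<alpha> + \<delta>))" "integrable \<rho> (\<lambda>x. \<bar>x $ j\<bar> powr (\<alpha> - \<delta>))"
  shows "integrable \<rho> (\<lambda>x. \<bar>x $ j\<bar> powr \<alpha> * ln \<bar>x $ j\<bar> ^ k)"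
proof (rule Bochner_Integration.integrable_bound)
  note [measurable_cong] = s
  let ?c = "fact k / \<delta> ^ k"
  show "integrable \<rho> (\<lambda>x. ?c * (\<bar>x $ j\<bar> powr (\<alpha> + \<delta>) + \<bar>x $ j\<bar> powr (\<alpha> - \<delta>)))"
    by (intro integrable_mult_right Bochner_Integration.integrable_add i)
  show "(\<lambda>x. \<bar>x $ j\<bar> powr \<alpha> * ln \<bar>x $ j\<bar> ^ k) \<in> borel_measurable \<rho>" by measurable
  have "\<bar>x $ j\<bar> powr \<alpha> * \<bar>ln \<bar>x $ j\<bar>\<bar> ^ k \<le> ?c * (\<bar>x $ j\<bar> powr (\<alpha> + \<delta>) + \<bar>x $ j\<bar> powr (\<alpha> - \<delta>))" for x
  proof (cases "x $ j = 0")
    case False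
    define v where "v = ln \<bar>x $ j\<bar>"
    have p: "\<bar>x $ j\<bar> powr a = exp (a * v)" for a using False by (simp add: powr_def v_def)
    have "exp (\<alpha> * v) * \<bar>v\<bar> ^ k \<le> exp (\<alpha> * v) * (?c * (exp (\<delta> * v) + exp (- \<delta> * v)))"
      by (intro mult_left_mono power_le_exp_sum[OF \<delta>]) auto
    also have "\<dots> = ?c * (exp ((\<alpha> + \<delta>) * v) + exp ((\<alpha> - \<delta>) * v))"
      by (simp add: exp_add[symmetric] algebra_simps add_divide_distrib)
    finally show ?thesis by (simp add: p v_def[symmetric])
  qed simp
  then show "AE x in \<rho>. norm (\<bar>x $ j\<bar> powr \<alpha> * ln \<bar>x $ j\<bar> ^ k) \<le> norm (?c * (\<bar>x $ j\<bar> powr (\<alpha> + \<delta>) + \<bar>x $ j\<bar> powr (\<alpha> - \<delta>)))"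
    using \<delta> by (intro AE_I2) (auto simp: abs_mult power_abs)
qed

lemma moment_component:
  fixes \<rho> :: "(real^'n) measure"
  assumes N: "is_norm N" and s: "sets \<rho> = sets borel" and \<delta>: "0 < \<delta>" "\<delta> < \<alpha>"
    and fin: "(\<integral>\<^sup>+ y. ennreal (max (N y powr (\<alpha> - \<delta>)) (N y powr (\<alpha> + \<delta>))) \<partial>\<rho>) < \<infinity>"
    and a: "a = \<alpha> - \<delta> \<or> a = \<alpha> + \<delta>"
  shows "integrable \<rho> (\<lambda>x. \<bar>x $ j\<bar> powr a)"
proof -
  note [measurable_cong] = s
  have [measurable]: "N \<in> borel_measurable borel"
    by (intro borel_measurable_continuous_onI is_norm_continuous[OF N])
  obtain c where c: "c > 0" "\<And>x. c * norm x \<le> N x" using is_norm_lower[OF N] by blast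
  have a0: "a > 0" using a \<delta> by auto
  let ?m = "\<lambda>y. max (N y powr (\<alpha> - \<delta>)) (N y powr (\<alpha> + \<delta>))"
  have m: "integrable \<rho> ?m"
  proof (rule integrableI_bounded)
    have "norm (?m y) = ?m y" for y by (simp add: max_def)
    then show "(\<integral>\<^sup>+ y. ennreal (norm (?m y)) \<partial>\<rho>) < \<infinity>" using fin by (simp only:)
  qed measurable
  show ?thesis
  proof (rule Bochner_Integration.integrable_bound)
    show "integrable \<rho> (\<lambda>y. (1 / c) powr a * ?m y)" by (rule integrable_mult_right[OF m])
    show "(\<lambda>x. \<bar>x $ j\<bar> powr a) \<in> borel_measurable \<rho>" by measurable
    have "\<bar>x $ j\<bar> powr a \<le> (1 / c) powr a * ?m x" for x
    proof -
      have "c * \<bar>x $ j\<bar> \<le> N x" using c mult_left_mono[OF component_le_norm_cart[of x j], of c] by (meson less_imp_le order_trans)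
      then have "\<bar>x $ j\<bar> \<le> 1 / c * N x" using c(1) by (simp add: field_simps)
      then have "\<bar>x $ j\<bar> powr a \<le> (1 / c * N x) powr a" using a0 by (intro powr_mono2) auto
      also have "\<dots> = (1 / c) powr a * N x powr a" by (rule powr_mult)
      also have "\<dots> \<le> (1 / c) powr a * ?m x" using a by (intro mult_left_mono) auto
      finally show ?thesis .
    qed
    then show "AE x in \<rho>. norm (\<bar>x $ j\<bar> powr a) \<le> norm ((1 / c) powr a * ?m x)"
      by (intro AE_I2) (auto intro: order_trans[OF _ abs_ge_self])
  qed
qed

section \<open>Transfer between the compactified space and the finite one\<close>

lemma finite_away_from_ext:
  fixes L :: "(ereal^'n) measure"
  assumes N: "is_norm N" and L: "radon N L"
  shows "finite_away (from_ext L)" "emeasure (from_ext L) {0} = 0"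
proof -
  have s: "sets L = sets ext_space" using L by (simp add: radon_def)
  show "emeasure (from_ext L) {0} = 0" by (subst emeasure_from_ext[OF s]) auto
  obtain c where c: "c > 0" "\<And>x. c * norm x \<le> N x" using is_norm_lower[OF N] by blast
  show "finite_away (from_ext L)"
    unfolding finite_away_def
  proof (intro conjI allI impI)
    fix r :: real assume r: "r > 0"
    have "emeasure (from_ext L) {x. r \<le> norm x} = emeasure L (ext ` ({x. r \<le> norm x} - {0}))"
      by (rule emeasure_from_ext[OF s]) measurable
    also have "\<dots> \<le> emeasure L (- {0} - ext ` {x. N x < c * r})"
    proof (rule emeasure_mono)
      show "- {0} - ext ` {x. N x < c * r} \<in> sets L" unfolding s by (rule ball_image_measurable[OF N])
      have "c * r \<le> N x" if "r \<le> norm x" for x using c mult_left_mono[OF that, of c] by (meson less_imp_le order_trans)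
      then show "ext ` ({x. r \<le> norm x} - {0}) \<subseteq> - {0} - ext ` {x. N x < c * r}"
        unfolding ext_image using r by (auto simp: not_less[symmetric]) 
    qed
    also have "\<dots> < \<infinity>" using L c(1) r by (simp add: radon_def)
    finally show "emeasure (from_ext L) {x. r \<le> norm x} < \<infinity>" .
  qed simp
qed

lemma measure_from_ext_homogeneous:
  fixes L :: "(ereal^'n) measure"
  assumes N: "is_norm N" and L: "radon N L" and hom: "homogeneous L \<alpha>" and t: "t > 0"
  shows "measure (from_ext L) {x. N x > t} = t powr (- \<alpha>) * measure (from_ext L) {x. N x > 1}"
proof -
  have s: "sets L = sets ext_space" using L by (simp add: radon_def)
  have [measurable]: "N \<in> borel_measurable borel"
    by (intro borel_measurable_continuous_onI is_norm_continuous[OF N])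
  have N0: "N 0 = 0" using N by (auto simp: is_norm_def)
  have nz: "{x. N x > u} - {0} = {x. N x > u}" if "u > 0" for u using that N0 by auto
  have em: "emeasure (from_ext L) {x. N x > u} = emeasure L (ext ` {x. N x > u})" if "u > 0" for u
    by (subst emeasure_from_ext[OF s]) (auto simp: nz[OF that])
  have m1: "ext ` {x. N x > 1} \<in> sets L"
  proof -
    have "{z. z \<notin> infinite_points \<and> fin_vec z \<in> {x. N x > 1}} = (- infinite_points) \<inter> {z \<in> space borel. N (fin_vec z) > 1}" by auto
    also have "\<dots> \<in> sets borel" by measurable
    finally show ?thesis unfolding s sets_ext_space ext_image using N0 by simp
  qed
  have img: "(\<lambda>x. \<chi> i. ereal t * x $ i) ` (ext ` {x. N x > 1}) = ext ` {x. N x > t}"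
  proof -
    have e: "(\<chi> i. ereal t * ext x $ i) = ext (t *\<^sub>R x)" for x by (simp add: ext_def vec_eq_iff)
    have "(\<lambda>x. \<chi> i. ereal t * x $ i) ` (ext ` {x. N x > 1}) = ext ` ((\<lambda>x. t *\<^sub>R x) ` {x. N x > 1})"
      by (simp only: image_image e)
    also have "(\<lambda>x. t *\<^sub>R x) ` {x. N x > 1} = {x. N x > t}"
    proof (intro set_eqI iffI)
      fix x assume "x \<in> {x. N x > t}"
      then have "x = t *\<^sub>R (inverse t *\<^sub>R x)" "N (inverse t *\<^sub>R x) > 1"
        using t by (auto simp: is_norm_scale[OF N] field_simps)
      then show "x \<in> (\<lambda>x. t *\<^sub>R x) ` {x. N x > 1}" by blast
    qed (use t in \<open>auto simp: is_norm_scale[OF N]\<close>)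
    finally show ?thesis .
  qed
  have "emeasure (from_ext L) {x. N x > t} = ennreal (t powr (- \<alpha>)) * emeasure (from_ext L) {x. N x > 1}"
    using hom t m1 unfolding em[OF t] em[OF zero_less_one] img[symmetric] homogeneous_def by blast
  then show ?thesis by (simp add: measure_def enn2real_mult)
qed

text \<open>By homogeneity one vanishing tail makes all tails vanish, and with no mass at infinite
  points nothing would remain of a non-null measure.\<close>

lemma from_ext_nonnull:
  fixes L :: "(ereal^'n) measure"
  assumes N: "is_norm N" and L: "radon N L" and hom: "homogeneous L \<alpha>"
    and nz: "emeasure L (space L) \<noteq> 0" and inf: "emeasure L infinite_points = 0"
  shows "measure (from_ext L) {x. N x > 1} > 0"
proof (rule ccontr)
  assume "\<not> ?thesis"
  then have m0: "measure (from_ext L) {x. N x > 1} = 0" using measure_nonneg[of "from_ext L" "{x. N x > 1}"] by linarith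
  have s: "sets L = sets ext_space" using L by (simp add: radon_def)
  have sp: "space L = - {0}" using sets_eq_imp_space_eq[OF s] by simp
  note fa = finite_away_from_ext[OF N L]
  have z: "emeasure (from_ext L) {x. N x > 1 / real (Suc n)} = 0" for n
  proof -
    have "emeasure (from_ext L) {x. N x > 1 / real (Suc n)} = ennreal (measure (from_ext L) {x. N x > 1 / real (Suc n)})"
      using finite_away_norm(3)[OF N fa(1), of "1 / real (Suc n)"] by (intro emeasure_eq_ennreal_measure) simp
    also have "measure (from_ext L) {x. N x > 1 / real (Suc n)} = 0"
      by (subst measure_from_ext_homogeneous[OF N L hom]) (auto simp: m0)
    finally show ?thesis by simp
  qed
  have "emeasure (from_ext L) (\<Union>n. {x. N x > 1 / real (Suc n)}) = 0"
    by (rule emeasure_UN_eq_0[OF z]) (use finite_away_norm(1)[OF N fa(1)] in auto)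
  also have "(\<Union>n. {x. N x > 1 / real (Suc n)}) = - {0}"
  proof -
    have N0: "N x = 0 \<longleftrightarrow> x = 0" for x using N by (auto simp: is_norm_def)
    have "\<exists>n. N x > 1 / real (Suc n)" if "x \<noteq> 0" for x
      using that N0[of x] is_norm_nonneg[OF N, of x] nat_approx_posE[of "N x"] by (metis le_less)
    moreover have "\<not> N 0 > 1 / real (Suc n)" for n using N0[of 0] by simp
    ultimately show ?thesis by blast
  qed
  finally have "emeasure L (ext ` (- {0} - {0})) = 0"
    by (subst (asm) emeasure_from_ext[OF s]) auto
  moreover have "space L = ext ` (- {0} - {0}) \<union> infinite_points"
  proof -
    have "0 \<notin> (infinite_points :: (ereal^'n) set)" by (simp add: infinite_points_def)
    then show ?thesis unfolding sp ext_image by (auto simp: fin_vec_eq_0)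
  qed
  moreover have "infinite_points \<in> sets L" unfolding s sets_ext_space by (simp add: infinite_points_def)
  moreover have "ext ` (- {0} - {0}) \<in> sets L"
  proof -
    have "ext ` (- {0} - {0}) = space L - infinite_points" unfolding sp ext_image by (auto simp: fin_vec_eq_0)
    then show ?thesis using \<open>infinite_points \<in> sets L\<close> by auto
  qed
  ultimately have "emeasure L (space L) \<le> 0"
    using emeasure_subadditive[of "ext ` (- {0} - {0})" L infinite_points] inf by simp
  then show False using nz by simp
qed

lemma radon_to_ext:
  fixes D :: "(real^'n) measure"
  assumes N: "is_norm N" and D: "finite_away D"
  shows "radon N (to_ext D)" "emeasure (to_ext D) infinite_points = 0"
proof -
  have s: "sets D = sets borel" using D by (simp add: finite_away_def)
  show "radon N (to_ext D)"
    unfolding radon_def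
  proof (intro conjI allI impI)
    fix r :: real assume "r > 0"
    have "emeasure (to_ext D) (- {0} - ext ` {x. N x < r}) = emeasure D {y. ext y \<in> - {0} - ext ` {x. N x < r}}"
      by (rule emeasure_to_ext[OF s ball_image_measurable[OF N]])
    also have "\<dots> \<le> emeasure D {x. N x \<ge> r}"
      using finite_away_norm(2)[OF N D \<open>r > 0\<close>] by (intro emeasure_mono) auto
    also have "\<dots> < \<infinity>" by (rule finite_away_norm(4)[OF N D \<open>r > 0\<close>])
    finally show "emeasure (to_ext D) (- {0} - ext ` {x. N x < r}) < \<infinity>" .
  qed simp
  have "infinite_points \<in> sets (ext_space :: (ereal^'n) measure)" unfolding sets_ext_space by (simp add: infinite_points_def)
  then show "emeasure (to_ext D) infinite_points = 0" by (simp add: emeasure_to_ext[OF s])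
qed

lemma homogeneous_to_ext:
  fixes D :: "(real^'n) measure"
  assumes s: "sets D = sets borel"
    and hom: "\<And>t B. t > 0 \<Longrightarrow> B \<in> sets borel \<Longrightarrow> emeasure D ((\<lambda>y. inverse t *\<^sub>R y) -` B) = ennreal (t powr (- \<alpha>)) * emeasure D B"
  shows "homogeneous (to_ext D) \<alpha>"
  unfolding homogeneous_def
proof (intro allI impI ballI)
  fix t :: real and A :: "(ereal^'n) set" assume t: "t > 0" and "A \<in> sets (to_ext D)"
  then have A: "A \<in> sets ext_space" by simp
  define h where "h c x = (\<chi> i. ereal c * x $ i)" for c and x :: "ereal^'n"
  have inv: "h a (h b x) = x" if "a * b = 1" for a b x
  proof -
    have "ereal a * (ereal b * y) = y" for y
      using that by (simp add: mult.assoc[symmetric] one_ereal_def[symmetric])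
    then show ?thesis by (simp add: h_def vec_eq_iff)
  qed
  \<comment> \<open>Written as a preimage under the inverse dilation, the image is seen to be
    measurable.\<close>
  have img: "h t ` A = h (inverse t) -` A"
  proof (intro set_eqI iffI)
    fix x assume "x \<in> h t ` A"
    then show "x \<in> h (inverse t) -` A" using inv[of "inverse t" t] t by auto
  next
    fix x assume "x \<in> h (inverse t) -` A"
    then show "x \<in> h t ` A" using inv[of t "inverse t" x] t by (intro rev_image_eqI[of "h (inverse t) x"]) auto
  qed
  have "continuous_on UNIV (h (inverse t))"
    unfolding continuous_on_def h_def
    by (auto intro!: tendsto_vec_lambda tendsto_cmult_ereal tendsto_vec_nth tendsto_ident_at)
  then have hm: "h (inverse t) \<in> borel \<rightarrow>\<^sub>M borel" by (rule borel_measurable_continuous_onI)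
  have A': "A \<in> sets borel" "0 \<notin> A" using A by (auto simp: sets_ext_space)
  have h0: "h (inverse t) 0 = 0" by (simp add: h_def vec_eq_iff)
  have "h (inverse t) -` A \<in> sets ext_space"
    unfolding sets_ext_space using measurable_sets[OF hm A'(1)] A'(2) h0 by auto
  then have "emeasure (to_ext D) (h t ` A) = emeasure D {y. ext y \<in> h (inverse t) -` A}"
    unfolding img by (rule emeasure_to_ext[OF s])
  also have "{y. ext y \<in> h (inverse t) -` A} = (\<lambda>y. inverse t *\<^sub>R y) -` {y. ext y \<in> A}"
  proof -
    have "h (inverse t) (ext y) = ext (inverse t *\<^sub>R y)" for y by (simp add: h_def ext_def vec_eq_iff)
    then show ?thesis by auto
  qed
  also have "emeasure D \<dots> = ennreal (t powr (- \<alpha>)) * emeasure D {y. ext y \<in> A}"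
    using measurable_sets[OF ext_measurable A'(1)] by (intro hom[OF t]) (simp add: vimage_def)
  also have "emeasure D {y. ext y \<in> A} = emeasure (to_ext D) A" by (rule emeasure_to_ext[OF s A, symmetric])
  finally show "emeasure (to_ext D) ((\<lambda>x. \<chi> i. ereal t * x $ i) ` A) = ennreal (t powr (- \<alpha>)) * emeasure (to_ext D) A"
    by (simp only: h_def[abs_def])
qed

lemma vague_conv_rescaled_iff:
  fixes M :: "(real^'n) measure"
  assumes s: "sets M = sets borel" and V: "\<And>s. s > 0 \<Longrightarrow> V s > 0"
  shows "vague_conv (\<lambda>s. rescaled M (ennreal (V s)) s) K at_top \<longleftrightarrow>
    (\<forall>f\<in>Cc_ext. ((\<lambda>s. (LINT y|M. (if inverse s *\<^sub>R y = 0 then 0 else f (ext (inverse s *\<^sub>R y)))) / V s) \<longlongrightarrow> integral\<^sup>L K f) at_top)"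
proof -
  have "eventually (\<lambda>s. integral\<^sup>L (rescaled M (ennreal (V s)) s) f =
     (LINT y|M. (if inverse s *\<^sub>R y = 0 then 0 else f (ext (inverse s *\<^sub>R y)))) / V s) at_top" if "f \<in> Cc_ext" for f
    using eventually_gt_at_top[of 0] by eventually_elim (rule integral_rescaled[OF s that V])
  then show ?thesis unfolding vague_conv_def by (intro ball_cong refl tendsto_cong)
qed

lemma vague_conv_if_scaled_conv:
  fixes M D :: "(real^'n) measure"
  assumes s: "sets M = sets borel" "sets D = sets borel" and V: "\<And>s. s > 0 \<Longrightarrow> V s > 0" and conv: "scaled_conv M V D"
  shows "vague_conv (\<lambda>s. rescaled M (ennreal (V s)) s) (to_ext D) at_top"
proof (rule vague_conv_rescaled_iff[THEN iffD2, OF s(1)])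
  show "V s > 0" if "s > 0" for s by (rule V[OF that])
  show "\<forall>f\<in>Cc_ext. ((\<lambda>s. (LINT y|M. (if inverse s *\<^sub>R y = 0 then 0 else f (ext (inverse s *\<^sub>R y)))) / V s) \<longlongrightarrow> integral\<^sup>L (to_ext D) f) at_top"
  proof
  fix f :: "ereal^'n \<Rightarrow> real" assume f: "f \<in> Cc_ext"
  show "((\<lambda>s. (LINT y|M. (if inverse s *\<^sub>R y = 0 then 0 else f (ext (inverse s *\<^sub>R y)))) / V s) \<longlongrightarrow> integral\<^sup>L (to_ext D) f) at_top"
    using conv Cc_ext_away_test[OF f] unfolding integral_to_ext[OF s(2) f] scaled_conv_def by (rule bspec)
  qed
qed

text \<open>The ramp \<open>k\<close>, equal to 1 near infinity, extends to the infinite points, and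
  so does the truncation \<open>g\<close>, which vanishes there. As \<open>L\<close> does not charge
  infinite points, the limit integral of \<open>k\<close> is small for a large radius, and vague
  convergence passes this on to the rescaled measures: tightness is extracted from the convergence
  itself.\<close>

lemma scaled_conv_if_vague_conv:
  fixes M :: "(real^'n) measure" and L :: "(ereal^'n) measure"
  assumes M: "finite_away M" and V: "\<And>s. s > 0 \<Longrightarrow> V s > 0" and N: "is_norm N" and L: "radon N L"
    and inf: "emeasure L infinite_points = 0"
    and conv: "vague_conv (\<lambda>s. rescaled M (ennreal (V s)) s) L at_top"
  shows "scaled_conv M V (from_ext L)"
  unfolding scaled_conv_def
proof
  fix f :: "real^'n \<Rightarrow> real" assume f: "f \<in> away_test"
  have sM: "sets M = sets borel" using M by (simp add: finite_away_def)
  have sL: "sets L = sets ext_space" using L by (simp add: radon_def)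
  define D where "D = from_ext L"
  have D: "finite_away D" "sets D = sets borel" unfolding D_def using finite_away_from_ext[OF N L] by auto
  have spD: "space D = UNIV" using sets_eq_imp_space_eq[OF D(2)] by simp
  obtain B r where B: "continuous_on UNIV f" "B > 0" "\<And>x. \<bar>f x\<bar> \<le> B" and r: "r > 0" "\<And>x. norm x < r \<Longrightarrow> f x = 0"
    using away_testE[OF f] by metis
  have cv: "((\<lambda>s. (LINT y|M. g (inverse s *\<^sub>R y)) / V s) \<longlongrightarrow> integral\<^sup>L D g) at_top"
    if g: "continuous_on UNIV g" "a > 0" "\<And>y. norm y < a \<Longrightarrow> g y = 0" "R > 0" "\<And>y. R < norm y \<Longrightarrow> g y = c" for g a R c
  proof -
    define G where "G z = (if z \<in> infinite_points then c else g (fin_vec z))" for z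
    have G: "G \<in> Cc_ext" unfolding G_def[abs_def] by (rule Cc_extI[OF g])
    have Gext: "(if y = 0 then 0 else G (ext y)) = g y" for y using g(2) g(3)[of 0] by (auto simp: G_def)
    have "\<forall>f\<in>Cc_ext. ((\<lambda>s. (LINT y|M. (if inverse s *\<^sub>R y = 0 then 0 else f (ext (inverse s *\<^sub>R y)))) / V s) \<longlongrightarrow> integral\<^sup>L L f) at_top"
    proof (rule vague_conv_rescaled_iff[THEN iffD1, OF sM _ conv])
      show "V s > 0" if "s > 0" for s by (rule V[OF that])
    qed
    from bspec[OF this G] show ?thesis
      unfolding integral_from_ext[OF sL inf G] by (simp only: Gext D_def)
  qed
  show "((\<lambda>s. (LINT y|M. f (inverse s *\<^sub>R y)) / V s) \<longlongrightarrow> integral\<^sup>L (from_ext L) f) at_top"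
    unfolding D_def[symmetric]
  proof (rule tendsto_uniform_approx)
    fix e :: real assume e: "e > 0"
    have "(\<lambda>n. measure D {x. norm x > real (Suc n)}) \<longlonglongrightarrow> measure D (\<Inter>n. {x. norm x > real (Suc n)})"
    proof (rule Lim_measure_decseq)
      show "range (\<lambda>n. {x. norm x > real (Suc n)}) \<subseteq> sets D"
        by (intro image_subsetI finite_away_norm(1)[OF is_norm_norm D(1)]) simp
      show "decseq (\<lambda>n. {x::real^'n. norm x > real (Suc n)})" by (rule decseq_SucI) auto
      show "emeasure D {x. norm x > real (Suc n)} \<noteq> \<infinity>" for n
        using finite_away_norm(3)[OF is_norm_norm D(1), of "real (Suc n)"] by simp
    qed
    also have "(\<Inter>n. {x::real^'n. norm x > real (Suc n)}) = {}"
    proof -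
      have "\<exists>n. \<not> real (Suc n) < norm x" for x :: "real^'n"
      proof -
        obtain n where "norm x \<le> real n" using real_arch_simple by blast
        then have "\<not> real (Suc n) < norm x" by simp
        then show ?thesis by blast
      qed
      then show ?thesis by auto
    qed
    finally have "eventually (\<lambda>n. measure D {x. norm x > real (Suc n)} < e / (2 * B)) sequentially"
      using e B(2) by (intro order_tendstoD(2)) auto
    then obtain n where n: "measure D {x. norm x > real (Suc n)} < e / (2 * B)" by (auto simp: eventually_sequentially)
    define R where "R = real (Suc n)"
    have R: "R > 0" by (simp add: R_def)
    define k where "k y = max 0 (min 1 (norm y - R))" for y :: "real^'n"
    have k: "0 \<le> k y" "k y \<le> 1" "norm y \<le> R \<Longrightarrow> k y = 0" "R + 1 \<le> norm y \<Longrightarrow> k y = 1" for y by (auto simp: k_def)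
    have kc: "continuous_on UNIV k" unfolding k_def[abs_def] by (intro continuous_intros)
    have kt: "k \<in> away_test" unfolding away_test_def mem_Collect_eq
      using kc k R by (intro conjI boundedI[of _ 1] exI[of _ R]) auto
    define g where "g y = f y * (1 - k y)" for y
    have gc: "continuous_on UNIV g" unfolding g_def[abs_def] by (intro continuous_intros B(1) kc)
    have gt: "g \<in> away_test" unfolding away_test_def mem_Collect_eq
    proof (intro conjI boundedI[of _ B] exI[of _ r])
      fix z assume "z \<in> range g"
      then obtain y where "z = g y" by blast
      then show "norm z \<le> B" using mult_mono[OF B(3)[of y], of "\<bar>1 - k y\<bar>" 1] k[of y] B(2) by (simp add: g_def abs_mult)
    qed (use gc r in \<open>auto simp: g_def\<close>)
    have fg: "\<bar>f y - g y\<bar> \<le> B * k y" for y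
      using mult_right_mono[OF B(3)[of y], of "k y"] k[of y] by (simp add: g_def right_diff_distrib abs_mult)
    have bound: "\<bar>(LINT y|K. f (h y)) - (LINT y|K. g (h y))\<bar> \<le> B * (LINT y|K. k (h y))"
      if "integrable K (\<lambda>y. f (h y))" "integrable K (\<lambda>y. g (h y))" "integrable K (\<lambda>y. k (h y))" for K and h :: "real^'n \<Rightarrow> real^'n"
    proof -
      have "\<bar>(LINT y|K. f (h y)) - (LINT y|K. g (h y))\<bar> = \<bar>LINT y|K. f (h y) - g (h y)\<bar>" using that by simp
      also have "\<dots> \<le> (LINT y|K. B * k (h y))"
        using that fg by (intro order_trans[OF integral_abs_bound integral_mono]) auto
      finally show ?thesis by simp
    qed
    have kD: "integral\<^sup>L D k < e / (2 * B)"
    proof -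
      have "integral\<^sup>L D k \<le> (LINT y|D. indicator {x. norm x > R} y)"
        using k finite_away_norm(1,3)[OF is_norm_norm D(1) R]
        by (intro integral_mono integrable_away_test[OF D(1) kt] integrable_real_indicator) (auto simp: indicator_def not_less)
      also have "\<dots> = measure D {x. norm x > R}" by (simp add: spD)
      finally show ?thesis using n by (simp add: R_def)
    qed
    have kconv: "((\<lambda>s. (LINT y|M. k (inverse s *\<^sub>R y)) / V s) \<longlongrightarrow> integral\<^sup>L D k) at_top"
      by (rule cv[OF kc R _ add_pos_pos[OF R zero_less_one]]) (use k in auto)
    have gconv: "((\<lambda>s. (LINT y|M. g (inverse s *\<^sub>R y)) / V s) \<longlongrightarrow> integral\<^sup>L D g) at_top"
      by (rule cv[OF gc r(1) _ add_pos_pos[OF R zero_less_one], where c=0]) (use k r in \<open>auto simp: g_def\<close>)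
    have "eventually (\<lambda>s. (LINT y|M. k (inverse s *\<^sub>R y)) / V s < e / (2 * B)) at_top"
      by (rule order_tendstoD(2)[OF kconv kD])
    then have "eventually (\<lambda>s. \<bar>(LINT y|M. f (inverse s *\<^sub>R y)) / V s - (LINT y|M. g (inverse s *\<^sub>R y)) / V s\<bar> \<le> e) at_top"
      using eventually_gt_at_top[of 0]
    proof eventually_elim
      case (elim s)
      have "\<bar>(LINT y|M. f (inverse s *\<^sub>R y)) - (LINT y|M. g (inverse s *\<^sub>R y))\<bar> \<le> B * (LINT y|M. k (inverse s *\<^sub>R y))"
        by (intro bound integrable_away_test[OF M] away_test_scale f gt kt elim)
      then have "\<bar>(LINT y|M. f (inverse s *\<^sub>R y)) / V s - (LINT y|M. g (inverse s *\<^sub>R y)) / V s\<bar> \<le> B * ((LINT y|M. k (inverse s *\<^sub>R y)) / V s)"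
        using V[OF elim(2)] by (simp add: diff_divide_distrib[symmetric] divide_right_mono)
      also have "\<dots> \<le> B * (e / (2 * B))" using elim(1) B(2) by (intro mult_left_mono) auto
      also have "\<dots> \<le> e" using B(2) e by simp
      finally show ?case .
    qed
    moreover have "\<bar>integral\<^sup>L D f - integral\<^sup>L D g\<bar> \<le> e"
    proof -
      have "\<bar>integral\<^sup>L D f - integral\<^sup>L D g\<bar> \<le> B * integral\<^sup>L D k"
        using bound[of D "\<lambda>y. y"] integrable_away_test[OF D(1)] f gt kt by simp
      also have "\<dots> \<le> B * (e / (2 * B))" using kD B(2) by (intro mult_left_mono) auto
      also have "\<dots> \<le> e" using B(2) e by simp
      finally show ?thesis .
    qed
    ultimately show "\<exists>g l'. (g \<longlongrightarrow> l') at_top \<and> (\<forall>\<^sub>F s in at_top. \<bar>(LINT y|M. f (inverse s *\<^sub>R y)) / V s - g s\<bar> \<le> e) \<and> \<bar>integral\<^sup>L D f - l'\<bar> \<le> e"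
      using gconv by blast
  qed
qed


text \<open>If one tail vanished, so would all further ones, and the rescaled measures would
  eventually ignore a set that the limit charges. The scaling factor is then
  \<open>inverse 0\<close>, which is infinite, but its product with measure 0 is still 0.\<close>

lemma rescaled_tail_pos:
  fixes M :: "(real^'n) measure" and L :: "(ereal^'n) measure"
  assumes N: "is_norm N" and M: "finite_away M" and L: "radon N L" and nn: "measure (from_ext L) {x. N x > 1} > 0"
    and inf: "emeasure L infinite_points = 0"
    and conv: "vague_conv (\<lambda>s. rescaled M (emeasure M {y. N y > s}) s) L at_top" and s: "s > 0"
  shows "measure M {x. N x > s} > 0"
proof (rule ccontr)
  assume "\<not> ?thesis"
  then have "measure M {x. N x > s} = 0" using measure_nonneg[of M "{x. N x > s}"] by linarith
  then have z: "emeasure M {x. N x > s} = 0"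
    using finite_away_norm(3)[OF N M s] by (simp add: emeasure_eq_ennreal_measure)
  have sM: "sets M = sets borel" using M by (simp add: finite_away_def)
  note [measurable_cong] = sM
  have sL: "sets L = sets ext_space" using L by (simp add: radon_def)
  define g where "g y = max 0 (min 1 ((N y - 1/2) / (1 - 1/2)))" for y
  have gt: "g \<in> away_test" unfolding g_def[abs_def] by (rule away_test_ramp[OF N]) auto
  obtain c where c: "c > 0" "\<And>x. c * norm x \<le> N x" using is_norm_lower[OF N] by blast
  obtain r where r: "r > 0" "\<And>y. norm y < r \<Longrightarrow> g y = 0" and gc: "continuous_on UNIV g"
    using away_testE[OF gt] by metis
  have g1: "g y = 1" if "1 \<le> N y" for y using that by (simp add: g_def)
  define G where "G z = (if z \<in> infinite_points then 1 else g (fin_vec z))" for z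
  have G: "G \<in> Cc_ext" unfolding G_def[abs_def]
  proof (rule Cc_extI[OF gc r])
    show "0 < 1 / c" using c(1) by simp
    show "g y = 1" if "1 / c < norm y" for y
    proof (rule g1)
      have "1 \<le> c * norm y" using that c(1) by (simp add: field_simps)
      then show "1 \<le> N y" using c(2)[of y] by linarith
    qed
  qed
  have Gext: "(if y = 0 then 0 else G (ext y)) = g y" for y using r(1) r(2)[of 0] by (auto simp: G_def)
  have D: "finite_away (from_ext L)" by (rule finite_away_from_ext[OF N L])
  \<comment> \<open>For t \<ge> 2 s a point x with g(x/t) nonzero has N x > t/2 \<ge> s, as
    \<open>g\<close> vanishes where N \<le> 1/2.\<close>
  have "eventually (\<lambda>t. integral\<^sup>L (rescaled M (emeasure M {y. N y > t}) t) G = 0) at_top"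
    using eventually_ge_at_top[of "2 * s"]
  proof eventually_elim
    case (elim t)
    have t: "t > 0" using elim s by linarith
    have Gm: "G \<in> borel_measurable ext_space" by (rule Cc_ext_measurable[OF G])
    have A: "{z. z \<noteq> 0 \<and> G z \<noteq> 0} \<in> sets ext_space"
    proof -
      have "{z \<in> space ext_space. G z \<noteq> 0} \<in> sets ext_space" using Gm by measurable
      moreover have "{z. z \<noteq> 0 \<and> G z \<noteq> 0} = {z \<in> space ext_space. G z \<noteq> 0}" by auto
      ultimately show ?thesis by (simp only:)
    qed
    have sp: "space M = UNIV" using sets_eq_imp_space_eq[OF sM] by simp
    have "emeasure (to_ext (dilate t M)) {z. z \<noteq> 0 \<and> G z \<noteq> 0} = emeasure (dilate t M) {y. ext y \<in> {z. z \<noteq> 0 \<and> G z \<noteq> 0}}"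
      by (rule emeasure_to_ext[OF _ A]) (simp add: dilate_def)
    also have "{y. ext y \<in> {z. z \<noteq> 0 \<and> G z \<noteq> 0}} = {y. g y \<noteq> 0}" 
    proof (rule set_eqI)
      fix y
      show "y \<in> {y. ext y \<in> {z. z \<noteq> 0 \<and> G z \<noteq> 0}} \<longleftrightarrow> y \<in> {y. g y \<noteq> 0}"
        using Gext[of y] by (cases "y = 0") auto
    qed
    also have "emeasure (dilate t M) {y. g y \<noteq> 0} = emeasure M ((\<lambda>x. inverse t *\<^sub>R x) -` {y. g y \<noteq> 0} \<inter> space M)"
    proof -
      have "g \<in> borel_measurable borel" using gc by (rule borel_measurable_continuous_onI)
      then have "{y \<in> space borel. g y \<noteq> 0} \<in> sets borel" by measurable
      then show ?thesis unfolding dilate_def by (subst emeasure_distr) auto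
    qed
    also have "\<dots> \<le> emeasure M {x. N x > s}"
    proof (rule emeasure_mono)
      show "{x. N x > s} \<in> sets M" by (rule finite_away_norm(1)[OF N M s])
      show "(\<lambda>x. inverse t *\<^sub>R x) -` {y. g y \<noteq> 0} \<inter> space M \<subseteq> {x. N x > s}"
      proof
        fix x assume "x \<in> (\<lambda>x. inverse t *\<^sub>R x) -` {y. g y \<noteq> 0} \<inter> space M"
        then have "g (inverse t *\<^sub>R x) \<noteq> 0" by simp
        then have "N (inverse t *\<^sub>R x) > 1/2" by (auto simp: g_def max_def min_def split: if_splits)
        then have "N x > t / 2" using t by (simp add: is_norm_scale[OF N] field_simps)
        then show "x \<in> {x. N x > s}" using elim by simp
      qed
    qed
    finally have "emeasure (to_ext (dilate t M)) {z. z \<noteq> 0 \<and> G z \<noteq> 0} = 0" using z by simp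
    then have e0: "emeasure (rescaled M (emeasure M {y. N y > t}) t) {z. z \<noteq> 0 \<and> G z \<noteq> 0} = 0" by (simp add: rescaled_def)
    have sr: "sets (rescaled M (emeasure M {y. N y > t}) t) = sets ext_space" by (simp add: rescaled_def)
    show ?case
    proof (rule integral_eq_zero_AE)
      show "AE z in rescaled M (emeasure M {y. N y > t}) t. G z = 0"
        by (rule AE_I[OF _ e0]) (use A sets_eq_imp_space_eq[OF sr] in \<open>auto simp: sr\<close>)
    qed
  qed
  then have "((\<lambda>t. integral\<^sup>L (rescaled M (emeasure M {y. N y > t}) t) G) \<longlongrightarrow> 0) at_top" by (rule tendsto_eventually)
  then have "integral\<^sup>L L G = 0"
    using conv G tendsto_unique[OF trivial_limit_at_top_linorder] unfolding vague_conv_def by blast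
  then have "integral\<^sup>L (from_ext L) g = 0" unfolding integral_from_ext[OF sL inf G] by (simp only: Gext)
  moreover have "measure (from_ext L) {x. N x > 1} \<le> integral\<^sup>L (from_ext L) g"
  proof -
    have "measure (from_ext L) {x. N x > 1} = (LINT y|from_ext L. indicator {x. N x > 1} y)"
      using sets_eq_imp_space_eq[OF sets_from_ext[of L]] by simp
    also have "\<dots> \<le> integral\<^sup>L (from_ext L) g"
      using finite_away_norm(1,3)[OF N D zero_less_one] g1
      by (intro integral_mono integrable_away_test[OF D gt] integrable_real_indicator) (auto simp: indicator_def g_def)
    finally show ?thesis .
  qed
  ultimately show False using nn by linarith
qed

text \<open>Serves to pass from normalisation by tails of \<nu> \<circledast> \<rho> to
  normalisation by tails of \<nu>, which the definition of regular variation of \<nu>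
  prescribes.\<close>

lemma scaled_conv_rescale:
  fixes M D :: "(real^'n) measure"
  assumes D: "sets D = sets borel" and conv: "scaled_conv M V D" and lim: "((\<lambda>s. W s / V s) \<longlongrightarrow> c) at_top"
    and V: "\<And>s. s > 0 \<Longrightarrow> V s > 0" and c: "c > 0"
  shows "scaled_conv M W (density D (\<lambda>_. ennreal (1 / c)))"
  unfolding scaled_conv_def
proof
  fix f :: "real^'n \<Rightarrow> real" assume f: "f \<in> away_test"
  have fm: "f \<in> borel_measurable borel" using away_testE[OF f] by metis
  then have fD: "f \<in> borel_measurable D" using measurable_cong_sets[OF D refl] by blast
  have "((\<lambda>s. ((LINT y|M. f (inverse s *\<^sub>R y)) / V s) / (W s / V s)) \<longlongrightarrow> integral\<^sup>L D f / c) at_top"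
    using conv f c unfolding scaled_conv_def by (intro tendsto_divide lim) auto
  moreover have "eventually (\<lambda>s. ((LINT y|M. f (inverse s *\<^sub>R y)) / V s) / (W s / V s) = (LINT y|M. f (inverse s *\<^sub>R y)) / W s) at_top"
    using eventually_gt_at_top[of 0] by eventually_elim (use V in force)
  ultimately have "((\<lambda>s. (LINT y|M. f (inverse s *\<^sub>R y)) / W s) \<longlongrightarrow> integral\<^sup>L D f / c) at_top"
    by (rule Lim_transform_eventually)
  moreover have "integral\<^sup>L (density D (\<lambda>_. ennreal (1 / c))) f = integral\<^sup>L D f / c"
    using c fD by (subst integral_real_density) auto
  ultimately show "((\<lambda>s. (LINT y|M. f (inverse s *\<^sub>R y)) / W s) \<longlongrightarrow> integral\<^sup>L (density D (\<lambda>_. ennreal (1 / c))) f) at_top" by simp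
qed

theorem theorem2p3:
  fixes N :: "real ^ 'd \<Rightarrow> real"
    and \<nu> \<rho> :: "(real ^ 'd) measure"
    and \<mu> :: "(ereal ^ 'd) measure"
    and \<alpha> \<delta>' :: real
  assumes "is_norm N"
    and "\<alpha> > 0"
    and "sets \<rho> = sets borel" and "sigma_finite_measure \<rho>"
    and "sets \<nu> = sets borel" and "sigma_finite_measure \<nu>"
    and "\<And>i. emeasure \<rho> {x. x $ i = 0} = 0"
    and "RV N (\<nu> \<circledast> \<rho>) \<alpha> \<mu>"
    and "0 < \<delta>'" and "\<delta>' < \<alpha>"
    and "(\<integral>\<^sup>+ y. ennreal (max (N y powr (\<alpha> - \<delta>')) (N y powr (\<alpha> + \<delta>'))) \<partial>\<rho>) < \<infinity>"
    and "\<And>j. ((\<lambda>b::real. Limsup at_top (\<lambda>s::real.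
            (\<integral>\<^sup>+ y \<in> {y. 0 < \<bar>y $ j\<bar> \<and> \<bar>y $ j\<bar> \<le> b}. emeasure \<rho> {x. \<bar>x $ j\<bar> > s / \<bar>y $ j\<bar>} \<partial>\<nu>)
            / emeasure (\<nu> \<circledast> \<rho>) {x. N x > s})) \<longlongrightarrow> 0) (at_right 0)"
    and "\<And>(j::'d) (m :: 'd \<Rightarrow> nat) (\<theta> :: 'd \<Rightarrow> real). (\<And>k. m k \<in> {0, 1}) \<Longrightarrow>
          (LINT x|\<rho>. complex_of_real (\<bar>x $ j\<bar> powr \<alpha>)
             * (\<Prod>k\<in>UNIV. complex_of_real \<bar>x $ k\<bar> powr (\<i> * complex_of_real (\<theta> k)))
             * (\<Prod>k\<in>UNIV. complex_of_real (sgn (x $ k)) ^ m k)) \<noteq> 0"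
  shows "(\<exists>\<mu>'. RV N \<nu> \<alpha> \<mu>') \<and>
    (\<exists>\<mu>\<^sub>0. radon N \<mu>\<^sub>0 \<and> emeasure \<mu>\<^sub>0 infinite_points = 0 \<and>
      vague_conv (\<lambda>s. rescaled \<nu> (emeasure (\<nu> \<circledast> \<rho>) {x. N x > s}) s) \<mu>\<^sub>0 at_top \<and>
      restrict_space (from_ext \<mu>\<^sub>0 \<circledast> \<rho>) (- {0}) = restrict_space (from_ext \<mu>) (- {0}))"
proof -
  let ?M = "\<nu> \<circledast> \<rho>"
  have tm: "tail_measure N ?M \<mu>" and hom: "homogeneous \<mu> \<alpha>" using assms(8) by (auto simp: RV_def)
  have rad: "radon N \<mu>" and nz: "emeasure \<mu> (space \<mu>) \<noteq> 0" and inf: "emeasure \<mu> infinite_points = 0"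
    and Mfin: "\<And>r. r > 0 \<Longrightarrow> emeasure ?M {x. N x \<ge> r} < \<infinity>"
    and vc: "vague_conv (\<lambda>s. rescaled ?M (emeasure ?M {y. N y > s}) s) \<mu> at_top"
    using tm by (auto simp: tail_measure_def)
  note N = assms(1)
  have [measurable]: "N \<in> borel_measurable borel"
    by (intro borel_measurable_continuous_onI is_norm_continuous[OF N])
  obtain c where c: "c > 0" "\<And>x. c * norm x \<le> N x" using is_norm_lower[OF N] by blast
  have M: "finite_away ?M"
    unfolding finite_away_def
  proof (intro conjI allI impI)
    fix r :: real assume r: "r > 0"
    have "c * r \<le> N x" if "r \<le> norm x" for x using c mult_left_mono[OF that, of c] by (meson less_imp_le order_trans)
    then have "emeasure ?M {x. r \<le> norm x} \<le> emeasure ?M {x. N x \<ge> c * r}"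
      by (intro emeasure_mono) auto
    also have "\<dots> < \<infinity>" using c(1) r by (intro Mfin) simp
    finally show "emeasure ?M {x. r \<le> norm x} < \<infinity>" .
  qed simp
  define \<kappa> where "\<kappa> = measure (from_ext \<mu>) {x. N x > 1}"
  have kappa: "\<kappa> > 0" unfolding \<kappa>_def by (rule from_ext_nonnull[OF N rad hom nz inf])
  have pos: "measure ?M {x. N x > s} > 0" if "s > 0" for s
    by (rule rescaled_tail_pos[OF N M rad kappa[unfolded \<kappa>_def] inf vc that])
  have emM: "emeasure ?M {x. N x > s} = ennreal (measure ?M {x. N x > s})" if "s > 0" for s
    using finite_away_norm(3)[OF N M that] by (intro emeasure_eq_ennreal_measure) simp
  \<comment> \<open>For positive s the normaliser is finite, so the extended and the real form of
    the normalisation can differ only for s \<le> 0.\<close>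
  have vague_cong: "vague_conv (\<lambda>s. rescaled K (emeasure ?M {y. N y > s}) s) L at_top \<longleftrightarrow>
      vague_conv (\<lambda>s. rescaled K (ennreal (measure ?M {y. N y > s})) s) L at_top" for K :: "(real^'d) measure" and L
    unfolding vague_conv_def
  proof (intro ball_cong refl tendsto_cong)
    fix f :: "ereal^'d \<Rightarrow> real"
    show "eventually (\<lambda>s. integral\<^sup>L (rescaled K (emeasure ?M {y. N y > s}) s) f = integral\<^sup>L (rescaled K (ennreal (measure ?M {y. N y > s})) s) f) at_top"
      using eventually_gt_at_top[of 0] by eventually_elim (simp add: emM)
  qed
  have sc: "scaled_conv ?M (\<lambda>s. measure ?M {x. N x > s}) (from_ext \<mu>)"
    by (rule scaled_conv_if_vague_conv[OF M pos N rad inf vc[unfolded vague_cong]])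
  have mom: "integrable \<rho> (\<lambda>x. \<bar>x $ j\<bar> powr (\<alpha> + \<delta>'))" "integrable \<rho> (\<lambda>x. \<bar>x $ j\<bar> powr (\<alpha> - \<delta>'))" for j
    using moment_component[OF N assms(3,9,10,11)] by auto
  have "tauberian \<rho> \<alpha> N \<nu> (from_ext \<mu>) \<delta>' \<kappa>"
  proof (intro tauberian.intro nonvanishing.intro tauberian_axioms.intro)
    show "integrable \<rho> (\<lambda>x. \<bar>x $ j\<bar> powr \<alpha> * ln \<bar>x $ j\<bar> ^ k)" for j k
      by (rule moment_log[OF assms(3,9) mom])
    show "measure (from_ext \<mu>) {x. N x > t} = t powr (- \<alpha>) * \<kappa>" if "t > 0" for t
      unfolding \<kappa>_def by (rule measure_from_ext_homogeneous[OF N rad hom that])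
  qed (fact assms mom M pos sc finite_away_from_ext[OF N rad] kappa)+
  then interpret tauberian \<rho> \<alpha> N \<nu> "from_ext \<mu>" \<delta>' \<kappa> .
  obtain L where L: "tail_bounded L \<alpha>" "emeasure L {0} = 0" "L \<circledast> \<rho> = from_ext \<mu>" "scaled_conv \<nu> V L"
    using scaled_conv_nu by blast
  have sL: "sets L = sets borel" and fL: "finite_away L"
    using L(1) tail_bounded_finite_away[OF L(1)] by (auto simp: tail_bounded_def)
  note [measurable_cong] = sL
  have Lhom: "emeasure L ((\<lambda>y. inverse t *\<^sub>R y) -` B) = ennreal (t powr (- \<alpha>)) * emeasure L B"
    if "t > 0" "B \<in> sets borel" for t B
    by (rule limit_homogeneous[OF L(1,2,4) that])
  have V_eq: "V = (\<lambda>s. measure ?M {y. N y > s})" by (simp add: V_def fun_eq_iff)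
  have Lvague: "vague_conv (\<lambda>s. rescaled \<nu> (emeasure ?M {x. N x > s}) s) (to_ext L) at_top"
    unfolding vague_cong using vague_conv_if_scaled_conv[OF assms(5) sL pos L(4)[unfolded V_eq]] .
  \<comment> \<open>This will be the limit of the tails of \<nu> relative to those of \<nu>
    \<circledast> \<rho>, hence the factor between the two normalisations.\<close>
  define \<tau> where "\<tau> = measure L {x. N x > 1}"
  have Ltail: "measure L {x. N x > t} = t powr (- \<alpha>) * \<tau>" if t: "t > 0" for t
  proof -
    have "(\<lambda>y. inverse t *\<^sub>R y) -` {x. N x > 1} = {x. N x > t}" using t by (auto simp: is_norm_scale[OF N] field_simps)
    moreover have "{x. N x > 1} \<in> sets borel" by measurable
    ultimately have "emeasure L {x. N x > t} = ennreal (t powr (- \<alpha>)) * emeasure L {x. N x > 1}"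
      using Lhom[OF t, of "{x. N x > 1}"] by simp
    then show ?thesis by (simp add: measure_def enn2real_mult \<tau>_def)
  qed
  \<comment> \<open>With \<tau> = 0 all tails of \<open>L\<close> would vanish, hence
    \<open>L\<close> and its convolution with \<rho>, which is the non-null finite part of
    \<mu>.\<close>
  have lam: "\<tau> > 0"
  proof (rule ccontr)
    assume "\<not> ?thesis"
    then have l0: "\<tau> = 0" using measure_nonneg[of L] by (simp add: \<tau>_def not_less measure_le_0_iff)
    have z: "emeasure L {x. N x > 1 / real (Suc n)} = 0" for n
      using finite_away_norm(3)[OF N fL, of "1 / real (Suc n)"] Ltail[of "1 / real (Suc n)"] l0
      by (simp add: emeasure_eq_ennreal_measure)
    have "emeasure L (insert 0 (\<Union>n. {x. N x > 1 / real (Suc n)})) = 0"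
    proof -
      have "emeasure L (\<Union>n. {x. N x > 1 / real (Suc n)}) = 0"
        by (rule emeasure_UN_eq_0[OF z]) (use finite_away_norm(1)[OF N fL] in auto)
      moreover have "(\<Union>n. {x. N x > 1 / real (Suc n)}) \<in> sets L" using finite_away_norm(1)[OF N fL] by auto
      ultimately have "emeasure L ({0} \<union> (\<Union>n. {x. N x > 1 / real (Suc n)})) \<le> 0"
        using emeasure_subadditive[of "{0}" L "\<Union>n. {x. N x > 1 / real (Suc n)}"] L(2) by (simp add: sL)
      then show ?thesis by simp
    qed
    moreover have "x \<in> insert 0 (\<Union>n. {x. N x > 1 / real (Suc n)})" for x
    proof (cases "x = 0")
      case False
      then have "N x > 0" using is_norm_nonneg[OF N, of x] N by (auto simp: is_norm_def le_less)
      then obtain n where "1 / real (Suc n) < N x" using nat_approx_posE by blast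
      then show ?thesis by blast
    qed simp
    ultimately have L0: "emeasure L UNIV = 0" by (metis UNIV_eq_I)
    have "emeasure L A = 0" for A
      using emeasure_mono[of A UNIV L] sets.top[of L] sets_eq_imp_space_eq[OF sL] L0 by simp
    then have "emeasure (from_ext \<mu>) {x. N x > 1} = 0"
      unfolding L(3)[symmetric]
      by (subst emeasure_mult_conv[OF assms(3) sL tail_bounded_sigma_finite[OF L(1,2)]]) auto
    then show False using kappa by (simp add: \<kappa>_def measure_def)
  qed
  have nuV: "((\<lambda>s. measure \<nu> {x. N x > s} / V s) \<longlongrightarrow> \<tau>) at_top"
    using scaled_conv_tail[OF N nu_fin fL V_pos L(4) Ltail zero_less_one] by simp
  \<comment> \<open>Two multiples of one measure are delivered: \<open>L\<close> solves the
    convolution equation, and \<open>L'\<close> is the tail measure of \<nu> normalised by its own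
    tails.\<close>
  define L' where "L' = density L (\<lambda>_. ennreal (1 / \<tau>))"
  have sL': "sets L' = sets borel" by (simp add: L'_def sL)
  have emL': "emeasure L' A = ennreal (1 / \<tau>) * emeasure L A" if "A \<in> sets borel" for A
    unfolding L'_def using that by (subst emeasure_density) (auto simp: sL nn_integral_cmult_indicator)
  have fL': "finite_away L'"
    unfolding finite_away_def
  proof (intro conjI allI impI)
    fix r :: real assume "r > 0"
    then show "emeasure L' {x. r \<le> norm x} < \<infinity>"
      using fL by (subst emL') (auto simp: finite_away_def ennreal_mult_less_top)
  qed (rule sL')
  \<comment> \<open>The conversion to vague convergence asks for positivity at every s > 0. A
    vanishing tail would make the quotient vanish from there on, against \<tau> > 0.\<close>
  have numpos: "measure \<nu> {x. N x > s} > 0" if "s > 0" for s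
  proof (rule ccontr)
    assume "\<not> ?thesis"
    then have s0: "measure \<nu> {x. N x > s} = 0" using measure_nonneg[of \<nu> "{x. N x > s}"] by linarith
    have m0: "measure \<nu> {x. N x > t} = 0" if "t \<ge> s" for t
    proof -
      have "emeasure \<nu> {x. N x > t} \<le> emeasure \<nu> {x. N x > s}"
        using that finite_away_norm(1)[OF N nu_fin \<open>s > 0\<close>] by (intro emeasure_mono) auto
      also have "\<dots> = 0" using s0 finite_away_norm(3)[OF N nu_fin \<open>s > 0\<close>] by (simp add: emeasure_eq_ennreal_measure)
      finally show ?thesis by (simp add: measure_def)
    qed
    have "eventually (\<lambda>t. measure \<nu> {x. N x > t} / V t = 0) at_top"
      using eventually_ge_at_top[of s] by eventually_elim (simp add: m0)
    then have "((\<lambda>t. measure \<nu> {x. N x > t} / V t) \<longlongrightarrow> 0) at_top" by (rule tendsto_eventually)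
    then show False using nuV lam tendsto_unique[OF trivial_limit_at_top_linorder] by blast
  qed
  have conv': "scaled_conv \<nu> (\<lambda>s. measure \<nu> {x. N x > s}) L'"
    unfolding L'_def by (rule scaled_conv_rescale[OF sL L(4) nuV V_pos lam])
  have vc0: "vague_conv (\<lambda>s. rescaled \<nu> (ennreal (measure \<nu> {x. N x > s})) s) (to_ext L') at_top"
    by (rule vague_conv_if_scaled_conv[OF assms(5) sL' numpos conv'])
  have ev: "eventually (\<lambda>s. integral\<^sup>L (rescaled \<nu> (emeasure \<nu> {y. N y > s}) s) f = integral\<^sup>L (rescaled \<nu> (ennreal (measure \<nu> {y. N y > s})) s) f) at_top" for f :: "ereal^'d \<Rightarrow> real"
    using eventually_gt_at_top[of 0]
  proof eventually_elim
    case (elim s)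
    show ?case using finite_away_norm(3)[OF N nu_fin elim] by (simp add: emeasure_eq_ennreal_measure)
  qed
  have vc': "vague_conv (\<lambda>s. rescaled \<nu> (emeasure \<nu> {y. N y > s}) s) (to_ext L') at_top"
    using vc0 unfolding vague_conv_def tendsto_cong[OF ev] .
  have "homogeneous (to_ext L') \<alpha>"
  proof (rule homogeneous_to_ext[OF sL'])
    fix t :: real and B :: "(real^'d) set" assume t: "t > 0" and B: "B \<in> sets borel"
    have "(\<lambda>y. inverse t *\<^sub>R y) -` B \<in> sets borel"
      using measurable_sets[of "\<lambda>y. inverse t *\<^sub>R y" borel borel B] B by simp
    then show "emeasure L' ((\<lambda>y. inverse t *\<^sub>R y) -` B) = ennreal (t powr (- \<alpha>)) * emeasure L' B"
      using B by (simp add: emL' Lhom[OF t B] mult.left_commute)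
  qed
  moreover have "emeasure (to_ext L') (space (to_ext L')) \<noteq> 0"
  proof
    assume a: "emeasure (to_ext L') (space (to_ext L')) = 0"
    have "space (to_ext L') = - {0}" using sets_eq_imp_space_eq[OF sets_to_ext] by simp
    moreover have "- {0::ereal^'d} \<in> sets ext_space" by (simp add: sets_ext_space nonzero_sets)
    ultimately have "emeasure L' {y. ext y \<in> - {0}} = 0" using a emeasure_to_ext[OF sL'] by simp
    moreover have "N 0 = 0" using N unfolding is_norm_def by blast
    then have "{x. N x > 1} \<subseteq> {y. ext y \<in> - {0}}" by auto
    moreover have "{y. ext y \<in> - {0}} \<in> sets L'" by (simp add: sL' Compl_eq[symmetric]) 
    ultimately have "emeasure L' {x. N x > 1} = 0" by (metis emeasure_mono le_zero_eq)
    then have "emeasure L {x. N x > 1} = 0" using lam by (subst (asm) emL') auto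
    then show False using lam by (simp add: \<tau>_def measure_def)
  qed
  ultimately have "RV N \<nu> \<alpha> (to_ext L')"
    unfolding RV_def tail_measure_def
    using assms(2,5,6) radon_to_ext[OF N fL'] vc' finite_away_norm(4)[OF N nu_fin] by auto
  moreover have "from_ext (to_ext L) \<circledast> \<rho> = from_ext \<mu>"
    by (simp add: from_ext_to_ext[OF sL L(2)] L(3))
  ultimately show ?thesis
    using radon_to_ext[OF N fL] Lvague by (intro conjI exI[of _ "to_ext L'"] exI[of _ "to_ext L"]) auto
qed

end
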